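(* Let $H$ be a finite-dimensional Hopf algebra over a field $\Bbbk$ of positive characteristic. Then $\exp_0(H)<\infty$.
   Context: Let $(H,m,u,\Delta,\varepsilon)$ be a Hopf algebra over a field $\Bbbk$. For $n\ge 1$ let $m_n:H^{\otimes n}\to H$, $h_1\otimes\cdots\otimes h_n\mapsto h_1\cdots h_n$, and $\Delta_n:H\to H^{\otimes n}$, $h\mapsto\sum h_{(1)}\otimes\cdots\otimes h_{(n)}$. Define $\exp_0(H):=\min\{n\ge 1\mid m_n\circ\Delta_n=u\circ\varepsilon\}$, with $\min\varnothing=\infty$. *)

theory Defs
  imports Complex_Main "HOL-Library.Poly_Mapping" "HOL-Library.Extended_Nat"
begin

section \<open>Formal linear combinations\<close>

definition fscale :: "'k::field \<Rightarrow> ('a \<Rightarrow>\<^sub>0 'k) \<Rightarrow> ('a \<Rightarrow>\<^sub>0 'k)" where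
  "fscale c p = Poly_Mapping.map ((*) c) p"

lemma lookup_fscale [simp]: "Poly_Mapping.lookup (fscale c p) x = c * Poly_Mapping.lookup p x"
  by (simp add: fscale_def Poly_Mapping.map.rep_eq when_def)

global_interpretation formal: vector_space "fscale :: 'k::field \<Rightarrow> ('a \<Rightarrow>\<^sub>0 'k) \<Rightarrow> _"
  by unfold_locales (auto intro!: poly_mapping_eqI simp: lookup_add algebra_simps)

text \<open>\<open>fext f\<close> is the linear extension of \<open>f\<close> and \<open>fext2 f\<close> the bilinear extension of \<open>f\<close>.\<close>

definition fext :: "('a \<Rightarrow> ('b \<Rightarrow>\<^sub>0 'k)) \<Rightarrow> ('a \<Rightarrow>\<^sub>0 'k::field) \<Rightarrow> ('b \<Rightarrow>\<^sub>0 'k)" where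
  "fext f p = (\<Sum>x\<in>Poly_Mapping.keys p. fscale (Poly_Mapping.lookup p x) (f x))"

definition fext2 :: "('a \<Rightarrow> 'b \<Rightarrow> 'c) \<Rightarrow> ('a \<Rightarrow>\<^sub>0 'k::field) \<Rightarrow> ('b \<Rightarrow>\<^sub>0 'k) \<Rightarrow> ('c \<Rightarrow>\<^sub>0 'k)" where
  "fext2 f p q = fext (\<lambda>x. fext (\<lambda>y. Poly_Mapping.single (f x y) 1) q) p"

section \<open>Tensor powers of a vector space\<close>

text \<open>
  The \<open>n\<close>-th tensor power of \<open>V\<close> is the free vector space on \<open>V\<^sup>n\<close> (lists of length \<open>n\<close>) modulo
  the subspace spanned by the multilinearity relations. Its elements are equivalence classes, i.e.
  sets of formal linear combinations; an operation on tensors is given on representatives and is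
  collected with a union over all of them, which is again a single class when the operation is
  well defined.
\<close>

locale tensor_powers = vector_space scale
  for scale :: "'a::field \<Rightarrow> 'b::ab_group_add \<Rightarrow> 'b"
begin

definition free_tensors :: "nat \<Rightarrow> ('b list \<Rightarrow>\<^sub>0 'a) set" where
  "free_tensors n = {p. Poly_Mapping.keys p \<subseteq> {xs. length xs = n}}"

definition multilinearity_relators :: "nat \<Rightarrow> ('b list \<Rightarrow>\<^sub>0 'a) set" where
  "multilinearity_relators n =
     {Poly_Mapping.single (xs @ (a + b) # ys) 1 - Poly_Mapping.single (xs @ a # ys) 1
        - Poly_Mapping.single (xs @ b # ys) 1 | xs a b ys. Suc (length xs + length ys) = n} \<union>
     {Poly_Mapping.single (xs @ scale c a # ys) 1 - Poly_Mapping.single (xs @ a # ys) c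
        | xs c a ys. Suc (length xs + length ys) = n}"

definition tensor_rel :: "nat \<Rightarrow> (('b list \<Rightarrow>\<^sub>0 'a) \<times> ('b list \<Rightarrow>\<^sub>0 'a)) set" where
  "tensor_rel n = {(p, q). p \<in> free_tensors n \<and> q \<in> free_tensors n \<and>
     p - q \<in> formal.span (multilinearity_relators n)}"

definition tensor_power :: "nat \<Rightarrow> ('b list \<Rightarrow>\<^sub>0 'a) set set" where
  "tensor_power n = free_tensors n // tensor_rel n"

definition pure_tensor :: "'b list \<Rightarrow> ('b list \<Rightarrow>\<^sub>0 'a) set" where
  "pure_tensor xs = tensor_rel (length xs) `` {Poly_Mapping.single xs 1}"

definition tensor_add ::
  "nat \<Rightarrow> ('b list \<Rightarrow>\<^sub>0 'a) set \<Rightarrow> ('b list \<Rightarrow>\<^sub>0 'a) set \<Rightarrow> ('b list \<Rightarrow>\<^sub>0 'a) set" where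
  "tensor_add n X Y = (\<Union>p\<in>X. \<Union>q\<in>Y. tensor_rel n `` {p + q})"

definition tensor_scale ::
  "nat \<Rightarrow> 'a \<Rightarrow> ('b list \<Rightarrow>\<^sub>0 'a) set \<Rightarrow> ('b list \<Rightarrow>\<^sub>0 'a) set" where
  "tensor_scale n c X = (\<Union>p\<in>X. tensor_rel n `` {fscale c p})"

text \<open>
  For linear maps \<open>F : V \<rightarrow> V\<^sup>\<otimes>\<^sup>i\<close> and \<open>G : V \<rightarrow> V\<^sup>\<otimes>\<^sup>j\<close>, the map
  \<open>F \<otimes> G : V \<otimes> V \<rightarrow> V\<^sup>\<otimes>\<^sup>(\<^sup>i\<^sup>+\<^sup>j\<^sup>)\<close>. Here \<open>f\<close> and \<open>g\<close> range over all choices of representatives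
  of the values of \<open>F\<close> and \<open>G\<close>.
\<close>

definition tensor_map2 ::
  "nat \<Rightarrow> nat \<Rightarrow> ('b \<Rightarrow> ('b list \<Rightarrow>\<^sub>0 'a) set) \<Rightarrow> ('b \<Rightarrow> ('b list \<Rightarrow>\<^sub>0 'a) set)
     \<Rightarrow> ('b list \<Rightarrow>\<^sub>0 'a) set \<Rightarrow> ('b list \<Rightarrow>\<^sub>0 'a) set" where
  "tensor_map2 i j F G X =
     (\<Union>p\<in>X. \<Union>f\<in>{f. \<forall>h. f h \<in> F h}. \<Union>g\<in>{g. \<forall>h. g h \<in> G h}.
        tensor_rel (i + j) `` {fext (\<lambda>xs. fext2 (@) (f (xs ! 0)) (g (xs ! 1))) p})"

text \<open>
  The linear map on a tensor power with values in \<open>V\<close> that is induced by a multilinear map \<open>f\<close>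
  (unspecified if \<open>f\<close> is not multilinear).
\<close>

definition tensor_lift :: "('b list \<Rightarrow> 'b) \<Rightarrow> ('b list \<Rightarrow>\<^sub>0 'a) set \<Rightarrow> 'b" where
  "tensor_lift f X = the_elem ((\<lambda>p. \<Sum>xs\<in>Poly_Mapping.keys p. scale (Poly_Mapping.lookup p xs) (f xs)) ` X)"

end

section \<open>Hopf algebras\<close>

text \<open>
  The ring structure of the type \<open>'h\<close> provides multiplication and unit; the unit map
  \<open>u : k \<rightarrow> H\<close> is \<open>\<lambda>c. scale c 1\<close>. In the counit axioms \<open>k \<otimes> H\<close> and \<open>H \<otimes> k\<close> are
  identified with \<open>H\<close>.
\<close>

locale bialgebra = tensor_powers scale
  for scale :: "'k::field \<Rightarrow> 'h::ring_1 \<Rightarrow> 'h" +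
  fixes comult :: "'h \<Rightarrow> ('h list \<Rightarrow>\<^sub>0 'k) set"
    and counit :: "'h \<Rightarrow> 'k"
  assumes scale_mult_left: "scale c a * b = scale c (a * b)"
    and scale_mult_right: "a * scale c b = scale c (a * b)"
    and comult_tensor: "comult a \<in> tensor_power 2"
    and comult_add: "comult (a + b) = tensor_add 2 (comult a) (comult b)"
    and comult_scale: "comult (scale c a) = tensor_scale 2 c (comult a)"
    and counit_linear: "Vector_Spaces.linear scale (*) counit"
    and coassoc:
      "tensor_map2 2 1 comult (\<lambda>h. pure_tensor [h]) (comult a) =
       tensor_map2 1 2 (\<lambda>h. pure_tensor [h]) comult (comult a)"
    and counit_left: "tensor_lift (\<lambda>xs. scale (counit (xs ! 0)) (xs ! 1)) (comult a) = a"
    and counit_right: "tensor_lift (\<lambda>xs. scale (counit (xs ! 1)) (xs ! 0)) (comult a) = a"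
    and comult_mult: "comult (a * b) =
      (\<Union>p\<in>comult a. \<Union>q\<in>comult b. tensor_rel 2 `` {fext2 (map2 (*)) p q})"
    and comult_one: "comult 1 = pure_tensor [1, 1]"
    and counit_mult: "counit (a * b) = counit a * counit b"
    and counit_one: "counit 1 = 1"
begin

definition mult_n :: "('h list \<Rightarrow>\<^sub>0 'k) set \<Rightarrow> 'h" where
  "mult_n = tensor_lift prod_list"

text \<open>
  \<open>comult_n n : H \<rightarrow> H\<^sup>\<otimes>\<^sup>n\<close> for \<open>n \<ge> 1\<close>; by convention \<open>comult_n 0\<close> is the counit, since
  \<open>H\<^sup>\<otimes>\<^sup>0 = k\<close>.
\<close>

fun comult_n :: "nat \<Rightarrow> 'h \<Rightarrow> ('h list \<Rightarrow>\<^sub>0 'k) set" where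
  "comult_n 0 = (\<lambda>h. tensor_rel 0 `` {Poly_Mapping.single [] (counit h)})"
| "comult_n (Suc 0) = (\<lambda>h. pure_tensor [h])"
| "comult_n (Suc (Suc n)) =
     (\<lambda>h. tensor_map2 (Suc n) 1 (comult_n (Suc n)) (\<lambda>x. pure_tensor [x]) (comult h))"

text \<open>The infimum of the empty set in \<^typ>\<open>enat\<close> is \<^term>\<open>\<infinity> :: enat\<close>.\<close>

definition exp0 :: enat where
  "exp0 = Inf (enat ` {n. n \<ge> 1 \<and> (\<forall>h. mult_n (comult_n n h) = scale (counit h) 1)})"

end

locale hopf_algebra = bialgebra scale comult counit
  for scale :: "'k::field \<Rightarrow> 'h::ring_1 \<Rightarrow> 'h" and comult counit +
  assumes antipode_exists: "\<exists>S. Vector_Spaces.linear scale scale S \<and>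
    (\<forall>h. tensor_lift (\<lambda>xs. S (xs ! 0) * xs ! 1) (comult h) = scale (counit h) 1 \<and>
         tensor_lift (\<lambda>xs. xs ! 0 * S (xs ! 1)) (comult h) = scale (counit h) 1)"

end

theory Submission
  imports Defs "Jordan_Normal_Form.Determinant" "HOL-Algebra.Algebraic_Closure_Type" "HOL-Library.Function_Algebras"
begin

text \<open>
  Let \<open>K\<close> be an algebraic closure of \<open>k\<close>. The \<open>n\<close>-th power of the operator
  \<open>\<sigma>(g \<otimes> m) = g m\<^sub>1 \<otimes> m\<^sub>2\<close> on \<open>H \<otimes> H\<close> is \<open>g \<otimes> m \<mapsto> g (m\<^sub>1 \<cdots> m\<^sub>n) \<otimes> m\<^sub>n\<^sub>+\<^sub>1\<close>, so \<open>exp\<^sub>0\<close> is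
  finite as soon as \<open>\<sigma>\<close> has finite order, and in positive characteristic it suffices that the
  eigenvalues of \<open>\<sigma>\<close> over \<open>K\<close> are roots of unity.

  Now \<open>\<sigma>\<close> is the canonical automorphism \<open>m \<mapsto> m\<^sub>(\<^sub>-\<^sub>1\<^sub>)m\<^sub>(\<^sub>0\<^sub>)\<close> of an anti-Yetter-Drinfeld module
  structure on \<open>H \<otimes> H\<close>; hence it commutes with the action and the coaction, and every eigenspace
  \<open>M\<close> is again such a module. On \<open>H \<otimes> M\<close> consider
  \<open>T(f \<otimes> m) = f\<^sub>1 \<otimes> f\<^sub>2m\<close>, \<open>T'(f \<otimes> m) = f\<^sub>2 \<otimes> f\<^sub>1m\<close>,
  \<open>G(f \<otimes> m) = fm\<^sub>(\<^sub>-\<^sub>1\<^sub>) \<otimes> m\<^sub>(\<^sub>0\<^sub>)\<close> and \<open>G'(f \<otimes> m) = m\<^sub>(\<^sub>-\<^sub>1\<^sub>)f \<otimes> m\<^sub>(\<^sub>0\<^sub>)\<close>. Each of them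
  satisfies a pentagon equation on \<open>H \<otimes> H \<otimes> M\<close>, which forces its determinant to be a root of
  unity. The module condition reads \<open>G' (S\<^sup>-\<^sup>2 \<otimes> 1) T' (1 \<otimes> \<sigma>) = T G\<close>, so \<open>det \<sigma>\<close> on a power of
  \<open>M\<close> equals \<open>det S\<^sup>2\<close> up to roots of unity. Taking \<open>M = H \<otimes> H\<close>, where \<open>\<sigma>\<close> itself satisfies a pentagon
  equation, shows that \<open>det S\<^sup>2\<close> is a root of unity; taking for \<open>M\<close> an eigenspace then gives the claim.
  All this is carried out on \<open>K\<close>-valued multilinear forms, which replace elements of tensor powers.
\<close>

section \<open>Determinants and periodicity of endomorphisms\<close>

locale linear_endomorphisms = vector_space scale
  for scale :: "'a::field \<Rightarrow> 'b::ab_group_add \<Rightarrow> 'b"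
begin

definition endo_on :: "'b set \<Rightarrow> ('b \<Rightarrow> 'b) \<Rightarrow> bool" where
  "endo_on W F \<longleftrightarrow> (\<forall>x\<in>W. F x \<in> W) \<and> (\<forall>x\<in>W. \<forall>y\<in>W. F (x + y) = F x + F y) \<and>
     (\<forall>c. \<forall>x\<in>W. F (scale c x) = scale c (F x))"

lemma endo_on_sum:
  assumes "endo_on W F" "subspace W" "finite I" "\<And>i. i \<in> I \<Longrightarrow> x i \<in> W"
  shows "F (\<Sum>i\<in>I. scale (c i) (x i)) = (\<Sum>i\<in>I. scale (c i) (F (x i)))"
  using assms(3,4)
proof (induction I)
  case empty
  have "F (scale 0 0) = scale 0 (F 0)"
    using assms(1,2) subspace_0 unfolding endo_on_def by blast
  then show ?case by simp
next
  case (insert i I)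
  then have "(\<Sum>i\<in>I. scale (c i) (x i)) \<in> W"
    using assms(2) by (intro subspace_sum subspace_scale) auto
  with insert show ?case
    using assms(1,2) by (simp add: endo_on_def subspace_scale)
qed

lemma endo_on_diff:
  assumes "endo_on W F" "subspace W" "u \<in> W" "v \<in> W"
  shows "F (u - scale a v) = F u - scale a (F v)"
proof -
  have "F (u + scale (- a) v) = F u + F (scale (- a) v)"
    using assms subspace_scale unfolding endo_on_def by blast
  also have "F (scale (- a) v) = scale (- a) (F v)"
    using assms unfolding endo_on_def by blast
  finally show ?thesis by simp
qed

lemma endo_on_0: "endo_on W F \<Longrightarrow> subspace W \<Longrightarrow> F 0 = 0"
  using endo_on_sum[of W F "{}"] by simp

text \<open>The determinant of the restriction to \<open>W\<close>, computed in a basis of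
  \<open>W\<close> and packaged as a functional on total functions. The later argument uses only
  these five properties; \<open>N\<close> is the dimension of \<open>W\<close>.\<close>

lemma det_functional:
  assumes W: "subspace W" and "finite B" and "W \<subseteq> span B"
  obtains \<delta> :: "('b \<Rightarrow> 'b) \<Rightarrow> 'a" and N :: nat where
    "\<And>F G. endo_on W F \<Longrightarrow> endo_on W G \<Longrightarrow> \<delta> (\<lambda>x. F (G x)) = \<delta> F * \<delta> G"
    "\<And>F G. (\<And>x. x \<in> W \<Longrightarrow> F x = G x) \<Longrightarrow> \<delta> F = \<delta> G"
    "\<And>c. \<delta> (\<lambda>x. scale c x) = c ^ N"
    "\<And>F. endo_on W F \<Longrightarrow> inj_on F W \<Longrightarrow> \<delta> F \<noteq> 0"
    "W \<noteq> {0} \<Longrightarrow> N > 0"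
proof -
  obtain C where C: "C \<subseteq> W" "independent C" "W \<subseteq> span C"
    using maximal_independent_subset by blast
  have fin: "finite C"
    using independent_span_bound[OF assms(2) C(2)] C(1) assms(3) by blast
  obtain cs where cs: "set cs = C" "distinct cs"
    using finite_distinct_list[OF fin] by blast
  define N where "N = length cs"
  have csW: "cs ! i \<in> W" if "i < N" for i
    using that cs C(1) by (auto simp: N_def)
  have nth_eq: "cs ! i = cs ! j \<longleftrightarrow> i = j" if "i < N" "j < N" for i j
    using that cs(2) by (simp add: N_def nth_eq_iff_index_eq)
  define R where "R x i = representation C x (cs ! i)" for x i
  have expand: "x = (\<Sum>i<N. scale (R x i) (cs ! i))" if "x \<in> W" for x
  proof -
    have "x = (\<Sum>b\<in>C. scale (representation C x b) b)"
      using sum_representation_eq[OF C(2) _ fin order_refl] that C(3) by auto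
    also have "\<dots> = (\<Sum>i<N. scale (R x i) (cs ! i))"
      unfolding R_def
      by (rule sum.reindex_bij_betw[symmetric])
         (use cs in \<open>auto simp: N_def intro: bij_betw_nth\<close>)
    finally show ?thesis .
  qed
  have R_sum: "R (\<Sum>k<N. scale (c k) (x k)) i = (\<Sum>k<N. c k * R (x k) i)"
    if "\<And>k. k < N \<Longrightarrow> x k \<in> W" for c x i
  proof -
    have "representation C (\<Sum>k<N. scale (c k) (x k)) = (\<lambda>b. \<Sum>k<N. representation C (scale (c k) (x k)) b)"
      by (rule representation_sum[OF C(2)]) (use that C(3) in \<open>auto intro!: span_scale\<close>)
    moreover have "representation C (scale (c k) (x k)) = (\<lambda>b. c k * representation C (x k) b)" if "k < N" for k
      by (rule representation_scale[OF C(2)]) (use \<open>\<And>k. k < N \<Longrightarrow> x k \<in> W\<close> that C(3) in auto)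
    ultimately show ?thesis by (simp add: R_def)
  qed
  have R_basis: "R (cs ! j) i = (if i = j then 1 else 0)" if "i < N" "j < N" for i j
    using that representation_basis[OF C(2), of "cs ! j"] cs nth_eq[OF that]
    by (auto simp: R_def N_def)
  define M where "M F = mat N N (\<lambda>(i, j). R (F (cs ! j)) i)" for F
  have M_carrier: "M F \<in> carrier_mat N N" for F by (simp add: M_def)
  define \<delta> where "\<delta> F = det (M F)" for F
  show thesis
  proof (rule that[of \<delta> N])
    fix F G assume F: "endo_on W F" and G: "endo_on W G"
    have "M (\<lambda>x. F (G x)) = M F * M G"
    proof (rule eq_matI)
      fix i j assume "i < dim_row (M F * M G)" "j < dim_col (M F * M G)"
      then have ij: "i < N" "j < N" by (auto simp: M_def)
      have GW: "G (cs ! j) \<in> W" using G csW[OF ij(2)] by (simp add: endo_on_def)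
      have "F (G (cs ! j)) = F (\<Sum>k<N. scale (R (G (cs ! j)) k) (cs ! k))"
        using expand[OF GW] by simp
      also have "\<dots> = (\<Sum>k<N. scale (R (G (cs ! j)) k) (F (cs ! k)))"
        by (rule endo_on_sum[OF F W]) (use csW in auto)
      finally have "R (F (G (cs ! j))) i = (\<Sum>k<N. R (G (cs ! j)) k * R (F (cs ! k)) i)"
        using R_sum[of "\<lambda>k. F (cs ! k)"] F csW by (simp add: endo_on_def)
      then show "M (\<lambda>x. F (G x)) $$ (i, j) = (M F * M G) $$ (i, j)"
        using ij by (simp add: M_def scalar_prod_def mult.commute atLeast0LessThan)
    qed (simp_all add: M_def)
    then show "\<delta> (\<lambda>x. F (G x)) = \<delta> F * \<delta> G"
      using det_mult[OF M_carrier M_carrier] by (simp add: \<delta>_def)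
  next
    fix F G :: "'b \<Rightarrow> 'b" assume "\<And>x. x \<in> W \<Longrightarrow> F x = G x"
    then have "M F = M G" using csW by (auto simp: M_def intro!: cong_mat)
    then show "\<delta> F = \<delta> G" by (simp add: \<delta>_def)
  next
    fix c
    have "R (scale c (cs ! j)) i = c * R (cs ! j) i" if "j < N" for i j
    proof -
      have "cs ! j \<in> span C" using csW[OF that] C(3) by blast
      then show ?thesis unfolding R_def by (subst representation_scale[OF C(2)]) auto
    qed
    then have "M (\<lambda>x. scale c x) = c \<cdot>\<^sub>m 1\<^sub>m N"
      by (intro eq_matI) (auto simp: M_def R_basis)
    then show "\<delta> (\<lambda>x. scale c x) = c ^ N"
      by (simp add: \<delta>_def)
  next
    fix F assume F: "endo_on W F" and inj: "inj_on F W"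
    show "\<delta> F \<noteq> 0"
    proof
      assume "\<delta> F = 0"
      then obtain v where v: "v \<in> carrier_vec N" "v \<noteq> 0\<^sub>v N" "M F *\<^sub>v v = 0\<^sub>v N"
        unfolding \<delta>_def using det_0_iff_vec_prod_zero[OF M_carrier] by blast
      define x where "x = (\<Sum>k<N. scale (v $ k) (cs ! k))"
      have xW: "x \<in> W" unfolding x_def
        using csW W by (intro subspace_sum subspace_scale) auto
      have Fx: "F x = (\<Sum>k<N. scale (v $ k) (F (cs ! k)))"
        unfolding x_def by (rule endo_on_sum[OF F W]) (use csW in auto)
      have "R (F x) i = 0" if "i < N" for i
      proof -
        have "R (F x) i = (\<Sum>k<N. v $ k * R (F (cs ! k)) i)"
          unfolding Fx using R_sum[of "\<lambda>k. F (cs ! k)"] F csW by (simp add: endo_on_def)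
        also have "\<dots> = (M F *\<^sub>v v) $ i"
          using that v(1) by (simp add: M_def scalar_prod_def mult.commute atLeast0LessThan)
        finally show ?thesis using v(3) that by simp
      qed
      moreover have FxW: "F x \<in> W" using F xW by (simp add: endo_on_def)
      ultimately have "F x = 0" using expand[OF FxW] by simp
      moreover have "F 0 = 0" using endo_on_0[OF F W] .
      ultimately have x0: "x = 0" using inj xW subspace_0[OF W] by (auto simp: inj_on_def)
      have "v $ i = 0" if "i < N" for i
      proof -
        have "R x i = (\<Sum>k<N. v $ k * R (cs ! k) i)"
          unfolding x_def by (rule R_sum) (use csW in auto)
        also have "\<dots> = (\<Sum>k<N. if k = i then v $ k else 0)"
          using that by (intro sum.cong) (auto simp: R_basis)
        also have "\<dots> = v $ i" using that by simp
        finally show ?thesis using x0 by (simp add: R_def representation_zero)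
      qed
      then have "v = 0\<^sub>v N" using v(1) by (intro eq_vecI) auto
      with v(2) show False by contradiction
    qed
  next
    assume "W \<noteq> {0}"
    moreover have "W = {0}" if "N = 0"
      using that cs C subspace_0[OF W] by (auto simp: N_def span_empty)
    ultimately show "N > 0" by blast
  qed
qed

end

section \<open>Periodic vectors of an endomorphism over an algebraically closed field\<close>

locale alg_closed_space = linear_endomorphisms scale
  for scale :: "'a::alg_closed_field \<Rightarrow> 'b::ab_group_add \<Rightarrow> 'b"
begin

definition poly_act :: "('b \<Rightarrow> 'b) \<Rightarrow> 'a poly \<Rightarrow> 'b \<Rightarrow> 'b" where
  "poly_act F p x = (\<Sum>i\<le>Polynomial.degree p. scale (poly.coeff p i) ((F ^^ i) x))"

lemma poly_act_ge: "Polynomial.degree p \<le> n \<Longrightarrow> poly_act F p x = (\<Sum>i\<le>n. scale (poly.coeff p i) ((F ^^ i) x))"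
  unfolding poly_act_def
  by (rule sum.mono_neutral_left) (auto simp: coeff_eq_0)

lemma funpow_closed: "endo_on W F \<Longrightarrow> x \<in> W \<Longrightarrow> (F ^^ i) x \<in> W"
  by (induction i) (auto simp: endo_on_def)

lemma poly_act_linear_factor:
  assumes F: "endo_on W F" and W: "subspace W" and x: "x \<in> W"
  shows "poly_act F (p * [:-a, 1:]) x = poly_act F p (F x - scale a x)"
proof -
  define n where "n = Suc (Polynomial.degree p)"
  have pow: "(F ^^ i) (F x - scale a x) = (F ^^ Suc i) x - scale a ((F ^^ i) x)" for i
  proof (induction i)
    case (Suc i)
    have closed: "(F ^^ j) x \<in> W" for j using funpow_closed[OF F x] .
    show ?case using endo_on_diff[OF F W closed[of "Suc i"] closed[of i]] Suc by simp
  qed simp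
  have c0: "poly.coeff p n = 0" by (simp add: n_def coeff_eq_0)
  have eq: "p * [:-a, 1:] = pCons 0 p - Polynomial.smult a p" by simp
  have deg: "Polynomial.degree (p * [:-a, 1:]) \<le> n"
    unfolding n_def by (rule order_trans[OF degree_mult_le]) simp
  have "poly_act F (p * [:-a, 1:]) x = (\<Sum>i\<le>n. scale (poly.coeff (p * [:-a, 1:]) i) ((F ^^ i) x))"
    by (rule poly_act_ge[OF deg])
  also have "\<dots> = (\<Sum>i\<le>n. scale (poly.coeff (pCons 0 p) i) ((F ^^ i) x)) - (\<Sum>i\<le>n. scale (a * poly.coeff p i) ((F ^^ i) x))"
    unfolding eq by (simp add: scale_left_diff_distrib sum_subtractf)
  also have "(\<Sum>i\<le>n. scale (poly.coeff (pCons 0 p) i) ((F ^^ i) x)) = (\<Sum>i\<le>Polynomial.degree p. scale (poly.coeff p i) ((F ^^ Suc i) x))"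
    unfolding n_def by (subst sum.atMost_Suc_shift) simp
  also have "(\<Sum>i\<le>n. scale (a * poly.coeff p i) ((F ^^ i) x)) = (\<Sum>i\<le>Polynomial.degree p. scale (a * poly.coeff p i) ((F ^^ i) x))"
    using c0 by (simp add: n_def)
  finally show ?thesis
    unfolding poly_act_def pow
    by (simp add: scale_right_diff_distrib sum_subtractf mult.commute)
qed

text \<open>The first \<open>card B + 1\<close> iterates of \<open>x\<close> cannot be distinct and
  independent. If two coincide, a difference of monomials annihilates \<open>x\<close>; otherwise
  the coefficients of a linear relation form the polynomial.\<close>

lemma annihilating_poly:
  assumes "finite B" "W \<subseteq> span B" "endo_on W F" "x \<in> W"
  obtains p where "p \<noteq> 0" "poly_act F p x = 0"
proof (cases "inj_on (\<lambda>i. (F ^^ i) x) {..card B}")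
  case False
  then obtain i j where ij: "i < j" "(F ^^ i) x = (F ^^ j) x"
    by (auto simp: inj_on_def) (metis linorder_neqE_nat)
  let ?p = "Polynomial.monom 1 i - Polynomial.monom 1 j :: 'a poly"
  have "poly_act F ?p x = (\<Sum>k\<le>j. scale (poly.coeff ?p k) ((F ^^ k) x))"
    by (rule poly_act_ge) (use ij in \<open>auto intro!: degree_diff_le order_trans[OF degree_monom_le]\<close>)
  also have "\<dots> = (\<Sum>k\<le>j. (if k = i then (F ^^ k) x else 0) - (if k = j then (F ^^ k) x else 0))"
    using ij(1) by (intro sum.cong) auto
  also have "\<dots> = 0" using ij by (simp add: sum_subtractf)
  finally show thesis
    using ij(1) by (intro that[of ?p]) (auto simp: poly_eq_iff)
next
  case True
  let ?S = "(\<lambda>i. (F ^^ i) x) ` {..card B}"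
  have "?S \<subseteq> span B" using funpow_closed[OF assms(3,4)] assms(2) by auto
  moreover have "card ?S = Suc (card B)" using card_image[OF True] by simp
  ultimately have "dependent ?S"
    using independent_span_bound[OF assms(1), of ?S] by auto
  then obtain u where u: "(\<Sum>v\<in>?S. scale (u v) v) = 0" "\<exists>v\<in>?S. u v \<noteq> 0"
    using dependent_finite[of ?S] by auto
  define p where "p = (\<Sum>i\<le>card B. Polynomial.monom (u ((F ^^ i) x)) i)"
  have coeff_p: "poly.coeff p i = (if i \<le> card B then u ((F ^^ i) x) else 0)" for i
    by (simp add: p_def coeff_sum)
  have "poly_act F p x = (\<Sum>k\<le>card B. scale (poly.coeff p k) ((F ^^ k) x))"
    by (rule poly_act_ge) (auto intro!: degree_le simp: coeff_p)
  also have "\<dots> = (\<Sum>v\<in>?S. scale (u v) v)"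
    by (simp add: sum.reindex[OF True] coeff_p)
  finally have "poly_act F p x = 0" using u(1) by simp
  moreover have "p \<noteq> 0" using u(2) by (auto simp: poly_eq_iff coeff_p)
  ultimately show thesis using that by blast
qed

text \<open>In characteristic \<open>p\<close>, a vector \<open>x\<close> with \<open>F x = a x + w\<close>, where \<open>a\<^sup>q = 1\<close> and
  \<open>F\<^sup>q w = w\<close>, satisfies \<open>F\<^sup>q x = x + z\<close> with \<open>F\<^sup>q z = z\<close>, hence \<open>F\<^sup>p\<^sup>q x = x\<close>.\<close>

lemma periodic_step:
  assumes F: "endo_on W F" and W: "subspace W" and x: "x \<in> W" and p: "of_nat p = (0 :: 'a)"
    and q: "a ^ q = 1" and w: "(F ^^ q) (F x - scale a x) = F x - scale a x"
  shows "(F ^^ (q * p)) x = x"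
proof -
  define w' where "w' = F x - scale a x"
  have Fx: "F x = scale a x + w'" by (simp add: w'_def)
  have w'W: "w' \<in> W" unfolding w'_def
    using F W x by (intro subspace_diff subspace_scale) (auto simp: endo_on_def)
  have add: "(F ^^ i) (u + v) = (F ^^ i) u + (F ^^ i) v" if "u \<in> W" "v \<in> W" for i u v
    using that funpow_closed[OF F] F by (induction i) (auto simp: endo_on_def)
  have scl: "(F ^^ i) (scale c u) = scale c ((F ^^ i) u)" if "u \<in> W" for i u c
    using that funpow_closed[OF F] F by (induction i) (auto simp: endo_on_def)
  \<comment> \<open>Every \<open>Z i\<close> is fixed by \<open>F^q\<close>, because
    \<open>Z (i + 1) = F (Z i) + a^i w'\<close>; the increment \<open>z\<close> in
    \<open>F^q x = x + z\<close> is \<open>Z q\<close>.\<close>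
  define Z where "Z i = (F ^^ i) x - scale (a ^ i) x" for i
  have ZW: "Z i \<in> W" for i
    unfolding Z_def using funpow_closed[OF F x] W x by (intro subspace_diff subspace_scale)
  have Zfix: "(F ^^ q) (Z i) = Z i" for i
  proof (induction i)
    case 0
    have "(F ^^ q) (scale 0 x) = scale 0 ((F ^^ q) x)" by (rule scl[OF x])
    then show ?case by (simp add: Z_def)
  next
    case (Suc i)
    have "(F ^^ Suc i) x = F (Z i + scale (a ^ i) x)" by (simp add: Z_def)
    also have "\<dots> = F (Z i) + scale (a ^ i) (F x)"
      using F ZW x W by (simp add: endo_on_def subspace_scale)
    finally have eq: "Z (Suc i) = F (Z i) + scale (a ^ i) w'"
      by (simp add: Z_def Fx scale_right_distrib mult.commute)
    have FZ: "F (Z i) \<in> W" using F ZW by (simp add: endo_on_def)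
    have "(F ^^ q) (F (Z i)) = F ((F ^^ q) (Z i))" by (simp add: funpow_swap1)
    then show ?case
      unfolding eq using w Suc by (simp add: add FZ w'W W subspace_scale scl flip: w'_def)
  qed
  define z where "z = Z q"
  have base: "(F ^^ q) x = x + z" using q by (simp add: z_def Z_def)
  have "(F ^^ (q * k)) x = x + scale (of_nat k) z" for k
  proof (induction k)
    case (Suc k)
    have "(F ^^ (q * Suc k)) x = (F ^^ q) ((F ^^ (q * k)) x)" by (simp add: funpow_add)
    also have "\<dots> = x + z + scale (of_nat k) z"
      unfolding Suc using ZW x W Zfix by (simp add: add scl subspace_scale base z_def)
    finally show ?case by (simp add: scale_left_distrib)
  qed simp
  from this[of p] show ?thesis using p by simp
qed

lemma funpow_mult_fixed: "(F ^^ n) x = x \<Longrightarrow> (F ^^ (n * m)) x = x"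
  by (induction m) (auto simp: funpow_add)

text \<open>Induction over the linear factors: \<open>w = F x - a x\<close> is annihilated by the
  remaining ones, hence periodic. If \<open>a\<close> is an eigenvalue, it is a root of unity and
  \<open>periodic_step\<close> applies; otherwise the period of \<open>w\<close> is one of
  \<open>x\<close>.\<close>

lemma periodic_vector:
  assumes F: "endo_on W F" and W: "subspace W" and "x \<in> W" and p: "p > 0" "of_nat p = (0 :: 'a)"
    and root: "\<And>a x. x \<in> W \<Longrightarrow> x \<noteq> 0 \<Longrightarrow> F x = scale a x \<Longrightarrow> \<exists>n>0. a ^ n = 1"
    and "poly_act F (\<Prod>a\<leftarrow>as. [:-a, 1:]) x = 0"
  shows "\<exists>n>0. (F ^^ n) x = x"
  using assms(3,7)
proof (induction as arbitrary: x)
  case Nil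
  then show ?case using endo_on_0[OF F W] by (intro exI[of _ 1]) (auto simp: poly_act_def)
next
  case (Cons a as)
  define w where "w = F x - scale a x"
  have wW: "w \<in> W" unfolding w_def
    using F W Cons.prems by (intro subspace_diff subspace_scale) (auto simp: endo_on_def)
  have "poly_act F (\<Prod>a\<leftarrow>as. [:-a, 1:]) w = 0"
    using Cons.prems poly_act_linear_factor[OF F W Cons.prems(1)]
    by (simp add: w_def mult.commute)
  then obtain n where n: "n > 0" "(F ^^ n) w = w" using Cons.IH[OF wW] by blast
  show ?case
  proof (cases "\<exists>y\<in>W. y \<noteq> 0 \<and> F y = scale a y")
    case True
    then obtain m where m: "m > 0" "a ^ m = 1" using root by blast
    \<comment> \<open>With \<open>q = n * m\<close>, both \<open>a^q = 1\<close> and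
      \<open>F^q w = w\<close> hold.\<close>
    have "(F ^^ (n * m * p)) x = x"
      by (rule periodic_step[OF F W Cons.prems(1) p(2), of a])
         (use funpow_mult_fixed[OF n(2), of m] m in \<open>auto simp: w_def mult.commute[of n] power_mult\<close>)
    then show ?thesis using n(1) m(1) p(1) by (intro exI[of _ "n * m * p"]) auto
  next
    case False
    have FxW: "(F ^^ n) x \<in> W" using funpow_closed[OF F Cons.prems(1)] .
    have scl: "(F ^^ i) (u - scale c v) = (F ^^ i) u - scale c ((F ^^ i) v)" if "u \<in> W" "v \<in> W" for i u v c
    proof (induction i)
      case (Suc i)
      show ?case
        using Suc endo_on_diff[OF F W funpow_closed[OF F that(1), of i] funpow_closed[OF F that(2), of i]] by simp
    qed simp
    have Fx: "F x \<in> W" using F Cons.prems(1) by (simp add: endo_on_def)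
    \<comment> \<open>\<open>F^n\<close> commutes with \<open>F - a\<close>, which is injective on
      \<open>W\<close> since \<open>a\<close> is not an eigenvalue.\<close>
    have "F ((F ^^ n) x - x) - scale a ((F ^^ n) x - x) = (F ^^ n) w - w"
      using scl[OF Fx Cons.prems(1), of n a] scl[OF FxW Cons.prems(1), of 1 1]
      by (simp add: w_def funpow_swap1 scale_right_diff_distrib)
    then have "F ((F ^^ n) x - x) = scale a ((F ^^ n) x - x)" using n(2) by simp
    moreover have "(F ^^ n) x - x \<in> W" using FxW Cons.prems(1) W by (intro subspace_diff)
    ultimately have "(F ^^ n) x - x = 0" using False by blast
    then show ?thesis using n(1) by auto
  qed
qed

text \<open>An annihilating polynomial splits into linear factors, and its leading coefficient can
  be divided out. The period obtained depends on the vector.\<close>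

lemma alg_closed_finite_order:
  assumes F: "endo_on W F" and W: "subspace W" and B: "finite B" "W \<subseteq> span B"
    and p: "p > 0" "of_nat p = (0 :: 'a)"
    and root: "\<And>a x. x \<in> W \<Longrightarrow> x \<noteq> 0 \<Longrightarrow> F x = scale a x \<Longrightarrow> \<exists>n>0. a ^ n = 1"
    and x: "x \<in> W"
  shows "\<exists>n>0. (F ^^ n) x = x"
proof -
  obtain P where P: "P \<noteq> 0" "poly_act F P x = 0"
    using annihilating_poly[OF B F x] .
  obtain A where A: "size A = Polynomial.degree P" "P = Polynomial.smult (poly.coeff P (Polynomial.degree P)) (\<Prod>a\<in>#A. [:-a, 1:])"
    using alg_closed_imp_factorization[OF P(1)] by blast
  obtain as where as: "mset as = A" using ex_mset by blast
  define Q where "Q = (\<Prod>a\<leftarrow>as. [:-a, 1:])"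
  have PQ: "P = Polynomial.smult (poly.coeff P (Polynomial.degree P)) Q" using A(2) as by (auto simp: Q_def prod_mset_prod_list[symmetric] simp del: prod_mset_prod_list)
  have lc: "poly.coeff P (Polynomial.degree P) \<noteq> 0" using P(1) by simp
  have "poly_act F P x = scale (poly.coeff P (Polynomial.degree P)) (poly_act F Q x)"
    by (subst PQ) (use lc in \<open>simp add: poly_act_def scale_sum_right\<close>)
  then have "poly_act F Q x = 0" using P(2) lc by simp
  then show ?thesis unfolding Q_def
    by (intro periodic_vector[OF F W x p root])
qed

end

section \<open>Sweedler notation for forms\<close>

text \<open>A finite combination of point evaluations is all that is retained of an element of a
  tensor product. Such functionals are linear, and by \<open>fincomb_swap\<close> they can be
  interchanged like finite sums.\<close>

definition fincomb :: "(('x \<Rightarrow> 'K::comm_ring_1) \<Rightarrow> 'K) \<Rightarrow> bool" where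
  "fincomb F \<longleftrightarrow> (\<exists>L. \<forall>\<psi>. F \<psi> = (\<Sum>(c, p)\<leftarrow>L. c * \<psi> p))"

lemma fincomb_eval: "fincomb (\<lambda>\<psi>. \<psi> p)"
  unfolding fincomb_def by (rule exI[of _ "[(1, p)]"]) simp

lemma fincomb_plus: "fincomb F \<Longrightarrow> F (\<lambda>p. \<phi> p + \<psi> p) = F \<phi> + F \<psi>"
  unfolding fincomb_def by (auto simp: algebra_simps sum_list_addf[symmetric] case_prod_unfold)

lemma fincomb_cmult: "fincomb F \<Longrightarrow> F (\<lambda>p. c * \<phi> p) = c * F \<phi>"
  unfolding fincomb_def by (auto simp: mult.left_commute sum_list_const_mult[symmetric] case_prod_unfold)

lemma fincomb_sum_list:
  "(\<And>c p. (c, p) \<in> set L \<Longrightarrow> fincomb (G p)) \<Longrightarrow> fincomb (\<lambda>\<psi>. \<Sum>(c, p)\<leftarrow>L. c * G p \<psi>)"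
proof (induction L)
  case Nil
  then show ?case unfolding fincomb_def by (intro exI[of _ "[]"]) simp
next
  case (Cons a L)
  obtain c p where a: "a = (c, p)" by (cases a)
  obtain M where M: "\<And>\<psi>. (\<Sum>(c, p)\<leftarrow>L. c * G p \<psi>) = (\<Sum>(c, p)\<leftarrow>M. c * \<psi> p)"
  proof -
    have "fincomb (\<lambda>\<psi>. \<Sum>(c, p)\<leftarrow>L. c * G p \<psi>)" using Cons by (auto simp: a)
    then show thesis using that unfolding fincomb_def by blast
  qed
  obtain M' where M': "\<And>\<psi>. G p \<psi> = (\<Sum>(c, p)\<leftarrow>M'. c * \<psi> p)"
    using Cons.prems[of c p] a unfolding fincomb_def by auto
  show ?case
    unfolding fincomb_def
    by (rule exI[of _ "map (\<lambda>(d, q). (c * d, q)) M' @ M"])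
       (simp add: a M[unfolded case_prod_unfold] M' sum_list_const_mult[symmetric] o_def case_prod_unfold mult.assoc)
qed

lemma fincomb_compose:
  assumes "fincomb F" "\<And>p. fincomb (G p)"
  shows "fincomb (\<lambda>\<psi>. F (\<lambda>p. G p \<psi>))"
  using assms(1) fincomb_sum_list[OF assms(2)] unfolding fincomb_def[of F] by auto

lemma fincomb_swap:
  assumes "fincomb F" "fincomb G"
  shows "F (\<lambda>p. G (\<lambda>q. \<phi> p q)) = G (\<lambda>q. F (\<lambda>p. \<phi> p q))"
proof -
  obtain L where L: "\<And>\<psi>. F \<psi> = (\<Sum>(c, p)\<leftarrow>L. c * \<psi> p)" using assms(1) unfolding fincomb_def by auto
  have "(\<Sum>(c, p)\<leftarrow>L. c * G (\<phi> p)) = G (\<lambda>q. \<Sum>(c, p)\<leftarrow>L. c * \<phi> p q)"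
  proof (induction L)
    case Nil
    show ?case using fincomb_cmult[OF assms(2), of 0] by simp
  next
    case (Cons a L)
    then show ?case
      using fincomb_plus[OF assms(2)] fincomb_cmult[OF assms(2)] by (simp add: case_prod_unfold)
  qed
  then show ?thesis by (simp add: L)
qed

lemma fincomb_sum: "fincomb F \<Longrightarrow> F (\<lambda>p. \<Sum>i\<in>I. \<phi> i p) = (\<Sum>i\<in>I. F (\<phi> i))"
proof (induction I rule: infinite_finite_induct)
  case (insert i I)
  then show ?case using fincomb_plus[of F "\<phi> i" "\<lambda>p. \<Sum>i\<in>I. \<phi> i p"] by simp
qed (use fincomb_cmult[of F 0] in auto)

locale forms = vector_space scale
  for scale :: "'k::field \<Rightarrow> 'h::ring_1 \<Rightarrow> 'h" +
  fixes emb :: "'k \<Rightarrow> 'K::field"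
begin

definition lin :: "('h \<Rightarrow> 'K) \<Rightarrow> bool" where
  "lin \<psi> \<longleftrightarrow> (\<forall>a b. \<psi> (a + b) = \<psi> a + \<psi> b) \<and> (\<forall>c a. \<psi> (scale c a) = emb c * \<psi> a)"

definition bilin :: "('h \<Rightarrow> 'h \<Rightarrow> 'K) \<Rightarrow> bool" where
  "bilin \<phi> \<longleftrightarrow> (\<forall>x. lin (\<phi> x)) \<and> (\<forall>y. lin (\<lambda>x. \<phi> x y))"

definition trilin :: "('h \<Rightarrow> 'h \<Rightarrow> 'h \<Rightarrow> 'K) \<Rightarrow> bool" where
  "trilin F \<longleftrightarrow> (\<forall>x. bilin (F x)) \<and> (\<forall>y z. lin (\<lambda>x. F x y z))"

end

text \<open>
  \<open>D h (\<lambda>x y. \<phi> x y)\<close> stands for \<open>\<Sum> \<phi>(h\<^sub>(\<^sub>1\<^sub>), h\<^sub>(\<^sub>2\<^sub>))\<close> in Sweedler notation, for forms \<open>\<phi>\<close> with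
  values in an extension field \<open>'K\<close> of the ground field.
\<close>

locale sweedler = forms scale emb
  for scale :: "'k::field \<Rightarrow> 'h::ring_1 \<Rightarrow> 'h" and emb :: "'k \<Rightarrow> 'K::field" +
  fixes D :: "'h \<Rightarrow> ('h \<Rightarrow> 'h \<Rightarrow> 'K) \<Rightarrow> 'K"
    and eps :: "'h \<Rightarrow> 'K"
    and S :: "'h \<Rightarrow> 'h"
  assumes scale_mult_left [simp]: "scale c a * b = scale c (a * b)"
    and scale_mult_right [simp]: "a * scale c b = scale c (a * b)"
    and D_comb: "fincomb (\<lambda>\<phi>. D h (\<lambda>x y. \<phi> (x, y)))"
    and D_lin: "bilin \<phi> \<Longrightarrow> lin (\<lambda>h. D h \<phi>)"
    and D_coassoc: "trilin F \<Longrightarrow> D h (\<lambda>x z. D x (\<lambda>u v. F u v z)) = D h (\<lambda>x y. D y (\<lambda>v z. F x v z))"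
    and eps_lin: "lin eps"
    and D_eps_left: "lin \<psi> \<Longrightarrow> D h (\<lambda>x y. eps x * \<psi> y) = \<psi> h"
    and D_eps_right: "lin \<psi> \<Longrightarrow> D h (\<lambda>x y. eps y * \<psi> x) = \<psi> h"
    and D_mult: "bilin \<phi> \<Longrightarrow> D (a * b) \<phi> = D a (\<lambda>x y. D b (\<lambda>u v. \<phi> (x * u) (y * v)))"
    and D_one: "bilin \<phi> \<Longrightarrow> D 1 \<phi> = \<phi> 1 1"
    and eps_mult: "eps (a * b) = eps a * eps b"
    and eps_one [simp]: "eps 1 = 1"
    and S_add [simp]: "S (a + b) = S a + S b"
    and S_scale [simp]: "S (scale c a) = scale c (S a)"
    and S_left: "lin \<psi> \<Longrightarrow> D h (\<lambda>x y. \<psi> (S x * y)) = eps h * \<psi> 1"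
    and S_right: "lin \<psi> \<Longrightarrow> D h (\<lambda>x y. \<psi> (x * S y)) = eps h * \<psi> 1"
    and separating: "h \<noteq> 0 \<Longrightarrow> \<exists>\<psi>. lin \<psi> \<and> \<psi> h \<noteq> 0"
begin

lemma D_plus [simp]: "D h (\<lambda>x y. F x y + G x y) = D h F + D h G"
  using fincomb_plus[OF D_comb, of h "\<lambda>(x, y). F x y" "\<lambda>(x, y). G x y"] by simp

lemma D_cmult [simp]: "D h (\<lambda>x y. c * F x y) = c * D h F"
  using fincomb_cmult[OF D_comb, of h c "\<lambda>(x, y). F x y"] by simp

lemma D_cmult_right [simp]: "D h (\<lambda>x y. F x y * c) = D h F * c"
  using D_cmult[of h c F] by (simp add: mult.commute)

lemma D_swap: "D a (\<lambda>x y. D b (\<lambda>u v. F x y u v)) = D b (\<lambda>u v. D a (\<lambda>x y. F x y u v))"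
  using fincomb_swap[OF D_comb D_comb, of a b "\<lambda>(x, y) (u, v). F x y u v"] by simp

lemma D_sum: "D h (\<lambda>x y. \<Sum>i\<in>I. F i x y) = (\<Sum>i\<in>I. D h (F i))"
  using fincomb_sum[OF D_comb, of h "\<lambda>i (x, y). F i x y"] by simp

lemma D_add: "bilin \<phi> \<Longrightarrow> D (a + b) \<phi> = D a \<phi> + D b \<phi>"
  and D_scale: "bilin \<phi> \<Longrightarrow> D (scale c a) \<phi> = emb c * D a \<phi>"
  using D_lin[of \<phi>] by (auto simp: lin_def)

lemma linD: "lin \<psi> \<Longrightarrow> \<psi> (a + b) = \<psi> a + \<psi> b" "lin \<psi> \<Longrightarrow> \<psi> (scale c a) = emb c * \<psi> a"
  by (auto simp: lin_def)

text \<open>The left arguments are treated by equations between functions since eta-contraction hides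
  the remaining ones from the simplifier.\<close>

lemma bilinD:
  assumes "bilin \<phi>"
  shows "\<phi> (a + b) = (\<lambda>y. \<phi> a y + \<phi> b y)" "\<phi> (scale c a) = (\<lambda>y. emb c * \<phi> a y)"
    "\<phi> y (a + b) = \<phi> y a + \<phi> y b" "\<phi> y (scale c a) = emb c * \<phi> y a"
  using assms by (auto simp: lin_def bilin_def)

lemma trilinD:
  assumes "trilin F"
  shows "F (a + b) = (\<lambda>y z. F a y z + F b y z)" "F (scale c a) = (\<lambda>y z. emb c * F a y z)"
    "F y (a + b) = (\<lambda>z. F y a z + F y b z)" "F y (scale c a) = (\<lambda>z. emb c * F y a z)"
    "F y z (a + b) = F y z a + F y z b" "F y z (scale c a) = emb c * F y z a"
  using assms by (auto simp: lin_def bilin_def trilin_def fun_eq_iff)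

text \<open>Reduces a claim of multilinearity to additivity and homogeneity in each argument, so
  that \<open>simp\<close> discharges the side conditions of the Sweedler rules.\<close>

lemmas ml = lin_def bilin_def trilin_def D_add D_scale algebra_simps


section \<open>The antipode reverses products and coproducts\<close>

lemma S_one: "lin \<psi> \<Longrightarrow> \<psi> (S 1) = \<psi> 1"
proof -
  assume L: "lin \<psi>"
  have "D 1 (\<lambda>x y. \<psi> (S x * y)) = \<psi> (S 1 * 1)"
    by (rule D_one) (simp add: ml linD[OF L])
  then show "\<psi> (S 1) = \<psi> 1" using S_left[OF L, of 1] by simp
qed

text \<open>Both sides are convolution inverses of the multiplication \<open>H \<otimes> H \<rightarrow> H\<close>; \<open>E\<close> is
  \<open>\<psi>(S(a\<^sub>1 b\<^sub>1) a\<^sub>2 b\<^sub>2 S(b\<^sub>3) S(a\<^sub>3))\<close>, collapsed from either end.\<close>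

lemma S_mult_form:
  assumes L: "lin \<psi>"
  shows "\<psi> (S (a * b)) = \<psi> (S b * S a)"
proof -
  note T = linD[OF L] linD[OF eps_lin]
  define E where "E = D a (\<lambda>a1 a'. D a' (\<lambda>a2 a3. D b (\<lambda>b1 b'. D b' (\<lambda>b2 b3. \<psi> (S (a1 * b1) * a2 * b2 * S b3 * S a3)))))"
  have "E = D a (\<lambda>a1 a'. D a' (\<lambda>a2 a3. D b (\<lambda>b1 b'. eps b' * \<psi> (S (a1 * b1) * a2 * S a3))))"
  proof -
    have "D b' (\<lambda>b2 b3. \<psi> (S (a1 * b1) * a2 * b2 * S b3 * S a3)) = eps b' * \<psi> (S (a1 * b1) * a2 * S a3)" for a1 a2 a3 b1 b'
      using S_right[of "\<lambda>t. \<psi> (S (a1 * b1) * a2 * t * S a3)" b'] by (simp add: ml T)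
    then show ?thesis by (simp add: E_def)
  qed
  also have "\<dots> = D a (\<lambda>a1 a'. D a' (\<lambda>a2 a3. \<psi> (S (a1 * b) * a2 * S a3)))"
    by (subst D_eps_right) (simp_all add: ml T)
  also have "\<dots> = D a (\<lambda>a1 a'. eps a' * \<psi> (S (a1 * b)))"
  proof -
    have "D a' (\<lambda>a2 a3. \<psi> (S (a1 * b) * a2 * S a3)) = eps a' * \<psi> (S (a1 * b))" for a1 a'
      using S_right[of "\<lambda>t. \<psi> (S (a1 * b) * t)" a'] by (simp add: ml T)
    then show ?thesis by simp
  qed
  also have "\<dots> = \<psi> (S (a * b))"
    by (subst D_eps_right) (simp_all add: ml T)
  finally have 1: "E = \<psi> (S (a * b))" .
  have "E = D a (\<lambda>a' a3. D a' (\<lambda>a1 a2. D b (\<lambda>b' b3. D b' (\<lambda>b1 b2. \<psi> (S (a1 * b1) * (a2 * b2) * S b3 * S a3)))))"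
    by (simp add: E_def D_coassoc ml T)
  also have "\<dots> = D a (\<lambda>a' a3. D b (\<lambda>b' b3. D a' (\<lambda>a1 a2. D b' (\<lambda>b1 b2. \<psi> (S (a1 * b1) * (a2 * b2) * S b3 * S a3)))))"
    by (subst (2) D_swap) simp
  also have "\<dots> = D a (\<lambda>a' a3. D b (\<lambda>b' b3. eps a' * (eps b' * \<psi> (S b3 * S a3))))"
  proof -
    have "D a' (\<lambda>a1 a2. D b' (\<lambda>b1 b2. \<psi> (S (a1 * b1) * (a2 * b2) * S b3 * S a3))) = eps a' * (eps b' * \<psi> (S b3 * S a3))" for a' b' a3 b3
    proof -
      have "D a' (\<lambda>a1 a2. D b' (\<lambda>b1 b2. \<psi> (S (a1 * b1) * (a2 * b2) * S b3 * S a3)))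
          = D (a' * b') (\<lambda>x y. \<psi> (S x * y * S b3 * S a3))"
        by (subst D_mult) (simp_all add: ml T)
      also have "\<dots> = eps (a' * b') * \<psi> (S b3 * S a3)"
        using S_left[of "\<lambda>t. \<psi> (t * S b3 * S a3)"] by (simp add: ml T)
      finally show ?thesis by (simp add: eps_mult mult.assoc)
    qed
    then show ?thesis by simp
  qed
  also have "\<dots> = D a (\<lambda>a' a3. eps a' * \<psi> (S b * S a3))"
    using D_eps_left[of "\<lambda>t. \<psi> (S t * S _)" b] by (simp add: ml T)
  also have "\<dots> = \<psi> (S b * S a)"
    by (subst D_eps_left) (simp_all add: ml T)
  finally show ?thesis using 1 by simp
qed

lemma lin_eqI: "(\<And>\<psi>. lin \<psi> \<Longrightarrow> \<psi> a = \<psi> b) \<Longrightarrow> a = b"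
proof (rule ccontr)
  assume *: "\<And>\<psi>. lin \<psi> \<Longrightarrow> \<psi> a = \<psi> b" and "a \<noteq> b"
  then obtain \<psi> where \<psi>: "lin \<psi>" "\<psi> (a - b) \<noteq> 0" using separating[of "a - b"] by auto
  have "\<psi> (a - b + b) = \<psi> (a - b) + \<psi> b" using linD(1)[OF \<psi>(1)] .
  then show False using *[OF \<psi>(1)] \<psi>(2) by simp
qed

lemma S_mult: "S (a * b) = S b * S a"
  by (rule lin_eqI) (rule S_mult_form)

lemma S_1 [simp]: "S 1 = 1"
  by (rule lin_eqI) (rule S_one)

text \<open>Both sides are convolution inverses of
  \<open>\<Delta> : H \<rightarrow> H \<otimes> H\<close>; \<open>E\<close> is \<open>\<phi>\<close>
  on \<open>\<Delta>(S(h\<^sub>1)) (h\<^sub>2 \<otimes> h\<^sub>3) (S(h\<^sub>5) \<otimes>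
  S(h\<^sub>4))\<close>, collapsed from either end.\<close>

lemma D_S:
  assumes B: "bilin \<phi>"
  shows "D (S h) \<phi> = D h (\<lambda>x y. \<phi> (S y) (S x))"
proof -
  note T = bilinD[OF B] linD[OF eps_lin]
  define E where "E = D h (\<lambda>h1 r. D r (\<lambda>h2 r. D r (\<lambda>h3 r. D r (\<lambda>h4 h5.
    D (S h1) (\<lambda>u v. \<phi> (u * h2 * S h5) (v * h3 * S h4))))))"
  have "E = D h (\<lambda>h1 r. D r (\<lambda>h2 r. D r (\<lambda>w h5. D w (\<lambda>h3 h4.
    D (S h1) (\<lambda>u v. \<phi> (u * h2 * S h5) (v * (h3 * S h4)))))))"
    by (simp add: E_def D_coassoc ml T)
  also have "\<dots> = D h (\<lambda>h1 r. D r (\<lambda>h2 r. D r (\<lambda>w h5. eps w * D (S h1) (\<lambda>u v. \<phi> (u * h2 * S h5) v))))"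
  proof -
    have "D w (\<lambda>h3 h4. D (S h1) (\<lambda>u v. \<phi> (u * h2 * S h5) (v * (h3 * S h4)))) = eps w * D (S h1) (\<lambda>u v. \<phi> (u * h2 * S h5) v)" for w h1 h2 h5
      using S_right[of "\<lambda>t. D (S h1) (\<lambda>u v. \<phi> (u * h2 * S h5) (v * t))" w] by (simp add: ml T)
    then show ?thesis by simp
  qed
  also have "\<dots> = D h (\<lambda>h1 r. D r (\<lambda>h2 h5. D (S h1) (\<lambda>u v. \<phi> (u * (h2 * S h5)) v)))"
    by (subst D_eps_left) (simp_all add: ml T)
  also have "\<dots> = D h (\<lambda>h1 r. eps r * D (S h1) (\<lambda>u v. \<phi> u v))"
  proof -
    have "D r (\<lambda>h2 h5. D (S h1) (\<lambda>u v. \<phi> (u * (h2 * S h5)) v)) = eps r * D (S h1) (\<lambda>u v. \<phi> u v)" for r h1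
      using S_right[of "\<lambda>t. D (S h1) (\<lambda>u v. \<phi> (u * t) v)" r] by (simp add: ml T)
    then show ?thesis by simp
  qed
  also have "\<dots> = D (S h) \<phi>"
    by (subst D_eps_right) (simp_all add: ml T)
  finally have 1: "E = D (S h) \<phi>" .
  \<comment> \<open>The indices are regrouped into \<open>w\<close> for the first three and
    \<open>r\<close> for the last two; the first three factors then form
    \<open>\<Delta>(S(w\<^sub>1) w\<^sub>2)\<close>.\<close>
  have "E = D h (\<lambda>w r. D w (\<lambda>h1 w. D w (\<lambda>h2 h3. D r (\<lambda>h4 h5. 
    D (S h1) (\<lambda>u v. \<phi> (u * h2 * S h5) (v * h3 * S h4))))))"
    by (simp add: E_def D_coassoc ml T)
  also have "\<dots> = D h (\<lambda>w r. D r (\<lambda>h4 h5. D w (\<lambda>h1 w. D w (\<lambda>h2 h3. 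
    D (S h1) (\<lambda>u v. \<phi> (u * h2 * S h5) (v * h3 * S h4))))))"
  proof -
    have "D w (\<lambda>h1 w. D w (\<lambda>h2 h3. D r (\<lambda>h4 h5. D (S h1) (\<lambda>u v. \<phi> (u * h2 * S h5) (v * h3 * S h4)))))
      = D r (\<lambda>h4 h5. D w (\<lambda>h1 w. D w (\<lambda>h2 h3. D (S h1) (\<lambda>u v. \<phi> (u * h2 * S h5) (v * h3 * S h4)))))" for w r
      by (simp only: D_swap[of _ r])
    then show ?thesis by simp
  qed
  also have "\<dots> = D h (\<lambda>w r. D r (\<lambda>h4 h5. eps w * \<phi> (S h5) (S h4)))"
  proof -
    have "D w (\<lambda>h1 w. D w (\<lambda>h2 h3. D (S h1) (\<lambda>u v. \<phi> (u * h2 * S h5) (v * h3 * S h4)))) = eps w * \<phi> (S h5) (S h4)" for w h4 h5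
    proof -
      have "D w (\<lambda>h1 w. D w (\<lambda>h2 h3. D (S h1) (\<lambda>u v. \<phi> (u * h2 * S h5) (v * h3 * S h4))))
        = D w (\<lambda>x y. D (S x * y) (\<lambda>u v. \<phi> (u * S h5) (v * S h4)))"
        by (simp add: D_mult ml T D_swap[of "S _"])
      also have "\<dots> = eps w * D 1 (\<lambda>u v. \<phi> (u * S h5) (v * S h4))"
        by (rule S_left) (simp add: ml T)
      also have "D 1 (\<lambda>u v. \<phi> (u * S h5) (v * S h4)) = \<phi> (1 * S h5) (1 * S h4)"
        by (rule D_one) (simp add: ml T)
      finally show ?thesis by simp
    qed
    then show ?thesis by simp
  qed
  also have "\<dots> = D h (\<lambda>x y. \<phi> (S y) (S x))"
    using D_eps_left[of "\<lambda>r. D r (\<lambda>x y. \<phi> (S y) (S x))" h] by (simp add: ml T)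
  finally show ?thesis using 1 by simp
qed

end

section \<open>Bijectivity of the antipode\<close>

locale finite_sweedler = sweedler scale emb D eps S
  for scale :: "'k::field \<Rightarrow> 'h::ring_1 \<Rightarrow> 'h" and emb :: "'k \<Rightarrow> 'K::field" and D eps S +
  fixes Bs :: "'h set" and cf :: "'h \<Rightarrow> 'h \<Rightarrow> 'K"
  assumes Bs_finite: "finite Bs"
    and cf_lin: "lin (cf b)"
    and expand: "lin \<psi> \<Longrightarrow> \<psi> h = (\<Sum>b\<in>Bs. cf b h * \<psi> b)"
begin

text \<open>For a functional \<open>m\<close>, the right coaction dual to the multiplication of \<open>H\<^sup>*\<close> is
  \<open>m \<mapsto> \<Sum>\<^sub>b comp m b \<otimes> b\<close>. Together with the action \<open>(m \<cdot> h)(x) = m(x S(h))\<close> it makes \<open>H\<^sup>*\<close>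
  a Hopf module, and \<open>coinv m = \<Sum> m\<^sub>(\<^sub>0\<^sub>) \<cdot> S(m\<^sub>(\<^sub>1\<^sub>))\<close> is the projection to the coinvariants.\<close>

definition comp :: "('h \<Rightarrow> 'K) \<Rightarrow> 'h \<Rightarrow> 'h \<Rightarrow> 'K" where
  "comp m b y = D y (\<lambda>u v. cf b u * m v)"

definition coinv :: "('h \<Rightarrow> 'K) \<Rightarrow> 'h \<Rightarrow> 'K" where
  "coinv m x = (\<Sum>b\<in>Bs. comp m b (x * S (S b)))"

lemma comp_lin: assumes "lin m" shows "lin (comp m b)"
  unfolding comp_def using linD[OF assms] linD[OF cf_lin]
  by (intro D_lin) (simp add: ml)

lemma coinv_lin: assumes "lin m" shows "lin (coinv m)"
  using linD[OF comp_lin[OF assms]]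
  by (simp add: coinv_def lin_def sum.distrib distrib_right sum_distrib_left)

text \<open>Applying \<open>\<psi>\<close> to the coacting leg gives the convolution product of
  \<open>\<psi>\<close> and \<open>m\<close>.\<close>

lemma sum_comp:
  assumes "lin \<psi>"
  shows "(\<Sum>a\<in>Bs. \<psi> a * comp m a y) = D y (\<lambda>u v. \<psi> u * m v)"
proof -
  have "\<psi> u * m v = (\<Sum>a\<in>Bs. \<psi> a * (cf a u * m v))" for u v
    by (subst expand[OF assms, of u]) (simp add: sum_distrib_right sum_distrib_left ac_simps)
  then show ?thesis
    by (simp only: D_sum comp_def D_cmult)
qed

text \<open>Coassociativity of the coaction, tested on bilinear forms in its two legs. The form may
  depend on the basis vector \<open>e\<close>, since values at other points are recovered from those
  at \<open>e\<close> by \<open>expand\<close>.\<close>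

lemma comp_coassoc:
  assumes "lin m" and "\<And>e. bilin (\<Phi> e)"
  shows "(\<Sum>b\<in>Bs. \<Sum>a\<in>Bs. \<Sum>e\<in>Bs. \<Phi> e a b * comp (comp m b) a e) =
    (\<Sum>c\<in>Bs. \<Sum>e\<in>Bs. D c (\<Phi> e) * comp m c e)"
proof -
  have "(\<Sum>b\<in>Bs. \<Sum>a\<in>Bs. \<Phi> e a b * comp (comp m b) a e) = (\<Sum>c\<in>Bs. D c (\<Phi> e) * comp m c e)" for e
  proof -
    note T = bilinD[OF assms(2)] linD[OF assms(1)]
    have "(\<Sum>b\<in>Bs. \<Sum>a\<in>Bs. \<Phi> e a b * comp (comp m b) a e) = (\<Sum>b\<in>Bs. D e (\<lambda>u v. \<Phi> e u b * comp m b v))"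
      using assms(2)[of e] by (intro sum.cong sum_comp) (auto simp: bilin_def)
    also have "\<dots> = D e (\<lambda>u v. D v (\<lambda>y z. \<Phi> e u y * m z))"
      unfolding D_sum[symmetric] using assms(2)[of e]
      by (subst sum_comp) (auto simp: bilin_def)
    also have "\<dots> = D e (\<lambda>u v. D u (\<lambda>y z. \<Phi> e y z) * m v)"
      using D_coassoc[of "\<lambda>u y z. \<Phi> e u y * m z" e] by (simp add: ml T)
    also have "\<dots> = (\<Sum>c\<in>Bs. D c (\<Phi> e) * comp m c e)"
      using assms(2)[of e] by (subst sum_comp) (auto simp: D_lin)
    finally show ?thesis .
  qed
  note inner = this
  have "(\<Sum>b\<in>Bs. \<Sum>a\<in>Bs. \<Sum>e\<in>Bs. \<Phi> e a b * comp (comp m b) a e) =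
      (\<Sum>b\<in>Bs. \<Sum>e\<in>Bs. \<Sum>a\<in>Bs. \<Phi> e a b * comp (comp m b) a e)"
    by (intro sum.cong refl sum.swap)
  also have "\<dots> = (\<Sum>e\<in>Bs. \<Sum>b\<in>Bs. \<Sum>a\<in>Bs. \<Phi> e a b * comp (comp m b) a e)"
    by (rule sum.swap)
  also have "\<dots> = (\<Sum>e\<in>Bs. \<Sum>c\<in>Bs. D c (\<Phi> e) * comp m c e)"
    by (simp only: inner)
  also have "\<dots> = (\<Sum>c\<in>Bs. \<Sum>e\<in>Bs. D c (\<Phi> e) * comp m c e)"
    by (rule sum.swap)
  finally show ?thesis .
qed

text \<open>Compatibility of action and coaction: with \<open>k\<close> split into three,
  \<open>\<Delta>(h S(k))\<close> contributes
  \<open>h\<^sub>1 S(k\<^sub>2) \<otimes> h\<^sub>2 S(k\<^sub>1)\<close>, and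
  \<open>S(k\<^sub>2) k\<^sub>3\<close> cancels.\<close>

lemma coaction_action:
  assumes "lin w" "lin \<psi>"
  shows "D k (\<lambda>k1 k2. D (h * S k1) (\<lambda>u v. \<psi> (u * k2) * w v)) = D h (\<lambda>x y. \<psi> x * w (y * S k))"
proof -
  note T = linD[OF assms(1)] linD[OF assms(2)] linD[OF eps_lin]
  have "D k (\<lambda>k1 k2. D (h * S k1) (\<lambda>u v. \<psi> (u * k2) * w v))
    = D h (\<lambda>x y. D k (\<lambda>k1 k2. D k1 (\<lambda>p q. \<psi> (x * (S q * k2)) * w (y * S p))))"
    by (simp add: D_mult D_S ml T D_swap[of k])
  also have "\<dots> = D h (\<lambda>x y. D k (\<lambda>p r. D r (\<lambda>q k2. \<psi> (x * (S q * k2))) * w (y * S p)))"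
    by (subst D_coassoc) (simp_all add: ml T)
  also have "\<dots> = D h (\<lambda>x y. D k (\<lambda>p r. eps r * (\<psi> x * w (y * S p))))"
    using S_left[of "\<lambda>t. \<psi> (_ * t)"] by (simp add: ml T)
  also have "\<dots> = D h (\<lambda>x y. \<psi> x * w (y * S k))"
    by (subst D_eps_right) (simp_all add: ml T)
  finally show ?thesis .
qed

text \<open>\<open>coaction_action\<close> at \<open>S b\<close> exposes a second coaction,
  coassociativity merges the two into one element \<open>c\<close>, and
  \<open>c\<^sub>1 S(c\<^sub>2)\<close> cancels. Thus \<open>coinv m\<close> is a left integral in
  the dual algebra.\<close>

lemma coinv_invariant:
  assumes m: "lin m" and \<psi>: "lin \<psi>"
  shows "D h (\<lambda>x y. \<psi> x * coinv m y) = coinv m h * \<psi> 1"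
proof -
  note T = linD[OF m] linD[OF \<psi>] linD[OF cf_lin] linD[OF eps_lin]
  define \<Phi> where "\<Phi> e a b = D b (\<lambda>b1 b2. cf e (h * S (S b2)) * \<psi> (a * S b1))" for e a b
  have \<Phi>: "bilin (\<Phi> e)" for e unfolding \<Phi>_def by (simp add: ml T)
  have "D h (\<lambda>x y. \<psi> x * coinv m y) = (\<Sum>b\<in>Bs. D h (\<lambda>x y. \<psi> x * comp m b (y * S (S b))))"
    by (simp add: coinv_def sum_distrib_left D_sum)
  also have "\<dots> = (\<Sum>b\<in>Bs. D b (\<lambda>b1 b2. D (h * S (S b2)) (\<lambda>u v. \<psi> (u * S b1) * comp m b v)))"
    by (intro sum.cong refl, subst coaction_action[OF comp_lin[OF m] \<psi>, symmetric], subst D_S)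
       (use linD[OF comp_lin[OF m]] in \<open>simp_all add: ml T\<close>)
  also have "\<dots> = (\<Sum>b\<in>Bs. D b (\<lambda>b1 b2. \<Sum>a\<in>Bs. \<Sum>e\<in>Bs. cf e (h * S (S b2)) * \<psi> (a * S b1) * comp (comp m b) a e))"
  proof -
    have "D z (\<lambda>u v. \<psi> (u * k) * comp m b v) = (\<Sum>a\<in>Bs. \<Sum>e\<in>Bs. cf e z * \<psi> (a * k) * comp (comp m b) a e)" for z k b
    proof -
      have "D z (\<lambda>u v. \<psi> (u * k) * comp m b v) = (\<Sum>a\<in>Bs. \<psi> (a * k) * comp (comp m b) a z)"
        by (subst sum_comp) (simp_all add: ml T)
      also have "\<dots> = (\<Sum>a\<in>Bs. \<psi> (a * k) * (\<Sum>e\<in>Bs. cf e z * comp (comp m b) a e))"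
        using expand[OF comp_lin[OF comp_lin[OF m]]] by metis
      finally show ?thesis by (simp add: sum_distrib_left ac_simps)
    qed
    then show ?thesis by simp
  qed
  also have "\<dots> = (\<Sum>b\<in>Bs. \<Sum>a\<in>Bs. \<Sum>e\<in>Bs. \<Phi> e a b * comp (comp m b) a e)"
    by (simp add: D_sum \<Phi>_def)
  also have "\<dots> = (\<Sum>c\<in>Bs. \<Sum>e\<in>Bs. D c (\<Phi> e) * comp m c e)"
    by (rule comp_coassoc[OF m \<Phi>])
  also have "\<dots> = (\<Sum>c\<in>Bs. \<Sum>e\<in>Bs. cf e (h * S (S c)) * comp m c e * \<psi> 1)"
  proof -
    have "D c (\<Phi> e) = cf e (h * S (S c)) * \<psi> 1" for c e
    proof -
      have eq: "\<Phi> e = (\<lambda>a b. D b (\<lambda>b1 b2. \<psi> (a * S b1) * cf e (h * S (S b2))))"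
        by (intro ext) (simp add: \<Phi>_def mult.commute)
      have "D c (\<Phi> e) = D c (\<lambda>r b2. D r (\<lambda>a b1. \<psi> (a * S b1)) * cf e (h * S (S b2)))"
        unfolding eq using D_coassoc[of "\<lambda>a b1 b2. \<psi> (a * S b1) * cf e (h * S (S b2))" c]
        by (simp add: ml T)
      also have "\<dots> = D c (\<lambda>r b2. eps r * (\<psi> 1 * cf e (h * S (S b2))))"
        by (subst S_right[OF \<psi>]) (simp add: mult.assoc)
      also have "\<dots> = \<psi> 1 * cf e (h * S (S c))"
        by (subst D_eps_left) (simp_all add: ml T)
      finally show ?thesis by (simp add: mult.commute)
    qed
    then show ?thesis by (simp add: ac_simps)
  qed
  also have "\<dots> = coinv m h * \<psi> 1"
    unfolding coinv_def sum_distrib_right[symmetric]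
    using expand[OF comp_lin[OF m]] by (metis (no_types, lifting) sum.cong)
  finally show ?thesis .
qed

text \<open>After coassociativity \<open>S(b) S(S(a)) = S(S(a) b)\<close> cancels. This is the part
  of the structure theorem of Hopf modules by which coinvariants generate.\<close>

lemma coinv_generates:
  assumes m: "lin m"
  shows "m x = (\<Sum>b\<in>Bs. coinv (comp m b) (x * S b))"
proof -
  note T = linD[OF m] linD[OF cf_lin] linD[OF eps_lin]
  have "(\<Sum>b\<in>Bs. coinv (comp m b) (x * S b)) = (\<Sum>b\<in>Bs. \<Sum>a\<in>Bs. \<Sum>e\<in>Bs. cf e (x * S b * S (S a)) * comp (comp m b) a e)"
    unfolding coinv_def using expand[OF comp_lin[OF comp_lin[OF m]]] by (metis (no_types, lifting) sum.cong)
  also have "\<dots> = (\<Sum>c\<in>Bs. \<Sum>e\<in>Bs. D c (\<lambda>a b. cf e (x * S b * S (S a))) * comp m c e)"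
    by (rule comp_coassoc[OF m]) (simp add: ml T)
  also have "\<dots> = (\<Sum>c\<in>Bs. eps c * (\<Sum>e\<in>Bs. cf e x * comp m c e))"
  proof -
    have "D c (\<lambda>a b. cf e (x * S b * S (S a))) = eps c * cf e x" for c e
      using S_left[of "\<lambda>t. cf e (x * S t)" c] by (simp add: ml T S_mult)
    then show ?thesis by (simp add: sum_distrib_left mult.assoc)
  qed
  also have "\<dots> = (\<Sum>c\<in>Bs. eps c * comp m c x)"
    using expand[OF comp_lin[OF m]] by (metis (no_types, lifting) sum.cong)
  also have "\<dots> = m x" 
    by (subst sum_comp[OF eps_lin]) (rule D_eps_left[OF m])
  finally show ?thesis ..
qed

text \<open>The functional \<open>eps\<close> is nonzero and generated by coinvariants, so some
  coinvariant is nonzero.\<close>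

lemma integral_exists:
  obtains L x where "lin L" "L x \<noteq> 0" "\<And>h \<psi>. lin \<psi> \<Longrightarrow> D h (\<lambda>x y. \<psi> x * L y) = L h * \<psi> 1"
proof -
  have "(\<Sum>b\<in>Bs. coinv (comp eps b) (1 * S b)) \<noteq> 0"
    using coinv_generates[OF eps_lin, of 1] by simp
  then obtain b where "coinv (comp eps b) (1 * S b) \<noteq> 0" by (meson sum.neutral)
  then show thesis
    using that coinv_lin[OF comp_lin[OF eps_lin]] coinv_invariant[OF comp_lin[OF eps_lin]] by blast
qed

text \<open>If \<open>S h = 0\<close>, the integral property makes
  \<open>L(x S(h\<^sub>1)) \<psi>'(h\<^sub>2)\<close> vanish for all \<open>x\<close> and
  \<open>\<psi>'\<close>. Replacing a counit by \<open>h\<^sub>1 S(h\<^sub>2)\<close> writes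
  \<open>L(y) \<psi>(h)\<close> as a sum of such terms.\<close>

lemma S_injective: "S h = 0 \<Longrightarrow> h = 0"
proof (rule ccontr)
  assume Sh: "S h = 0" and "h \<noteq> 0"
  then obtain \<psi> where \<psi>: "lin \<psi>" "\<psi> h \<noteq> 0" using separating by blast
  obtain L y where L: "lin L" "L y \<noteq> 0" "\<And>h \<psi>. lin \<psi> \<Longrightarrow> D h (\<lambda>x y. \<psi> x * L y) = L h * \<psi> 1"
    using integral_exists by blast
  note T = linD[OF \<psi>(1)] linD[OF L(1)] linD[OF eps_lin] linD[OF cf_lin]
  have vanish: "D h (\<lambda>h1 h2. L (x * S h1) * \<psi>' h2) = 0" if \<psi>': "lin \<psi>'" for x \<psi>'
  proof -
    have "D h (\<lambda>h1 h2. L (x * S h1) * \<psi>' h2) = D h (\<lambda>h1 h2. D (x * S h1) (\<lambda>u v. \<psi>' (u * h2) * L v))"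
      by (subst L(3)) (simp_all add: ml linD[OF \<psi>'])
    also have "\<dots> = D x (\<lambda>x y. \<psi>' x * L (y * S h))"
      by (rule coaction_action[OF L(1) \<psi>'])
    also have "\<dots> = 0"
    proof -
      have "L 0 = 0" using linD(1)[OF L(1), of 0 0] by (metis add.right_neutral add_cancel_left_right)
      then show ?thesis using D_cmult[of x 0] by (simp add: Sh)
    qed
    finally show ?thesis .
  qed
  have "L y * \<psi> h = D h (\<lambda>w h3. eps w * (L y * \<psi> h3))"
    by (subst D_eps_left) (simp_all add: ml T)
  also have "\<dots> = D h (\<lambda>w h3. D w (\<lambda>h1 h2. L (y * S (S h2) * S h1)) * \<psi> h3)"
    using S_right[of "\<lambda>t. L (y * S t)"] by (simp add: ml T S_mult)
  also have "\<dots> = D h (\<lambda>h1 r. D r (\<lambda>h2 h3. L (y * S (S h2) * S h1) * \<psi> h3))"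
    using D_coassoc[of "\<lambda>h1 h2 h3. L (y * S (S h2) * S h1) * \<psi> h3" h] by (simp add: ml T)
  \<comment> \<open>The middle factor is expanded in coordinates, so that \<open>S (S c)\<close> is
    constant and \<open>vanish\<close> applies to each \<open>c\<close>.\<close>
  also have "\<dots> = D h (\<lambda>h1 r. D r (\<lambda>h2 h3. \<Sum>c\<in>Bs. cf c h2 * L (y * S (S c) * S h1) * \<psi> h3))"
  proof -
    have "L (y * S (S h2) * S h1) * \<psi> h3 = (\<Sum>c\<in>Bs. cf c h2 * L (y * S (S c) * S h1) * \<psi> h3)" for h1 h2 h3
      unfolding sum_distrib_right[symmetric]
      by (intro arg_cong[of _ _ "\<lambda>t. t * _"] expand[of "\<lambda>t. L (y * S (S t) * S h1)"]) (simp add: ml T)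
    then show ?thesis by (simp only:)
  qed
  also have "\<dots> = (\<Sum>c\<in>Bs. D h (\<lambda>h1 r. L (y * S (S c) * S h1) * D r (\<lambda>h2 h3. cf c h2 * \<psi> h3)))"
    unfolding D_sum D_cmult[symmetric] by (simp add: ac_simps del: D_cmult)
  also have "\<dots> = 0"
  proof (rule sum.neutral, rule ballI)
    fix c
    show "D h (\<lambda>h1 r. L (y * S (S c) * S h1) * D r (\<lambda>h2 h3. cf c h2 * \<psi> h3)) = 0"
      by (rule vanish) (simp add: ml T)
  qed
  finally show False using L(2) \<psi>(2) by simp
qed

end

section \<open>Pentagon equations\<close>

definition leg12 :: "(('a \<Rightarrow> 'a \<Rightarrow> 'k) \<Rightarrow> 'a \<Rightarrow> 'a \<Rightarrow> 'k) \<Rightarrow> ('a \<Rightarrow> 'a \<Rightarrow> 'a \<Rightarrow> 'k) \<Rightarrow> 'a \<Rightarrow> 'a \<Rightarrow> 'a \<Rightarrow> 'k" where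
  "leg12 F \<phi> = (\<lambda>e f g. F (\<lambda>a b. \<phi> a b g) e f)"

definition leg13 :: "(('a \<Rightarrow> 'a \<Rightarrow> 'k) \<Rightarrow> 'a \<Rightarrow> 'a \<Rightarrow> 'k) \<Rightarrow> ('a \<Rightarrow> 'a \<Rightarrow> 'a \<Rightarrow> 'k) \<Rightarrow> 'a \<Rightarrow> 'a \<Rightarrow> 'a \<Rightarrow> 'k" where
  "leg13 F \<phi> = (\<lambda>e f g. F (\<lambda>a b. \<phi> a f b) e g)"

definition leg23 :: "(('a \<Rightarrow> 'a \<Rightarrow> 'k) \<Rightarrow> 'a \<Rightarrow> 'a \<Rightarrow> 'k) \<Rightarrow> ('a \<Rightarrow> 'a \<Rightarrow> 'a \<Rightarrow> 'k) \<Rightarrow> 'a \<Rightarrow> 'a \<Rightarrow> 'a \<Rightarrow> 'k" where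
  "leg23 F \<phi> = (\<lambda>e f g. F (\<phi> e) f g)"

locale bijective_antipode = finite_sweedler scale emb D eps S Bs cf
  for scale :: "'k::field \<Rightarrow> 'h::ring_1 \<Rightarrow> 'h" and emb :: "'k \<Rightarrow> 'K::field" and D eps S Bs cf +
  fixes R :: "'h \<Rightarrow> 'h"
  assumes S_R [simp]: "S (R h) = h" and R_S [simp]: "R (S h) = h"
begin

section \<open>The inverse of the antipode\<close>

lemma R_eqI: "S a = S b \<Longrightarrow> a = b"
  by (metis R_S)

lemma R_add [simp]: "R (a + b) = R a + R b"
  by (rule R_eqI) simp

lemma R_scale [simp]: "R (scale c a) = scale c (R a)"
  by (rule R_eqI) simp

lemma R_mult: "R (a * b) = R b * R a"
  by (rule R_eqI) (simp add: S_mult)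

lemma D_R:
  assumes "bilin \<phi>"
  shows "D (R h) \<phi> = D h (\<lambda>x y. \<phi> (R y) (R x))"
proof -
  have "D (S (R h)) (\<lambda>x y. \<phi> (R y) (R x)) = D (R h) (\<lambda>x y. \<phi> (R (S x)) (R (S y)))"
    by (rule D_S) (simp add: ml bilinD[OF assms])
  then show ?thesis by simp
qed

text \<open>\<open>S_left\<close> for the form \<open>\<psi> \<circ> R\<close>, since
  \<open>R(S(x) y) = R(y) x\<close>.\<close>

lemma R_left: assumes "lin \<psi>" shows "D h (\<lambda>x y. \<psi> (R y * x)) = eps h * \<psi> 1"
  using S_left[of "\<lambda>t. \<psi> (R t)" h] linD[OF assms] by (simp add: ml R_mult)
    (metis R_S S_1)

lemma R_right: assumes "lin \<psi>" shows "D h (\<lambda>x y. \<psi> (y * R x)) = eps h * \<psi> 1"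
  using S_right[of "\<lambda>t. \<psi> (R t)" h] linD[OF assms] by (simp add: ml R_mult)
    (metis R_S S_1)

text \<open>Operators on bilinear forms: the transposes of the endomorphisms of \<open>H \<otimes> H\<close> that map
  \<open>a \<otimes> b\<close>, in this order, to \<open>a\<^sub>1 \<otimes> a\<^sub>2b\<close>, \<open>a\<^sub>2 \<otimes> a\<^sub>1b\<close>, \<open>ab\<^sub>1 \<otimes> b\<^sub>2\<close>, \<open>b\<^sub>1a \<otimes> b\<^sub>2\<close>,
  \<open>aR(b\<^sub>2) \<otimes> b\<^sub>1\<close>, \<open>R(b\<^sub>2)a \<otimes> b\<^sub>1\<close>, \<open>R(b\<^sub>2) \<otimes> ab\<^sub>1\<close>, \<open>a\<^sub>1R(b) \<otimes> a\<^sub>2\<close> and \<open>R\<^sup>2(a) \<otimes> b\<close>.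
  Transposition reverses products, so in a composition the outermost operator acts first on tensors.\<close>

definition opT where "opT \<psi> a b = D a (\<lambda>x y. \<psi> x (y * b))" for \<psi> :: "'h \<Rightarrow> 'h \<Rightarrow> 'K"
definition opT' where "opT' \<psi> a b = D a (\<lambda>x y. \<psi> y (x * b))" for \<psi> :: "'h \<Rightarrow> 'h \<Rightarrow> 'K"
definition sig where "sig \<psi> a b = D b (\<lambda>x y. \<psi> (a * x) y)" for \<psi> :: "'h \<Rightarrow> 'h \<Rightarrow> 'K"
definition sig' where "sig' \<psi> a b = D b (\<lambda>x y. \<psi> (x * a) y)" for \<psi> :: "'h \<Rightarrow> 'h \<Rightarrow> 'K"
definition kap where "kap \<psi> a b = D b (\<lambda>x y. \<psi> (a * R y) x)" for \<psi> :: "'h \<Rightarrow> 'h \<Rightarrow> 'K"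
definition rho where "rho \<psi> a b = D b (\<lambda>x y. \<psi> (R y * a) x)" for \<psi> :: "'h \<Rightarrow> 'h \<Rightarrow> 'K"
definition theta where "theta \<psi> a b = D b (\<lambda>x y. \<psi> (R y) (a * x))" for \<psi> :: "'h \<Rightarrow> 'h \<Rightarrow> 'K"
definition tau where "tau \<psi> a b = D a (\<lambda>x y. \<psi> (x * R b) y)" for \<psi> :: "'h \<Rightarrow> 'h \<Rightarrow> 'K"
definition sq where "sq \<psi> a b = \<psi> (R (R a)) b" for \<psi> :: "'h \<Rightarrow> 'h \<Rightarrow> 'K"

lemmas op_defs = opT_def opT'_def sig_def sig'_def kap_def rho_def theta_def tau_def sq_def
lemmas leg_defs = leg12_def leg13_def leg23_def

lemma op_bilin:
  assumes "bilin \<psi>"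
  shows "bilin (opT \<psi>)" "bilin (opT' \<psi>)" "bilin (sig \<psi>)" "bilin (sig' \<psi>)" "bilin (kap \<psi>)"
    "bilin (rho \<psi>)" "bilin (theta \<psi>)" "bilin (tau \<psi>)" "bilin (sq \<psi>)"
  by (simp_all add: op_defs ml bilinD[OF assms])

section \<open>Identities between operators on trilinear forms\<close>

context
  fixes \<phi> assumes tri: "trilin \<phi>"
begin

lemmas tri_simps = trilinD[OF tri]

text \<open>Both sides reach one normal form: \<open>D_mult\<close> splits coproducts of products,
  \<open>D_coassoc\<close> nests iterated coproducts to the right, and \<open>D_swap\<close> orders
  the splittings of different arguments. The lemmas that follow use the same pattern.\<close>

lemma pent_T: "leg23 opT (leg13 opT (leg12 opT \<phi>)) e f g = leg12 opT (leg23 opT \<phi>) e f g"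
  by (simp add: op_defs leg_defs D_mult D_coassoc D_swap[of f] ml tri_simps)

lemma pent_T': "leg23 opT' (leg13 opT' (leg12 opT' \<phi>)) e f g = leg12 opT' (leg23 opT' \<phi>) e f g"
  by (simp add: op_defs leg_defs D_mult D_coassoc D_swap[of f] ml tri_simps)

lemma pent_sig: "leg23 sig (leg12 sig \<phi>) e f g = leg12 sig (leg13 sig (leg23 sig \<phi>)) e f g"
  by (simp add: op_defs leg_defs D_mult D_coassoc D_swap[of g] ml tri_simps)

lemma pent_sig': "leg23 sig' (leg12 sig' \<phi>) e f g = leg12 sig' (leg13 sig' (leg23 sig' \<phi>)) e f g"
  by (simp add: op_defs leg_defs D_mult D_coassoc D_swap[of f] ml tri_simps)

text \<open>Mixed pentagons: \<open>kap\<close> and \<open>rho\<close> supply the factor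
  \<open>R(g\<^sub>3)\<close> of the coaction in \<open>opG\<close> and \<open>opG'\<close>, whose
  pentagons rest on this lemma and the next.\<close>

lemma kap_sig: "leg23 kap (leg12 sig \<phi>) e f g = leg12 sig (leg13 kap (leg23 kap \<phi>)) e f g"
  by (simp add: op_defs leg_defs D_mult D_R D_coassoc D_swap[of g] ml tri_simps)

lemma rho_sig': "leg23 rho (leg12 sig' \<phi>) e f g = leg12 sig' (leg13 rho (leg23 rho \<phi>)) e f g"
  by (simp add: op_defs leg_defs D_mult D_R D_coassoc D_swap[of f] ml tri_simps)

lemma T_sig: "leg23 sig (leg12 opT \<phi>) f g m = leg12 opT (leg23 sig \<phi>) f g m"
  "leg23 sig (leg12 opT' \<phi>) f g m = leg12 opT' (leg23 sig \<phi>) f g m"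
  by (simp_all add: op_defs leg_defs D_swap[of m] ml tri_simps)

lemma sig'_sig: "leg23 sig (leg12 sig' \<phi>) f g m = leg13 sig' (leg12 sig' (leg23 sig \<phi>)) f g m"
  by (simp add: op_defs leg_defs D_mult D_coassoc D_swap[of m] ml tri_simps)

lemma sig'_rho: "leg13 sig' (leg23 rho \<phi>) e f g = leg23 rho (leg13 sig' \<phi>) e f g"
  by (simp add: op_defs leg_defs D_coassoc ml tri_simps)

lemma kap_sig_comm: "leg23 sig (leg13 kap \<phi>) e f g = leg13 kap (leg23 sig \<phi>) e f g"
  by (simp add: op_defs leg_defs D_coassoc ml tri_simps)

text \<open>The core of the module condition \<open>opG_identity\<close>. With \<open>theta\<close>
  and \<open>tau\<close> it is a mere regrouping of Sweedler indices; the cancellations are left to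
  \<open>theta_eq\<close> and \<open>tau_eq\<close>.\<close>

lemma sig_theta: "leg12 theta (leg23 sig (leg12 sig' \<phi>)) f g m = leg12 sig (leg13 sig (leg12 tau \<phi>)) f g m"
  by (simp add: op_defs leg_defs D_mult D_R D_coassoc D_swap[of m] ml tri_simps)

text \<open>The factors \<open>h\<^sub>3 R(h\<^sub>2)\<close> collapse by \<open>R_right\<close>.
  This is how a factor \<open>sig\<close> or \<open>sig'\<close> is absorbed in the three lemmas
  below.\<close>

lemma R_cancel:
  assumes "trilin F"
  shows "D h (\<lambda>a r. D r (\<lambda>b r. D r (\<lambda>u v. F a (u * R b) v))) = D h (\<lambda>a v. F a 1 v)"
proof -
  note T = trilinD[OF assms] linD[OF eps_lin]
  have "D r (\<lambda>b r. D r (\<lambda>u v. F a (u * R b) v)) = F a 1 r" for a r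
  proof -
    have "D r (\<lambda>b r. D r (\<lambda>u v. F a (u * R b) v)) = D r (\<lambda>t v. D t (\<lambda>b u. F a (u * R b) v))"
      by (subst D_coassoc) (simp_all add: ml T)
    also have "\<dots> = D r (\<lambda>t v. eps t * F a 1 v)"
      by (subst R_right) (simp_all add: ml T)
    also have "\<dots> = F a 1 r"
      by (subst D_eps_left) (simp_all add: ml T)
    finally show ?thesis .
  qed
  then show ?thesis by simp
qed

lemma kap_sig_sig: "leg23 sig (leg13 sig (leg12 kap \<phi>)) f g m = leg12 kap (leg23 sig \<phi>) f g m"
proof -
  have "leg23 sig (leg13 sig (leg12 kap \<phi>)) f g m =
    D m (\<lambda>p q. D q (\<lambda>u v. D p (\<lambda>a b. D g (\<lambda>x y. \<phi> (f * (u * R b) * R y) (x * a) v))))"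
    by (simp add: op_defs leg_defs D_mult R_mult D_swap[of g] ml tri_simps)
  also have "\<dots> = D m (\<lambda>p q. D p (\<lambda>a b. D q (\<lambda>u v. D g (\<lambda>x y. \<phi> (f * (u * R b) * R y) (x * a) v))))"
    by (subst (2) D_swap) simp
  also have "\<dots> = D g (\<lambda>x y. D m (\<lambda>a r. D r (\<lambda>b r. D r (\<lambda>u v. \<phi> (f * (u * R b) * R y) (x * a) v))))"
    by (simp add: D_coassoc D_swap[of g] ml tri_simps)
  also have "\<dots> = D g (\<lambda>x y. D m (\<lambda>a v. \<phi> (f * 1 * R y) (x * a) v))"
    by (subst R_cancel[of "\<lambda>a t v. \<phi> (f * t * R _) (_ * a) v"]) (simp_all add: ml tri_simps)
  finally show ?thesis by (simp add: op_defs leg_defs)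
qed

lemma rho_sig_sig': "leg23 sig (leg12 rho (leg13 sig' \<phi>)) f g m = leg12 rho (leg23 sig \<phi>) f g m"
proof -
  have "leg23 sig (leg12 rho (leg13 sig' \<phi>)) f g m =
    D g (\<lambda>x y. D m (\<lambda>a r. D r (\<lambda>b r. D r (\<lambda>u v. \<phi> (u * R b * R y * f) (x * a) v))))"
    by (simp add: op_defs leg_defs D_mult R_mult D_coassoc D_swap[of m] ml tri_simps)
  also have "\<dots> = D g (\<lambda>x y. D m (\<lambda>a v. \<phi> (1 * R y * f) (x * a) v))"
    by (subst R_cancel[of "\<lambda>a t v. \<phi> (t * R _ * f) (_ * a) v"]) (simp_all add: ml tri_simps)
  finally show ?thesis by (simp add: op_defs leg_defs)
qed

lemma theta_sig_sig': "leg23 sig (leg12 theta (leg13 sig' \<phi>)) f g m = leg12 theta (leg23 sig \<phi>) f g m"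
proof -
  have "leg23 sig (leg12 theta (leg13 sig' \<phi>)) f g m =
    D g (\<lambda>x y. D m (\<lambda>a r. D r (\<lambda>b r. D r (\<lambda>u v. \<phi> (u * R b * R y) (f * x * a) v))))"
    by (simp add: op_defs leg_defs D_mult R_mult D_coassoc D_swap[of m] ml tri_simps)
  also have "\<dots> = D g (\<lambda>x y. D m (\<lambda>a v. \<phi> (1 * R y) (f * x * a) v))"
    by (subst R_cancel[of "\<lambda>a t v. \<phi> (t * R _) (f * _ * a) v"]) (simp_all add: ml tri_simps)
  finally show ?thesis by (simp add: op_defs leg_defs mult.assoc)
qed

end

context
  fixes \<psi> assumes bil: "bilin \<psi>"
begin

lemmas bil_simps = bilinD[OF bil] linD[OF eps_lin]

text \<open>\<open>R(b\<^sub>2) b\<^sub>1\<close> cancels by \<open>R_left\<close>.\<close>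

lemma tau_eq: "tau \<psi> a b = kap (opT \<psi>) a b"
proof -
  have "kap (opT \<psi>) a b = D a (\<lambda>x y. D b (\<lambda>u r. D r (\<lambda>v w. \<psi> (x * R w) (y * (R v * u)))))"
    by (simp add: op_defs D_mult D_R D_swap[of a] ml bil_simps)
  also have "\<dots> = D a (\<lambda>x y. D b (\<lambda>r w. eps r * \<psi> (x * R w) y))"
  proof -
    have "D b (\<lambda>u r. D r (\<lambda>v w. \<psi> (x * R w) (y * (R v * u)))) = D b (\<lambda>r w. eps r * \<psi> (x * R w) y)" for x y
    proof -
      have "D b (\<lambda>u r. D r (\<lambda>v w. \<psi> (x * R w) (y * (R v * u)))) = D b (\<lambda>r w. D r (\<lambda>u v. \<psi> (x * R w) (y * (R v * u))))"
        by (subst D_coassoc) (simp_all add: ml bil_simps)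
      then show ?thesis
        by (subst (asm) R_left[of "\<lambda>t. \<psi> (x * R _) (y * t)"]) (simp_all add: ml bil_simps)
    qed
    then show ?thesis by simp
  qed
  also have "\<dots> = D a (\<lambda>x y. \<psi> (x * R b) y)"
    by (subst D_eps_left) (simp_all add: ml bil_simps)
  finally show ?thesis by (simp add: op_defs)
qed

text \<open>\<open>R(a\<^sub>2) R(R(a\<^sub>3)) = R(R(a\<^sub>3) a\<^sub>2)\<close> cancels, which
  is the reason for the factor \<open>S\<^sup>-\<^sup>2\<close> in the module condition.\<close>

lemma theta_eq: "theta \<psi> a b = opT' (sq (rho \<psi>)) a b"
proof -
  have "opT' (sq (rho \<psi>)) a b = D b (\<lambda>x y. D a (\<lambda>u r. D r (\<lambda>v w. \<psi> (R y * R (R w * v)) (u * x))))"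
    by (simp add: op_defs D_mult R_mult D_coassoc D_swap[of b] ml bil_simps)
  also have "\<dots> = D b (\<lambda>x y. D a (\<lambda>u r. eps r * \<psi> (R y) (u * x)))"
  proof -
    have "D r (\<lambda>v w. \<psi> (R y * R (R w * v)) t) = eps r * \<psi> (R y) t" for r y t
      using R_left[of "\<lambda>z. \<psi> (R y * R z) t" r] by (simp add: ml bil_simps) (metis R_S S_1 mult.right_neutral)
    then show ?thesis by simp
  qed
  also have "\<dots> = D b (\<lambda>x y. \<psi> (R y) (a * x))"
    by (subst D_eps_right) (simp_all add: ml bil_simps)
  finally show ?thesis by (simp add: op_defs)
qed

text \<open>This and the next four lemmas exhibit left inverses, which give the injectivity of the
  operators in \<open>op_inj\<close>.\<close>

lemma opT_inv: "D a (\<lambda>x y. opT \<psi> x (S y * b)) = \<psi> a b"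
proof -
  have "D a (\<lambda>x y. opT \<psi> x (S y * b)) = D a (\<lambda>x r. D r (\<lambda>u v. \<psi> x (u * S v * b)))"
    by (simp add: op_defs D_coassoc ml bil_simps)
  also have "\<dots> = D a (\<lambda>x r. eps r * \<psi> x b)"
    by (subst S_right[of "\<lambda>t. \<psi> _ (t * b)"]) (simp_all add: ml bil_simps)
  also have "\<dots> = \<psi> a b" by (subst D_eps_right) (simp_all add: ml bil_simps)
  finally show ?thesis .
qed

lemma opT'_inv: "D a (\<lambda>x y. opT' \<psi> y (R x * b)) = \<psi> a b"
proof -
  have "D a (\<lambda>x y. opT' \<psi> y (R x * b)) = D a (\<lambda>r y. D r (\<lambda>u v. \<psi> y (v * R u * b)))"
    by (simp add: op_defs D_coassoc ml bil_simps)
  also have "\<dots> = D a (\<lambda>r y. eps r * \<psi> y b)"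
    by (subst R_right[of "\<lambda>t. \<psi> _ (t * b)"]) (simp_all add: ml bil_simps)
  also have "\<dots> = \<psi> a b" by (subst D_eps_left) (simp_all add: ml bil_simps)
  finally show ?thesis .
qed

lemma sig_inv: "D b (\<lambda>x y. sig \<psi> (a * S x) y) = \<psi> a b"
proof -
  have "D b (\<lambda>x y. sig \<psi> (a * S x) y) = D b (\<lambda>r y. D r (\<lambda>u v. \<psi> (a * (S u * v)) y))"
    by (simp add: op_defs D_coassoc ml bil_simps)
  also have "\<dots> = D b (\<lambda>r y. eps r * \<psi> a y)"
    by (subst S_left[of "\<lambda>t. \<psi> (a * t) _"]) (simp_all add: ml bil_simps)
  also have "\<dots> = \<psi> a b" by (subst D_eps_left) (simp_all add: ml bil_simps)
  finally show ?thesis .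
qed

lemma sig'_inv: "D b (\<lambda>x y. sig' \<psi> (R x * a) y) = \<psi> a b"
proof -
  have "D b (\<lambda>x y. sig' \<psi> (R x * a) y) = D b (\<lambda>r y. D r (\<lambda>u v. \<psi> (v * R u * a) y))"
    by (simp add: op_defs D_coassoc ml bil_simps)
  also have "\<dots> = D b (\<lambda>r y. eps r * \<psi> a y)"
    by (subst R_right[of "\<lambda>t. \<psi> (t * a) _"]) (simp_all add: ml bil_simps)
  also have "\<dots> = \<psi> a b" by (subst D_eps_left) (simp_all add: ml bil_simps)
  finally show ?thesis .
qed

lemma kap_inv: "D b (\<lambda>x y. kap \<psi> (a * y) x) = \<psi> a b"
proof -
  have "D b (\<lambda>x y. kap \<psi> (a * y) x) = D b (\<lambda>x r. D r (\<lambda>u v. \<psi> (a * (v * R u)) x))"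
    by (simp add: op_defs D_coassoc ml bil_simps)
  also have "\<dots> = D b (\<lambda>x r. eps r * \<psi> a x)"
    by (subst R_right[of "\<lambda>t. \<psi> (a * t) _"]) (simp_all add: ml bil_simps)
  also have "\<dots> = \<psi> a b" by (subst D_eps_right) (simp_all add: ml bil_simps)
  finally show ?thesis .
qed

end
end

section \<open>Operators on multilinear forms\<close>

text \<open>Multilinear forms in the arguments \<open>x 0, \<dots>, x (n - 1)\<close> are functions of a sequence \<open>x\<close>,
  so that a binary operator can act on any two of the arguments.\<close>

definition legs :: "nat \<Rightarrow> nat \<Rightarrow> (('h \<Rightarrow> 'h \<Rightarrow> 'K) \<Rightarrow> 'h \<Rightarrow> 'h \<Rightarrow> 'K) \<Rightarrow> ((nat \<Rightarrow> 'h) \<Rightarrow> 'K) \<Rightarrow> (nat \<Rightarrow> 'h) \<Rightarrow> 'K" where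
  "legs i j F \<phi> x = F (\<lambda>a b. \<phi> (x(i := a, j := b))) (x i) (x j)"

text \<open>Freezes all arguments but three, so that identities of trilinear forms transfer to
  \<open>legs\<close>.\<close>

definition slice :: "(nat \<Rightarrow> 'h) \<Rightarrow> nat \<Rightarrow> nat \<Rightarrow> nat \<Rightarrow> ((nat \<Rightarrow> 'h) \<Rightarrow> 'K) \<Rightarrow> 'h \<Rightarrow> 'h \<Rightarrow> 'h \<Rightarrow> 'K" where
  "slice x i j k \<phi> = (\<lambda>a b c. \<phi> (x(i := a, j := b, k := c)))"

lemma slice_eval: "\<phi> x = slice x i j k \<phi> (x i) (x j) (x k)"
  by (simp add: slice_def)

lemma slice_at:
  assumes "i \<noteq> j" "i \<noteq> k" "j \<noteq> k"
  shows "slice x i j k (legs i j F \<phi>) = leg12 F (slice x i j k \<phi>)"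
    "slice x i j k (legs i k F \<phi>) = leg13 F (slice x i j k \<phi>)"
    "slice x i j k (legs j k F \<phi>) = leg23 F (slice x i j k \<phi>)"
proof -
  have *: "x(i := a, j := b, k := c, i := a', j := b') = x(i := a', j := b', k := c)"
    "x(i := a, j := b, k := c, i := a', k := c') = x(i := a', j := b, k := c')"
    "x(i := a, j := b, k := c, j := b', k := c') = x(i := a, j := b', k := c')" for a b c a' b' c'
    using assms by (auto simp: fun_eq_iff)
  show "slice x i j k (legs i j F \<phi>) = leg12 F (slice x i j k \<phi>)"
    "slice x i j k (legs i k F \<phi>) = leg13 F (slice x i j k \<phi>)"
    "slice x i j k (legs j k F \<phi>) = leg23 F (slice x i j k \<phi>)"
    unfolding slice_def legs_def leg12_def leg13_def leg23_def * using assms by auto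
qed

text \<open>The transposition of two legs, used to renumber legs by conjugation.\<close>

definition swp :: "('h \<Rightarrow> 'h \<Rightarrow> 'K) \<Rightarrow> 'h \<Rightarrow> 'h \<Rightarrow> 'K" where
  "swp \<psi> a b = \<psi> b a"

lemma legs_swp_conj:
  assumes "i \<noteq> j" "i \<noteq> k" "j \<noteq> k"
  shows "legs i j swp (legs j k F (legs i j swp \<phi>)) = legs i k F \<phi>"
proof
  fix x
  have "legs i j swp (legs j k F (legs i j swp \<phi>)) x = slice x i j k (legs i j swp (legs j k F (legs i j swp \<phi>))) (x i) (x j) (x k)"
    by (rule slice_eval)
  also have "\<dots> = slice x i j k (legs i k F \<phi>) (x i) (x j) (x k)"
    using assms by (simp add: slice_at leg12_def leg13_def leg23_def swp_def)
  finally show "legs i j swp (legs j k F (legs i j swp \<phi>)) x = legs i k F \<phi> x"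
    by (simp flip: slice_eval)
qed

lemma legs_swp_swp: assumes "i \<noteq> j" shows "legs i j swp (legs i j swp \<phi>) = \<phi>"
proof
  fix x
  show "legs i j swp (legs i j swp \<phi>) x = \<phi> x"
    using assms by (auto simp: legs_def swp_def fun_eq_iff intro!: arg_cong[of _ _ \<phi>])
qed

section \<open>Multilinear forms and the operators acting on them\<close>

context sweedler
begin

text \<open>Being pointwise a finite combination of values makes an operator linear and lets
  operators on disjoint legs commute.\<close>

definition good :: "(('h \<Rightarrow> 'h \<Rightarrow> 'K) \<Rightarrow> 'h \<Rightarrow> 'h \<Rightarrow> 'K) \<Rightarrow> bool" where
  "good F \<longleftrightarrow> (\<forall>a b. fincomb (\<lambda>\<psi>. F (\<lambda>x y. \<psi> (x, y)) a b)) \<and> (\<forall>\<psi>. bilin \<psi> \<longrightarrow> bilin (F \<psi>))"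

text \<open>The second conjunct confines the dependence to the first \<open>n\<close> arguments, as
  the finite-dimensionality in \<open>mlin_span\<close> requires.\<close>

definition mlin :: "nat \<Rightarrow> ((nat \<Rightarrow> 'h) \<Rightarrow> 'K) \<Rightarrow> bool" where
  "mlin n \<phi> \<longleftrightarrow> (\<forall>x. \<forall>i<n. lin (\<lambda>h. \<phi> (x(i := h)))) \<and> (\<forall>x y. (\<forall>i<n. x i = y i) \<longrightarrow> \<phi> x = \<phi> y)"

lemma mlin_bilin:
  assumes "mlin n \<phi>" "i < n" "j < n" "i \<noteq> j"
  shows "bilin (\<lambda>a b. \<phi> (x(i := a, j := b)))"
proof -
  have "x(i := a, j := b) = x(j := b, i := a)" for a b
    using assms(4) by (auto simp: fun_eq_iff)
  then have "lin (\<lambda>a. \<phi> (x(i := a, j := b)))" for b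
    using assms(1,2) by (simp add: mlin_def)
  moreover have "lin (\<lambda>b. \<phi> (x(i := a, j := b)))" for a
    using assms(1,3) by (simp add: mlin_def)
  ultimately show ?thesis by (simp add: bilin_def)
qed

lemma mlin_trilin:
  assumes "mlin n \<phi>" "i < n" "j < n" "k < n" "i \<noteq> j" "i \<noteq> k" "j \<noteq> k"
  shows "trilin (slice x i j k \<phi>)"
proof -
  have "lin (\<lambda>h. \<phi> (x(i := h, j := b, k := c)))" for b c
  proof -
    have "(\<lambda>h. \<phi> (x(i := h, j := b, k := c))) = (\<lambda>h. \<phi> ((x(j := b, k := c))(i := h)))"
      using assms(5-7) by (simp add: fun_upd_twist)
    then show ?thesis using assms(1,2) by (simp only: mlin_def)
  qed
  then show ?thesis
    unfolding trilin_def slice_def using mlin_bilin[OF assms(1,3,4,7)] by blast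
qed

lemma good_plus: "good F \<Longrightarrow> F (\<lambda>x y. \<phi> x y + \<psi> x y) a b = F \<phi> a b + F \<psi> a b"
  using fincomb_plus[of "\<lambda>\<psi>. F (\<lambda>x y. \<psi> (x, y)) a b" "\<lambda>(x, y). \<phi> x y" "\<lambda>(x, y). \<psi> x y"]
  by (simp add: good_def)

lemma good_cmult: "good F \<Longrightarrow> F (\<lambda>x y. c * \<psi> x y) a b = c * F \<psi> a b"
  using fincomb_cmult[of "\<lambda>\<psi>. F (\<lambda>x y. \<psi> (x, y)) a b" c "\<lambda>(x, y). \<psi> x y"]
  by (simp add: good_def)

lemma good_swap:
  assumes "good F" "good G"
  shows "F (\<lambda>x y. G (\<lambda>u v. \<phi> x y u v) c d) a b = G (\<lambda>u v. F (\<lambda>x y. \<phi> x y u v) a b) c d"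
  using fincomb_swap[of "\<lambda>\<psi>. F (\<lambda>x y. \<psi> (x, y)) a b" "\<lambda>\<psi>. G (\<lambda>x y. \<psi> (x, y)) c d"
     "\<lambda>(x, y) (u, v). \<phi> x y u v"] assms by (simp add: good_def)

lemma mlin_at:
  assumes F: "good F" and \<phi>: "mlin n \<phi>" and ij: "i < n" "j < n" "i \<noteq> j"
  shows "mlin n (legs i j F \<phi>)"
  unfolding mlin_def
proof (intro conjI allI impI)
  fix x l assume l: "l < n"
  have bil: "bilin (F (\<lambda>a b. \<phi> (x(i := a, j := b))))"
    using F mlin_bilin[OF \<phi> ij] by (simp add: good_def)
  consider "l = i" | "l = j" | "l \<noteq> i" "l \<noteq> j" by blast
  then show "lin (\<lambda>h. legs i j F \<phi> (x(l := h)))"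
  proof cases
    case 1
    then show ?thesis using bil ij by (simp add: legs_def bilin_def)
  next
    case 2
    have "(x(j := h, i := a, j := b)) = x(i := a, j := b)" for h a b
      by (auto simp: fun_eq_iff)
    with 2 show ?thesis using bil ij by (simp add: legs_def bilin_def)
  next
    case 3
    have eq: "x(l := h, i := a, j := b) = (x(i := a, j := b))(l := h)" for h a b
      using 3 by (auto simp: fun_eq_iff)
    have L: "lin (\<lambda>h. \<phi> ((x(i := a, j := b))(l := h)))" for a b
      using \<phi> l by (simp add: mlin_def)
    show ?thesis
      using 3 unfolding legs_def eq lin_def
      by (simp add: linD(1)[OF L] linD(2)[OF L] good_plus[OF F] good_cmult[OF F])
  qed
next
  fix x y :: "nat \<Rightarrow> 'h" assume "\<forall>i<n. x i = y i"
  then have "x i = y i" "x j = y j" "\<phi> (x(i := a, j := b)) = \<phi> (y(i := a, j := b))" for a b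
    using ij \<phi> unfolding mlin_def by auto
  then show "legs i j F \<phi> x = legs i j F \<phi> y" by (simp add: legs_def)
qed

lemma legs_commute:
  assumes "good F" "good G" "i \<noteq> k" "i \<noteq> l" "j \<noteq> k" "j \<noteq> l"
  shows "legs i j F (legs k l G \<phi>) = legs k l G (legs i j F \<phi>)"
proof
  fix x :: "nat \<Rightarrow> 'h"
  have "x(k := c, l := d, i := a, j := b) = x(i := a, j := b, k := c, l := d)" for a b c d
    using assms(3-6) by (auto simp: fun_eq_iff)
  then show "legs i j F (legs k l G \<phi>) x = legs k l G (legs i j F \<phi>) x"
    using assms(3-6) good_swap[OF assms(1,2)] by (simp add: legs_def)
qed

lemma legs_plus: assumes "good F" shows "legs i j F (\<phi> + \<psi>) = legs i j F \<phi> + legs i j F \<psi>"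
  by (rule ext) (simp add: legs_def good_plus[OF assms])

lemma legs_cmult: assumes "good F" shows "legs i j F (\<lambda>x. c * \<phi> x) = (\<lambda>x. c * legs i j F \<phi> x)"
  by (rule ext) (simp add: legs_def good_cmult[OF assms])

lemma good_D: 
  assumes "\<And>\<psi>. bilin \<psi> \<Longrightarrow> bilin (F \<psi>)" "\<And>\<psi> a b. F \<psi> a b = D (h a b) (\<lambda>x y. \<psi> (l a b x y) (r a b x y))"
  shows "good F"
  unfolding good_def
proof (intro conjI allI impI)
  fix a b
  have "fincomb (\<lambda>\<psi>. D (h a b) (\<lambda>x y. (\<lambda>p. \<psi> (l a b (fst p) (snd p), r a b (fst p) (snd p))) (x, y)))"
    by (rule fincomb_compose[OF D_comb fincomb_eval])
  then show "fincomb (\<lambda>\<psi>. F (\<lambda>x y. \<psi> (x, y)) a b)" by (simp add: assms(2))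
qed (rule assms(1))

lemma good_swp: "good swp"
  unfolding good_def swp_def bilin_def by (auto intro: fincomb_eval)

end

context bijective_antipode
begin

lemma good_ops: "good opT" "good opT'" "good sig" "good sig'" "good kap" "good rho" "good theta" "good tau" "good sq"
proof -
  show "good sq"
    unfolding good_def by (simp add: op_bilin) (simp add: sq_def fincomb_eval)
qed (rule good_D, erule op_bilin, simp only: op_defs)+

lemmas good_all = good_ops good_swp
lemmas mlin_ops = good_all[THEN mlin_at]

lemma legs_identity:
  assumes ijk: "i \<noteq> j" "i \<noteq> k" "j \<noteq> k"
    and "slice x i j k \<phi> (x i) (x j) (x k) = slice x i j k \<psi> (x i) (x j) (x k)"
  shows "\<phi> x = \<psi> x"
  using assms(4) by (simp flip: slice_eval)

context
  fixes n i j k :: nat and \<phi> :: "(nat \<Rightarrow> 'h) \<Rightarrow> 'K"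
  assumes lt: "i < n" "j < n" "k < n" and ne: "i \<noteq> j" "i \<noteq> k" "j \<noteq> k" and \<phi>: "mlin n \<phi>"
begin

lemmas tri = mlin_trilin[OF \<phi> lt ne]

text \<open>The identities for three legs, transferred through \<open>slice\<close>. Their order
  matters, since later proofs select members by position.\<close>

lemma legs_identities:
  "legs j k opT (legs i k opT (legs i j opT \<phi>)) = legs i j opT (legs j k opT \<phi>)"
  "legs j k opT' (legs i k opT' (legs i j opT' \<phi>)) = legs i j opT' (legs j k opT' \<phi>)"
  "legs j k sig (legs i j sig \<phi>) = legs i j sig (legs i k sig (legs j k sig \<phi>))"
  "legs j k sig' (legs i j sig' \<phi>) = legs i j sig' (legs i k sig' (legs j k sig' \<phi>))"
  "legs j k kap (legs i j sig \<phi>) = legs i j sig (legs i k kap (legs j k kap \<phi>))"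
  "legs j k rho (legs i j sig' \<phi>) = legs i j sig' (legs i k rho (legs j k rho \<phi>))"
  "legs j k sig (legs i j opT \<phi>) = legs i j opT (legs j k sig \<phi>)"
  "legs j k sig (legs i j opT' \<phi>) = legs i j opT' (legs j k sig \<phi>)"
  "legs j k sig (legs i j sig' \<phi>) = legs i k sig' (legs i j sig' (legs j k sig \<phi>))"
  "legs i k sig' (legs j k rho \<phi>) = legs j k rho (legs i k sig' \<phi>)"
  "legs j k sig (legs i k kap \<phi>) = legs i k kap (legs j k sig \<phi>)"
  "legs i j theta (legs j k sig (legs i j sig' \<phi>)) = legs i j sig (legs i k sig (legs i j tau \<phi>))"
  "legs j k sig (legs i k sig (legs i j kap \<phi>)) = legs i j kap (legs j k sig \<phi>)"
  "legs j k sig (legs i j rho (legs i k sig' \<phi>)) = legs i j rho (legs j k sig \<phi>)"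
  "legs j k sig (legs i j theta (legs i k sig' \<phi>)) = legs i j theta (legs j k sig \<phi>)"
  by (rule ext, rule legs_identity[OF ne],
      simp only: slice_at[OF ne] pent_T[OF tri] pent_T'[OF tri] pent_sig[OF tri] pent_sig'[OF tri]
       kap_sig[OF tri] rho_sig'[OF tri] T_sig[OF tri] sig'_sig[OF tri] sig'_rho[OF tri]
       kap_sig_comm[OF tri] sig_theta[OF tri] kap_sig_sig[OF tri] rho_sig_sig'[OF tri] theta_sig_sig'[OF tri])+

end

lemma legs_comp:
  fixes \<phi> :: "(nat \<Rightarrow> 'h) \<Rightarrow> 'K"
  assumes "i \<noteq> j"
  shows "legs i j F (legs i j G \<phi>) = legs i j (\<lambda>\<psi>. F (G \<psi>)) \<phi>"
proof
  fix x :: "nat \<Rightarrow> 'h"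
  have "x(i := a, j := b, i := c, j := d) = x(i := c, j := d)" for a b c d
    using assms by (auto simp: fun_eq_iff)
  then show "legs i j F (legs i j G \<phi>) x = legs i j (\<lambda>\<psi>. F (G \<psi>)) \<phi> x"
    using assms by (simp add: legs_def)
qed

lemma legs_tau: "mlin n \<phi> \<Longrightarrow> i < n \<Longrightarrow> j < n \<Longrightarrow> i \<noteq> j \<Longrightarrow> legs i j tau \<phi> = legs i j kap (legs i j opT \<phi>)"
  using tau_eq[OF mlin_bilin] by (simp add: legs_comp) (simp add: legs_def fun_eq_iff)

lemma legs_theta: "mlin n \<phi> \<Longrightarrow> i < n \<Longrightarrow> j < n \<Longrightarrow> i \<noteq> j \<Longrightarrow>
    legs i j theta \<phi> = legs i j opT' (legs i j sq (legs i j rho \<phi>))"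
  using theta_eq[OF mlin_bilin] by (simp add: legs_comp) (simp add: legs_def fun_eq_iff)

end

lemma sum_fun_apply: "(\<Sum>i\<in>I. f i) x = (\<Sum>i\<in>I. f i x)" for f :: "'i \<Rightarrow> 'x \<Rightarrow> 'y::comm_monoid_add"
  by (induction I rule: infinite_finite_induct) auto

locale closed_forms = bijective_antipode scale emb D eps S Bs cf R
  for scale :: "'k::field \<Rightarrow> 'h::ring_1 \<Rightarrow> 'h" and emb :: "'k \<Rightarrow> 'K::alg_closed_field" and D eps S Bs cf R
begin

definition fscale :: "'K \<Rightarrow> ((nat \<Rightarrow> 'h) \<Rightarrow> 'K) \<Rightarrow> (nat \<Rightarrow> 'h) \<Rightarrow> 'K" where
  "fscale c \<phi> = (\<lambda>x. c * \<phi> x)"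

sublocale FS: alg_closed_space fscale
  by unfold_locales (auto simp: fscale_def fun_eq_iff algebra_simps)

lemma mlin_plus: "mlin n \<phi> \<Longrightarrow> mlin n \<psi> \<Longrightarrow> mlin n (\<phi> + \<psi>)"
  unfolding mlin_def lin_def plus_fun_def by (auto simp: algebra_simps intro!: arg_cong2[of _ _ _ _ "(+)"])

lemma mlin_fscale: "mlin n \<phi> \<Longrightarrow> mlin n (fscale c \<phi>)"
  unfolding mlin_def lin_def fscale_def by (auto simp: algebra_simps)

lemma mlin_0: "mlin n 0"
  unfolding mlin_def lin_def by simp

lemma mlin_subspace: "FS.subspace {\<phi>. mlin n \<phi>}"
  by (simp add: FS.subspace_def mlin_0 mlin_plus mlin_fscale)

text \<open>Induction on the number of legs: the last argument is expanded by \<open>expand\<close>,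
  and the products of a coordinate functional with a spanning form in fewer legs span.\<close>

lemma mlin_span: "\<exists>B. finite B \<and> {\<phi>. mlin n \<phi>} \<subseteq> FS.span B"
proof (induction n)
  case 0
  have "\<phi> \<in> FS.span {\<lambda>_. 1}" if "mlin 0 \<phi>" for \<phi>
  proof -
    have "\<phi> = fscale (\<phi> undefined) (\<lambda>_. 1)"
      using that by (auto simp: mlin_def fscale_def)
    then show ?thesis by (metis FS.span_base FS.span_scale singletonI)
  qed
  then show ?case by (intro exI[of _ "{\<lambda>_. 1}"]) auto
next
  case (Suc n)
  then obtain B where B: "finite B" "{\<phi>. mlin n \<phi>} \<subseteq> FS.span B" by blast
  define C where "C = (\<Union>b\<in>Bs. (\<lambda>\<beta> x. cf b (x n) * \<beta> x) ` B)"
  have "finite C" using Bs_finite B(1) by (simp add: C_def)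
  have ext: "(\<lambda>x. cf b (x n) * \<chi> x) \<in> FS.span C" if "\<chi> \<in> FS.span B" "b \<in> Bs" for \<chi> b
    using that(1)
  proof (induction rule: FS.span_induct_alt)
    case base
    have "(\<lambda>x. cf b (x n) * 0 x) = 0" by auto
    then show ?case by (simp only: FS.span_zero)
  next
    case (step c \<beta> \<chi>)
    have "(\<lambda>x. cf b (x n) * (fscale c \<beta> + \<chi>) x) = fscale c (\<lambda>x. cf b (x n) * \<beta> x) + (\<lambda>x. cf b (x n) * \<chi> x)"
      by (auto simp: fscale_def algebra_simps)
    moreover have "(\<lambda>x. cf b (x n) * \<beta> x) \<in> C" using step that by (auto simp: C_def)
    ultimately show ?case using step
      by (simp only: FS.span_add FS.span_scale FS.span_base)
  qed
  have "\<phi> \<in> FS.span C" if \<phi>: "mlin (Suc n) \<phi>" for \<phi>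
  proof -
    have "mlin n (\<lambda>x. \<phi> (x(n := b)))" for b
      unfolding mlin_def
    proof (intro conjI allI impI)
      fix x i assume "i < n"
      then have "x(i := h, n := b) = (x(n := b))(i := h)" for h by auto
      then show "lin (\<lambda>h. \<phi> (x(i := h, n := b)))"
        using \<phi> \<open>i < n\<close> by (simp add: mlin_def)
    qed (use \<phi> in \<open>auto simp: mlin_def\<close>)
    then have "(\<lambda>x. cf b (x n) * \<phi> (x(n := b))) \<in> FS.span C" if "b \<in> Bs" for b
      using ext[of "\<lambda>x. \<phi> (x(n := b))" b] B(2) that by auto
    then have "(\<Sum>b\<in>Bs. (\<lambda>x. cf b (x n) * \<phi> (x(n := b)))) \<in> FS.span C"
      by (rule FS.span_sum)
    moreover have "\<phi> = (\<Sum>b\<in>Bs. (\<lambda>x. cf b (x n) * \<phi> (x(n := b))))"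
    proof
      fix x
      have "lin (\<lambda>h. \<phi> (x(n := h)))" using \<phi> by (simp add: mlin_def)
      from expand[OF this, of "x n"] show "\<phi> x = (\<Sum>b\<in>Bs. (\<lambda>x. cf b (x n) * \<phi> (x(n := b)))) x"
        by (simp add: sum_fun_apply)
    qed
    ultimately show ?thesis by simp
  qed
  then show ?case using \<open>finite C\<close> by blast
qed

text \<open>Legs \<open>j\<close> and \<open>k\<close> carry the anti-Yetter-Drinfeld module \<open>H \<otimes> H\<close> with action
  \<open>h(g \<otimes> m) = hg \<otimes> m\<close> and coaction \<open>g \<otimes> m \<mapsto> g\<^sub>1m\<^sub>1R(g\<^sub>3) \<otimes> g\<^sub>2 \<otimes> m\<^sub>2\<close>. The two operators below
  multiply leg \<open>i\<close> by its coaction from the right and from the left. The map \<open>m \<mapsto> m\<^sub>(\<^sub>-\<^sub>1\<^sub>)m\<^sub>(\<^sub>0\<^sub>)\<close> of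
  this module is \<open>legs j k sig\<close>.\<close>

definition opG where "opG i j k \<phi> = legs i j sig (legs i k sig (legs i j kap \<phi>))" for i j k :: nat
definition opG' where "opG' i j k \<phi> = legs i j rho (legs i k sig' (legs i j sig' \<phi>))" for i j k :: nat

text \<open>The canonical automorphism commutes with the coaction; hence \<open>opG\<close> and
  \<open>opG'\<close> preserve its eigenspaces.\<close>

lemma opG_sig:
  assumes "mlin n \<phi>" "i < n" "j < n" "k < n" "i \<noteq> j" "i \<noteq> k" "j \<noteq> k"
  shows "legs j k sig (opG i j k \<phi>) = opG i j k (legs j k sig \<phi>)"
    "legs j k sig (opG' i j k \<phi>) = opG' i j k (legs j k sig \<phi>)"
  using assms by (simp_all add: opG_def opG'_def legs_identities[where n = n and i = i and j = j and k = k] mlin_ops)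

text \<open>The transposed module condition: on the left \<open>opT'\<close>, \<open>sq\<close> and
  \<open>rho\<close> merge into \<open>theta\<close>, on the right \<open>kap\<close> and
  \<open>opT\<close> into \<open>tau\<close>, which reduces it to \<open>sig_theta\<close>.\<close>

lemma opG_identity:
  assumes "mlin n \<phi>" "i < n" "j < n" "k < n" "i \<noteq> j" "i \<noteq> k" "j \<noteq> k"
  shows "legs j k sig (legs i j opT' (legs i j sq (opG' i j k \<phi>))) = opG i j k (legs i j opT \<phi>)"
  using assms
  by (simp add: opG_def opG'_def legs_identities(12,15)[where n = n and i = i and j = j and k = k] mlin_ops
      legs_tau[where n = n] legs_theta[where n = n, symmetric])

text \<open>Reflects coassociativity of the coaction. The pentagons on legs \<open>e, f, g\<close>
  and \<open>e, f, m\<close> are combined with the mixed ones, and operators on disjoint legs are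
  sorted by \<open>legs_commute\<close>.\<close>

lemma opG_pentagon:
  assumes "mlin n \<phi>" "e < n" "f < n" "g < n" "m < n" "distinct [e, f, g, m]"
  shows "opG f g m (legs e f sig \<phi>) = legs e f sig (opG e g m (opG f g m \<phi>))"
    "opG' f g m (legs e f sig' \<phi>) = legs e f sig' (opG' e g m (opG' f g m \<phi>))"
proof -
  note ids = legs_identities[where n = n and i = e and j = f and k = g] legs_identities[where n = n and i = e and j = f and k = m]
  show "opG f g m (legs e f sig \<phi>) = legs e f sig (opG e g m (opG f g m \<phi>))"
  proof -
    have "opG f g m (legs e f sig \<phi>) = legs e f sig (legs e g sig (legs f g sig (legs e m sig
      (legs f m sig (legs e g kap (legs f g kap \<phi>))))))"
      using assms by (simp add: opG_def ids(3,5,18) mlin_ops)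
    also have "\<dots> = legs e f sig (legs e g sig (legs e m sig (legs f g sig
      (legs e g kap (legs f m sig (legs f g kap \<phi>))))))"
      using assms by (simp add: legs_commute[OF good_ops(3,3), where i = f and j = g and k = e and l = m] legs_commute[OF good_ops(3,5), where i = f and j = m and k = e and l = g])
    also have "\<dots> = legs e f sig (opG e g m (opG f g m \<phi>))"
      using assms by (simp add: opG_def ids(11) mlin_ops)
    finally show ?thesis .
  qed
  show "opG' f g m (legs e f sig' \<phi>) = legs e f sig' (opG' e g m (opG' f g m \<phi>))"
  proof -
    have "opG' f g m (legs e f sig' \<phi>) = legs e f sig' (legs e g rho (legs f g rho (legs e m sig' (legs f m sig'
      (legs e g sig' (legs f g sig' \<phi>))))))"
      using assms by (simp add: opG'_def ids(4,6,19) mlin_ops)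
    also have "\<dots> = legs e f sig' (legs e g rho (legs e m sig' (legs f g rho (legs e g sig' (legs f m sig' 
      (legs f g sig' \<phi>))))))"
      using assms by (simp add: legs_commute[OF good_ops(4,4), where i = f and j = m and k = e and l = g] legs_commute[OF good_ops(6,4), where i = f and j = g and k = e and l = m])
    also have "\<dots> = legs e f sig' (opG' e g m (opG' f g m \<phi>))"
      using assms by (simp add: opG'_def ids(10) mlin_ops)
    finally show ?thesis .
  qed
qed

lemma op_inj:
  assumes "bilin \<psi>" "bilin \<psi>'"
  shows "opT \<psi> = opT \<psi>' \<Longrightarrow> \<psi> = \<psi>'" "opT' \<psi> = opT' \<psi>' \<Longrightarrow> \<psi> = \<psi>'" "sig \<psi> = sig \<psi>' \<Longrightarrow> \<psi> = \<psi>'"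
    "sig' \<psi> = sig' \<psi>' \<Longrightarrow> \<psi> = \<psi>'" "kap \<psi> = kap \<psi>' \<Longrightarrow> \<psi> = \<psi>'"
  by (intro ext, metis opT_inv assms, intro ext, metis opT'_inv assms, intro ext, metis sig_inv assms,
      intro ext, metis sig'_inv assms, intro ext, metis kap_inv assms)

lemma legs_inj:
  assumes inj: "\<And>\<psi> \<psi>'. bilin \<psi> \<Longrightarrow> bilin \<psi>' \<Longrightarrow> F \<psi> = F \<psi>' \<Longrightarrow> \<psi> = \<psi>'"
    and m: "mlin n \<phi>" "mlin n \<phi>'" and ij: "i < n" "j < n" "i \<noteq> j" and eq: "legs i j F \<phi> = legs i j F \<phi>'"
  shows "\<phi> = \<phi>'"
proof
  fix x :: "nat \<Rightarrow> 'h"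
  have "x(i := a, j := b, i := c, j := d) = x(i := c, j := d)" for a b c d
    using ij(3) by (auto simp: fun_eq_iff)
  then have "F (\<lambda>a b. \<phi> (x(i := a, j := b))) = F (\<lambda>a b. \<phi>' (x(i := a, j := b)))"
    using fun_cong[OF eq, of "x(i := _, j := _)"] ij(3) by (intro ext) (simp add: legs_def)
  from inj[OF mlin_bilin[OF m(1) ij] mlin_bilin[OF m(2) ij] this]
  show "\<phi> x = \<phi>' x" by (metis fun_upd_triv)
qed

text \<open>\<open>sq\<close> touches only its first leg. This allows the determinant of
  \<open>R\<^sup>2\<close> on leg 1 to be compared between the modules on legs 2, 3 and on legs 4,
  5.\<close>

lemma sq_indep: "i \<noteq> j \<Longrightarrow> i \<noteq> k \<Longrightarrow> legs i j sq = legs i k sq"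
  by (rule ext)+ (auto simp: legs_def sq_def fun_eq_iff intro!: arg_cong[of _ _ "_ :: (nat \<Rightarrow> 'h) \<Rightarrow> 'K"])

end

section \<open>The determinant argument\<close>

context closed_forms
begin

text \<open>In the six-linear forms, legs 4 and 5 carry an eigenspace of \<open>sig\<close>, legs 2 and 3 a full copy
  of \<open>H \<otimes> H\<close>, leg 1 is the tensor factor on which \<open>R\<^sup>2\<close> acts, and leg 0 is the extra factor of the
  pentagon equations.\<close>

definition eig :: "'K \<Rightarrow> ((nat \<Rightarrow> 'h) \<Rightarrow> 'K) set" where
  "eig c = {\<phi>. mlin 6 \<phi> \<and> legs 4 5 sig \<phi> = fscale c \<phi>}"

definition mop :: "(((nat \<Rightarrow> 'h) \<Rightarrow> 'K) \<Rightarrow> (nat \<Rightarrow> 'h) \<Rightarrow> 'K) \<Rightarrow> bool" where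
  "mop F \<longleftrightarrow> (\<forall>\<phi>. mlin 6 \<phi> \<longrightarrow> mlin 6 (F \<phi>)) \<and> (\<forall>\<phi> \<psi>. F (\<phi> + \<psi>) = F \<phi> + F \<psi>) \<and>
     (\<forall>c \<phi>. F (fscale c \<phi>) = fscale c (F \<phi>))"

text \<open>Commuting with \<open>legs 4 5 sig\<close> is what makes an operator restrict to every
  \<open>eig c\<close>.\<close>

definition adm :: "(((nat \<Rightarrow> 'h) \<Rightarrow> 'K) \<Rightarrow> (nat \<Rightarrow> 'h) \<Rightarrow> 'K) \<Rightarrow> bool" where
  "adm F \<longleftrightarrow> mop F \<and> (\<forall>\<phi>. mlin 6 \<phi> \<longrightarrow> legs 4 5 sig (F \<phi>) = F (legs 4 5 sig \<phi>))"

definition minj :: "(((nat \<Rightarrow> 'h) \<Rightarrow> 'K) \<Rightarrow> (nat \<Rightarrow> 'h) \<Rightarrow> 'K) \<Rightarrow> bool" where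
  "minj F \<longleftrightarrow> inj_on F {\<phi>. mlin 6 \<phi>}"

lemma mop_legs: "good F \<Longrightarrow> i < 6 \<Longrightarrow> j < 6 \<Longrightarrow> i \<noteq> j \<Longrightarrow> mop (legs i j F)"
  by (simp add: mop_def mlin_at legs_plus legs_cmult fscale_def)

lemma mop_comp: "mop F \<Longrightarrow> mop G \<Longrightarrow> mop (\<lambda>\<phi>. F (G \<phi>))"
  by (simp add: mop_def)

lemma mop_mlin: "mop F \<Longrightarrow> mlin 6 \<phi> \<Longrightarrow> mlin 6 (F \<phi>)"
  by (simp add: mop_def)

lemma adm_comp: "adm F \<Longrightarrow> adm G \<Longrightarrow> adm (\<lambda>\<phi>. F (G \<phi>))"
  by (simp add: adm_def mop_comp mop_mlin)

lemma adm_legs: "good F \<Longrightarrow> i < 4 \<Longrightarrow> j < 4 \<Longrightarrow> i \<noteq> j \<Longrightarrow> adm (legs i j F)"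
  by (simp add: adm_def mop_legs legs_commute[OF good_ops(3)])

lemma mop_opG:
  assumes "i < 6" "j < 6" "k < 6" "i \<noteq> j" "i \<noteq> k" "j \<noteq> k"
  shows "mop (opG i j k)" "mop (opG' i j k)"
proof -
  have "mop (\<lambda>\<phi>. opG i j k \<phi>)" "mop (\<lambda>\<phi>. opG' i j k \<phi>)"
    unfolding opG_def opG'_def
    by (rule mop_comp[OF mop_legs[OF good_ops(3)] mop_comp[OF mop_legs[OF good_ops(3)] mop_legs[OF good_ops(5)]]]
             mop_comp[OF mop_legs[OF good_ops(6)] mop_comp[OF mop_legs[OF good_ops(4)] mop_legs[OF good_ops(4)]]];
        use assms in simp)+
  then show "mop (opG i j k)" "mop (opG' i j k)" by simp_all
qed

lemma adm_opG:
  assumes "i < 4" "j < 4" "k < 4" "i \<noteq> j" "i \<noteq> k" "j \<noteq> k"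
  shows "adm (opG i j k)" "adm (opG' i j k)"
proof -
  have "adm (\<lambda>\<phi>. opG i j k \<phi>)" "adm (\<lambda>\<phi>. opG' i j k \<phi>)"
    unfolding opG_def opG'_def
    by (rule adm_comp[OF adm_legs[OF good_ops(3)] adm_comp[OF adm_legs[OF good_ops(3)] adm_legs[OF good_ops(5)]]]
             adm_comp[OF adm_legs[OF good_ops(6)] adm_comp[OF adm_legs[OF good_ops(4)] adm_legs[OF good_ops(4)]]];
        use assms in simp)+
  then show "adm (opG i j k)" "adm (opG' i j k)" by simp_all
qed

lemma adm_45:
  assumes "i < 4"
  shows "adm (legs i 4 opT)" "adm (legs i 4 opT')" "adm (opG i 4 5)" "adm (opG' i 4 5)" "adm (legs i 4 sq)"
    "adm (legs 4 5 sig)"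
proof -
  \<comment> \<open>An auxiliary leg below 4 replaces leg 4 as the idle second leg of
    \<open>sq\<close>.\<close>
  obtain j :: nat where j: "j < 4" "i \<noteq> j" using that[of "if i = 0 then 1 else 0"] by auto
  show "adm (legs i 4 sq)"
    using assms j adm_legs[OF good_ops(9), of i j] sq_indep[of i j 4] by auto
qed (use assms in \<open>simp_all add: adm_def mop_legs mop_opG good_all opG_sig[where n = 6]
       legs_identities(7,8)[where n = 6 and i = i and j = 4 and k = 5]\<close>)

lemma sig_endo: "FS.endo_on {\<phi>. mlin 6 \<phi>} (legs 4 5 sig)"
  using mop_legs[OF good_ops(3), of 4 5] by (auto simp: FS.endo_on_def mop_def)

lemma eig_subspace: "FS.subspace (eig c)"
  using mop_legs[OF good_ops(3), of 4 5] FS.endo_on_0[OF sig_endo mlin_subspace]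
  by (auto simp: FS.subspace_def eig_def mop_def mlin_0 mlin_plus mlin_fscale FS.scale_right_distrib mult.commute)

lemma adm_endo: "adm F \<Longrightarrow> FS.endo_on (eig c) F"
  by (auto simp: adm_def mop_def FS.endo_on_def eig_def)

lemma minj_legs:
  assumes "i < 6" "j < 6" "i \<noteq> j"
  shows "minj (legs i j opT)" "minj (legs i j opT')" "minj (legs i j sig)" "minj (legs i j sig')" "minj (legs i j kap)"
proof -
  have "minj (legs i j F)" if "\<And>\<psi> \<psi>'. bilin \<psi> \<Longrightarrow> bilin \<psi>' \<Longrightarrow> F \<psi> = F \<psi>' \<Longrightarrow> \<psi> = \<psi>'" for F
    unfolding minj_def using assms that by (intro inj_onI) (auto intro: legs_inj[of F])
  then show "minj (legs i j opT)" "minj (legs i j opT')" "minj (legs i j sig)" "minj (legs i j sig')"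
      "minj (legs i j kap)"
    using op_inj by blast+
qed

lemma minj_comp: "minj F \<Longrightarrow> minj G \<Longrightarrow> mop G \<Longrightarrow> minj (\<lambda>\<phi>. F (G \<phi>))"
  by (simp add: minj_def inj_on_def mop_mlin)

lemma minj_opG:
  assumes "i < 6" "j < 6" "k < 6" "i \<noteq> j" "i \<noteq> k" "j \<noteq> k"
  shows "minj (opG i j k)"
proof -
  have "minj (\<lambda>\<phi>. opG i j k \<phi>)"
    unfolding opG_def
    by (rule minj_comp[OF minj_legs(3) minj_comp[OF minj_legs(3) minj_legs(5) mop_legs[OF good_ops(5)]]
          mop_comp[OF mop_legs[OF good_ops(3)] mop_legs[OF good_ops(5)]]]; use assms in simp)
  then show ?thesis by simp
qed

section \<open>Determinants of admissible operators\<close>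

context
  fixes c :: 'K and \<delta> :: "(((nat \<Rightarrow> 'h) \<Rightarrow> 'K) \<Rightarrow> (nat \<Rightarrow> 'h) \<Rightarrow> 'K) \<Rightarrow> 'K"
  assumes \<delta>_mult: "\<And>F G. adm F \<Longrightarrow> adm G \<Longrightarrow> \<delta> (\<lambda>\<phi>. F (G \<phi>)) = \<delta> F * \<delta> G"
    and \<delta>_cong: "\<And>F G. (\<And>\<phi>. mlin 6 \<phi> \<Longrightarrow> F \<phi> = G \<phi>) \<Longrightarrow> \<delta> F = \<delta> G"
    and \<delta>_id: "\<delta> (\<lambda>\<phi>. \<phi>) = 1"
    and \<delta>_inj: "\<And>F. adm F \<Longrightarrow> minj F \<Longrightarrow> \<delta> F \<noteq> 0"
begin

lemma \<delta>_mult3: "adm A \<Longrightarrow> adm B \<Longrightarrow> adm C \<Longrightarrow> \<delta> (\<lambda>\<phi>. A (B (C \<phi>))) = \<delta> A * (\<delta> B * \<delta> C)"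
  using \<delta>_mult[OF _ adm_comp, of A B C] by (simp add: \<delta>_mult)

text \<open>Determinants commute, so those of \<open>A\<close> and \<open>C\<close> cancel. All
  operators act on the same space, spare legs included, so the value is exactly 1.\<close>

lemma \<delta>_pentagon:
  assumes "adm A" "adm B" "adm C" "\<And>\<phi>. mlin 6 \<phi> \<Longrightarrow> A (C \<phi>) = C (B (A \<phi>))" "\<delta> A \<noteq> 0" "\<delta> C \<noteq> 0"
  shows "\<delta> B = 1"
proof -
  have "\<delta> A * \<delta> C = \<delta> C * (\<delta> B * \<delta> A)"
    using \<delta>_cong[of "\<lambda>\<phi>. A (C \<phi>)" "\<lambda>\<phi>. C (B (A \<phi>))"] assms(4)
    by (simp add: \<delta>_mult[OF assms(1,3)] \<delta>_mult3[OF assms(3,2,1)])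
  then show ?thesis using assms(5,6) by (simp add: mult.commute mult.left_commute)
qed

lemma \<delta>_pentagon':
  assumes "adm A" "adm B" "adm C" "\<And>\<phi>. mlin 6 \<phi> \<Longrightarrow> A (B (C \<phi>)) = C (A \<phi>)" "\<delta> A \<noteq> 0" "\<delta> C \<noteq> 0"
  shows "\<delta> B = 1"
proof -
  have "\<delta> A * (\<delta> B * \<delta> C) = \<delta> C * \<delta> A"
    using \<delta>_cong[of "\<lambda>\<phi>. A (B (C \<phi>))" "\<lambda>\<phi>. C (A \<phi>)"] assms(4)
    by (simp add: \<delta>_mult[OF assms(3,1)] \<delta>_mult3[OF assms(1-3)])
  then show ?thesis using assms(5,6) by (simp add: mult.commute mult.left_commute)
qed

text \<open>Conjugation by the transposition of two legs, an admissible involution, preserves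
  determinants.\<close>

lemma \<delta>_flip:
  assumes "i < 4" "j < 4" "i \<noteq> j" "adm A" "\<And>\<phi>. mlin 6 \<phi> \<Longrightarrow> legs i j swp (A (legs i j swp \<phi>)) = B \<phi>"
  shows "\<delta> A = \<delta> B"
proof -
  have s: "adm (legs i j swp)" using assms(1-3) by (intro adm_legs good_swp)
  have "\<delta> (legs i j swp) * \<delta> (legs i j swp) = 1"
    using \<delta>_mult[OF s s] \<delta>_id by (simp add: legs_swp_swp[OF assms(3)])
  moreover have "\<delta> B = \<delta> (legs i j swp) * (\<delta> A * \<delta> (legs i j swp))"
    using \<delta>_cong[of "\<lambda>\<phi>. legs i j swp (A (legs i j swp \<phi>))" B] assms(5)
    by (simp add: \<delta>_mult3[OF s assms(4) s])
  ultimately show ?thesis by (simp add: mult.commute mult.left_commute)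
qed

text \<open>By the pentagon equations the determinants of \<open>opT\<close>, \<open>opT'\<close>, \<open>opG\<close> and \<open>opG'\<close> are 1, so the
  identity \<open>opG_identity\<close> compares the determinants of \<open>sig\<close> and \<open>R\<^sup>2\<close>.\<close>

lemma \<delta>_sq:
  assumes jk: "j < 6" "k < 6" "j \<noteq> k" "j > 1" "k > 1"
    and adm: "\<And>i. i < 2 \<Longrightarrow> adm (legs i j opT)" "\<And>i. i < 2 \<Longrightarrow> adm (legs i j opT')"
      "\<And>i. i < 2 \<Longrightarrow> adm (opG i j k)" "\<And>i. i < 2 \<Longrightarrow> adm (opG' i j k)" "adm (legs 1 j sq)" "adm (legs j k sig)"
  shows "\<delta> (legs j k sig) * \<delta> (legs 1 j sq) = 1"
proof -
  have adm01: "adm (legs 0 1 F)" if "good F" for F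
    using that by (intro adm_legs) auto
  have flip: "legs 0 1 swp (legs 1 l F (legs 0 1 swp \<phi>)) = legs 0 l F \<phi>" if "l > 1" for F \<phi> l
    using that by (intro legs_swp_conj) auto
  have flip3: "legs 0 1 swp (legs 1 j F (legs 1 k G (legs 1 j H (legs 0 1 swp \<phi>)))) =
      legs 0 j F (legs 0 k G (legs 0 j H \<phi>))" for F G H \<phi>
    using jk legs_swp_swp[of 0 1] flip by (metis zero_neq_one)
  have T: "\<delta> (legs 1 j opT) = 1"
  proof -
    \<comment> \<open>The pentagon on legs 0, 1 and \<open>j\<close> isolates the operator on legs 0
      and \<open>j\<close>; \<open>\<delta>_flip\<close> then carries the value to leg 1.\<close>
    have "\<delta> (legs 0 j opT) = 1"
      by (rule \<delta>_pentagon'[of "legs 1 j opT" _ "legs 0 1 opT"])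
        (use jk in \<open>simp_all add: adm adm01 good_all \<delta>_inj minj_legs legs_identities(1)[where n = 6] del: One_nat_def\<close>)
    then show ?thesis using \<delta>_flip[of 0 1 "legs 1 j opT" "legs 0 j opT"] jk by (simp add: adm flip del: One_nat_def)
  qed
  have T': "\<delta> (legs 1 j opT') = 1"
  proof -
    have "\<delta> (legs 0 j opT') = 1"
      by (rule \<delta>_pentagon'[of "legs 1 j opT'" _ "legs 0 1 opT'"])
        (use jk in \<open>simp_all add: adm adm01 good_all \<delta>_inj minj_legs legs_identities(2)[where n = 6] del: One_nat_def\<close>)
    then show ?thesis using \<delta>_flip[of 0 1 "legs 1 j opT'" "legs 0 j opT'"] jk by (simp add: adm flip del: One_nat_def)
  qed
  have G: "\<delta> (opG 1 j k) = 1"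
  proof -
    have "\<delta> (opG 0 j k) = 1"
      by (rule \<delta>_pentagon[of "opG 1 j k" _ "legs 0 1 sig"])
        (use jk in \<open>simp_all add: adm adm01 good_all \<delta>_inj minj_legs minj_opG opG_pentagon(1)[where n = 6] del: One_nat_def\<close>)
    then show ?thesis using \<delta>_flip[of 0 1 "opG 1 j k" "opG 0 j k"] jk
      by (simp add: adm del: One_nat_def) (simp add: opG_def flip3 del: One_nat_def)
  qed
  have identity: "\<delta> (legs j k sig) * (\<delta> (legs 1 j opT') * (\<delta> (legs 1 j sq) * \<delta> (opG' 1 j k))) =
      \<delta> (opG 1 j k) * \<delta> (legs 1 j opT)"
    using \<delta>_cong[of "\<lambda>\<phi>. legs j k sig (legs 1 j opT' (legs 1 j sq (opG' 1 j k \<phi>)))" "\<lambda>\<phi>. opG 1 j k (legs 1 j opT \<phi>)"]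
      opG_identity[where n = 6 and i = 1 and j = j and k = k] jk
      \<delta>_mult[OF adm(6) adm_comp[OF adm(2)[of 1] adm_comp[OF adm(5) adm(4)[of 1]]]]
      \<delta>_mult3[OF adm(2)[of 1] adm(5) adm(4)[of 1]] \<delta>_mult[OF adm(3)[of 1] adm(1)[of 1]]
    by (simp del: One_nat_def)
  have G': "\<delta> (opG' 1 j k) = 1"
  proof -
    \<comment> \<open>That the determinant of \<open>opG' 1 j k\<close> is nonzero is read off
      \<open>identity\<close>, whose right side is 1 by \<open>T\<close> and
      \<open>G\<close>.\<close>
    have "\<delta> (opG' 0 j k) = 1"
      by (rule \<delta>_pentagon[of "opG' 1 j k" _ "legs 0 1 sig'"])
        (use jk identity T T' G in \<open>auto simp add: adm adm01 good_all \<delta>_inj minj_legs opG_pentagon(2)[where n = 6] simp del: One_nat_def\<close>)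
    then show ?thesis using \<delta>_flip[of 0 1 "opG' 1 j k" "opG' 0 j k"] jk
      by (simp add: adm del: One_nat_def) (simp add: opG'_def flip3 del: One_nat_def)
  qed
  show ?thesis using identity T T' G G' by simp
qed

text \<open>On the full legs 2 and 3, \<open>sig\<close> itself satisfies a pentagon equation, hence \<open>R\<^sup>2\<close> has
  determinant 1.\<close>

lemma \<delta>_sig: "\<delta> (legs 4 5 sig) = 1"
proof -
  have "\<delta> (legs 1 3 sig) = 1"
    by (rule \<delta>_pentagon[of "legs 2 3 sig" _ "legs 1 2 sig"])
       (simp_all add: adm_legs good_all \<delta>_inj minj_legs legs_identities(3)[where n = 6] del: One_nat_def)
  then have "\<delta> (legs 2 3 sig) = 1"
    using \<delta>_flip[of 1 2 "legs 2 3 sig" "legs 1 3 sig"] legs_swp_conj[of 1 2 3 sig]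
    by (simp add: adm_legs good_all del: One_nat_def)
  moreover have "\<delta> (legs 2 3 sig) * \<delta> (legs 1 2 sq) = 1"
    by (rule \<delta>_sq) (simp_all add: adm_legs adm_opG good_all)
  moreover have "\<delta> (legs 4 5 sig) * \<delta> (legs 1 4 sq) = 1"
    by (rule \<delta>_sq) (simp_all add: adm_45 adm_45(6)[of 0])
  moreover have "legs 1 2 sq = legs 1 4 sq" by (rule sq_indep) auto
  ultimately show ?thesis by simp
qed

end

text \<open>On \<open>eig c\<close> the operator \<open>legs 4 5 sig\<close> is the scalar
  \<open>c\<close>, so its determinant is \<open>c^N\<close> with \<open>N\<close> the dimension;
  \<open>\<delta>_sig\<close> makes this 1.\<close>

theorem eigenvalue_root_of_unity:
  assumes "mlin 6 \<phi>" "\<phi> \<noteq> 0" "legs 4 5 sig \<phi> = fscale c \<phi>"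
  shows "\<exists>n>0. c ^ n = 1"
proof -
  obtain B where B: "finite B" "{\<phi>. mlin 6 \<phi>} \<subseteq> FS.span B" using mlin_span by blast
  have "eig c \<subseteq> FS.span B" using B(2) by (auto simp: eig_def)
  note sub = this
  show ?thesis
  proof (rule FS.det_functional[OF eig_subspace B(1) sub])
    fix \<delta> :: "(((nat \<Rightarrow> 'h) \<Rightarrow> 'K) \<Rightarrow> (nat \<Rightarrow> 'h) \<Rightarrow> 'K) \<Rightarrow> 'K" and N
    assume mult: "\<And>F G. FS.endo_on (eig c) F \<Longrightarrow> FS.endo_on (eig c) G \<Longrightarrow> \<delta> (\<lambda>x. F (G x)) = \<delta> F * \<delta> G"
      and cong: "\<And>F G. (\<And>x. x \<in> eig c \<Longrightarrow> F x = G x) \<Longrightarrow> \<delta> F = \<delta> G"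
      and scalar: "\<And>d. \<delta> (\<lambda>x. fscale d x) = d ^ N"
      and inj: "\<And>F. FS.endo_on (eig c) F \<Longrightarrow> inj_on F (eig c) \<Longrightarrow> \<delta> F \<noteq> 0"
      and N: "eig c \<noteq> {0} \<Longrightarrow> N > 0"
    have "\<delta> (legs 4 5 sig) = 1"
    proof (rule \<delta>_sig[of \<delta>])
      show "\<delta> (\<lambda>\<phi>. \<phi>) = 1" using scalar[of 1] by (simp add: fscale_def)
      show "\<delta> F \<noteq> 0" if "adm F" "minj F" for F
        using that by (intro inj adm_endo) (auto simp: minj_def eig_def inj_on_def)
      show "\<delta> (\<lambda>\<phi>. F (G \<phi>)) = \<delta> F * \<delta> G" if "adm F" "adm G" for F G
        by (intro mult adm_endo that)
      show "\<delta> F = \<delta> G" if "\<And>\<phi>. mlin 6 \<phi> \<Longrightarrow> F \<phi> = G \<phi>" for F G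
        by (rule cong) (simp add: eig_def that)
    qed
    moreover have "\<delta> (legs 4 5 sig) = \<delta> (\<lambda>x. fscale c x)"
      by (rule cong) (simp add: eig_def)
    moreover have "eig c \<noteq> {0}" using assms by (auto simp: eig_def)
    ultimately show ?thesis using scalar N by (intro exI[of _ N]) auto
  qed
qed

text \<open>The Hopf power map seen through a form:
  \<open>\<psi>(h\<^sub>1 \<cdots> h\<^sub>n)\<close>, with the last factor split off first as in
  \<open>comult_n\<close>.\<close>

primrec hpow :: "nat \<Rightarrow> ('h \<Rightarrow> 'K) \<Rightarrow> 'h \<Rightarrow> 'K" where
  "hpow 0 \<psi> h = eps h * \<psi> 1"
| "hpow (Suc n) \<psi> h = D h (\<lambda>x y. hpow n (\<lambda>z. \<psi> (z * y)) x)"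

lemma hpow_comb: "fincomb (\<lambda>\<psi>. hpow n \<psi> h)"
proof (induction n arbitrary: h)
  case 0
  then show ?case unfolding fincomb_def by (intro exI[of _ "[(eps h, 1)]"]) simp
next
  case (Suc n)
  have "fincomb (\<lambda>\<psi>. hpow n (\<lambda>z. \<psi> (z * y)) x)" for x y
    by (rule fincomb_compose[OF Suc fincomb_eval])
  then have "fincomb (\<lambda>\<psi>. D h (\<lambda>x y. (\<lambda>p. hpow n (\<lambda>z. \<psi> (z * snd p)) (fst p)) (x, y)))"
    by (intro fincomb_compose[OF D_comb])
  then show ?case by simp
qed

lemma hpow_add: "hpow n (\<lambda>z. \<phi> z + \<psi> z) h = hpow n \<phi> h + hpow n \<psi> h"
  using fincomb_plus[OF hpow_comb] .

lemma hpow_cmult: "hpow n (\<lambda>z. d * \<psi> z) h = d * hpow n \<psi> h"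
  using fincomb_cmult[OF hpow_comb] .

lemma hpow_lin: "lin \<psi> \<Longrightarrow> lin (hpow n \<psi>)"
proof (induction n arbitrary: \<psi>)
  case 0
  then show ?case using linD[OF eps_lin] by (simp add: lin_def algebra_simps)
next
  case (Suc n)
  note T = linD[OF Suc.prems]
  have L: "lin (hpow n (\<lambda>z. \<psi> (z * y)))" for y
    by (rule Suc.IH) (simp add: ml T)
  then have "bilin (\<lambda>x y. hpow n (\<lambda>z. \<psi> (z * y)) x)"
    by (simp add: bilin_def) (simp add: lin_def algebra_simps T hpow_add hpow_cmult)
  from D_lin[OF this] show ?case by simp
qed

text \<open>Links the order of \<open>sig\<close> to Hopf powers: in each step coassociativity moves
  one more factor of \<open>b\<close> into the product beside \<open>a\<close>.\<close>

lemma sig_pow: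
  assumes "bilin \<phi>"
  shows "(sig ^^ n) \<phi> a b = D b (\<lambda>x y. hpow n (\<lambda>z. \<phi> (a * z) y) x)"
  using assms
proof (induction n arbitrary: \<phi>)
  case 0
  have "lin (\<phi> a)" using 0 by (simp add: bilin_def)
  then show ?case using D_eps_left by simp
next
  case (Suc n)
  note T = bilinD[OF Suc.prems]
  have L: "lin (hpow n (\<lambda>z. \<phi> (a * (z * q)) v))" for q v
    by (rule hpow_lin) (simp add: ml T)
  have "(sig ^^ Suc n) \<phi> a b = D b (\<lambda>x y. hpow n (\<lambda>z. sig \<phi> (a * z) y) x)"
    using Suc.IH[OF op_bilin(3)[OF Suc.prems]] by (simp add: funpow_swap1)
  also have "\<dots> = D b (\<lambda>x y. D y (\<lambda>u v. hpow n (\<lambda>z. \<phi> (a * (z * u)) v) x))"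
  proof -
    have "hpow n (\<lambda>z. D y (\<lambda>u v. F z u v)) x = D y (\<lambda>u v. hpow n (\<lambda>z. F z u v) x)" for F x y
      using fincomb_swap[OF hpow_comb[of n x] D_comb[of y], of "\<lambda>z (u, v). F z u v"] by simp
    then show ?thesis by (simp add: sig_def mult.assoc)
  qed
  also have "\<dots> = D b (\<lambda>x y. D x (\<lambda>p q. hpow n (\<lambda>z. \<phi> (a * (z * q)) y) p))"
    by (subst D_coassoc) (simp_all add: ml T linD[OF L] hpow_add hpow_cmult)
  finally show ?case by simp
qed

theorem hopf_power_trivial:
  assumes p: "p > 0" "of_nat p = (0 :: 'K)"
  shows "\<exists>n>0. \<forall>\<psi> h. lin \<psi> \<longrightarrow> hpow n \<psi> h = eps h * \<psi> 1"
proof -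
  \<comment> \<open>\<open>\<psi>\<close> sits on leg 4 and the counit on the other legs; evaluation
    at \<open>h\<close> on leg 5 and at 1 elsewhere turns powers of \<open>sig\<close> into Hopf
    powers.\<close>
  define \<Phi> where "\<Phi> \<psi> x = eps (x 0) * eps (x 1) * eps (x 2) * eps (x 3) * \<psi> (x 4) * eps (x 5)" for \<psi> :: "'h \<Rightarrow> 'K" and x :: "nat \<Rightarrow> 'h"
  have \<Phi>: "mlin 6 (\<Phi> \<psi>)" if "lin \<psi>" for \<psi>
  proof -
    note T = linD[OF that] linD[OF eps_lin]
    have "lin (\<lambda>h. \<Phi> \<psi> (x(i := h)))" if "i < 6" for x i
    proof -
      have "i \<in> {0, 1, 2, 3, 4, 5}" using that by auto
      then show ?thesis by (auto simp: \<Phi>_def lin_def T algebra_simps)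
    qed
    then show ?thesis by (simp add: mlin_def \<Phi>_def)
  qed
  obtain B where B: "finite B" "{\<phi>. mlin 6 \<phi>} \<subseteq> FS.span B" using mlin_span by blast
  have periodic: "\<exists>n>0. (legs 4 5 sig ^^ n) \<phi> = \<phi>" if "mlin 6 \<phi>" for \<phi>
    using that by (intro FS.alg_closed_finite_order[OF sig_endo mlin_subspace B p]) (auto intro: eigenvalue_root_of_unity)
  have pow: "(legs 4 5 sig ^^ n) \<phi> = legs 4 5 (sig ^^ n) \<phi>" for n \<phi>
  proof (induction n)
    case 0
    show ?case by (simp add: legs_def fun_eq_iff)
  next
    case (Suc n)
    then show ?case by (simp add: legs_comp o_def)
  qed
  have hpow_eval: "hpow n \<psi> h = (legs 4 5 sig ^^ n) (\<Phi> \<psi>) ((\<lambda>_. 1)(5 := h))" if \<psi>: "lin \<psi>" for n \<psi> h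
  proof -
    note T = linD[OF \<psi>] linD[OF eps_lin]
    have "(legs 4 5 sig ^^ n) (\<Phi> \<psi>) ((\<lambda>_. 1)(5 := h)) = (sig ^^ n) (\<lambda>a b. \<psi> a * eps b) 1 h"
      by (simp add: pow legs_def \<Phi>_def)
    also have "\<dots> = D h (\<lambda>x y. hpow n (\<lambda>z. \<psi> (1 * z) * eps y) x)"
      by (rule sig_pow) (simp add: ml T)
    also have "\<dots> = D h (\<lambda>x y. eps y * hpow n \<psi> x)"
    proof -
      have "hpow n (\<lambda>z. \<psi> (1 * z) * eps y) x = eps y * hpow n \<psi> x" for x y
        using hpow_cmult[of n "eps y" \<psi> x] by (simp add: mult.commute)
      then show ?thesis by simp
    qed
    also have "\<dots> = hpow n \<psi> h" by (rule D_eps_right[OF hpow_lin[OF \<psi>]])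
    finally show ?thesis ..
  qed
  \<comment> \<open>Periods depend on the form, so a common multiple is formed over the finitely
    many coordinate functionals.\<close>
  have "\<exists>n>0. \<forall>b\<in>A. (legs 4 5 sig ^^ n) (\<Phi> (cf b)) = \<Phi> (cf b)" if "finite A" for A
    using that
  proof (induction A)
    case (insert b A)
    then obtain n where n: "n > 0" "\<forall>b\<in>A. (legs 4 5 sig ^^ n) (\<Phi> (cf b)) = \<Phi> (cf b)" by blast
    obtain m where m: "m > 0" "(legs 4 5 sig ^^ m) (\<Phi> (cf b)) = \<Phi> (cf b)"
      using periodic[OF \<Phi>[OF cf_lin]] by blast
    show ?case
      using n m FS.funpow_mult_fixed[OF m(2), of n] FS.funpow_mult_fixed[of n "legs 4 5 sig" _ m]
      by (intro exI[of _ "n * m"]) (auto simp: mult.commute)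
  qed auto
  from this[OF Bs_finite] obtain n where n: "n > 0" "\<And>b. b \<in> Bs \<Longrightarrow> (legs 4 5 sig ^^ n) (\<Phi> (cf b)) = \<Phi> (cf b)"
    by blast
  have basis: "hpow n (cf b) h = eps h * cf b 1" if "b \<in> Bs" for b h
    using n(2)[OF that] by (simp add: hpow_eval[OF cf_lin] \<Phi>_def)
  have "hpow n \<psi> h = eps h * \<psi> 1" if \<psi>: "lin \<psi>" for \<psi> h
  proof -
    have "hpow n \<psi> h = hpow n (\<lambda>z. \<Sum>b\<in>Bs. cf b z * \<psi> b) h"
      by (rule arg_cong[of _ _ "\<lambda>\<psi>. hpow n \<psi> h"]) (rule ext, rule expand[OF \<psi>])
    also have "\<dots> = (\<Sum>b\<in>Bs. \<psi> b * hpow n (cf b) h)"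
      using fincomb_sum[OF hpow_comb[of n h], where \<phi> = "\<lambda>b z. \<psi> b * cf b z" and I = Bs] by (simp add: hpow_cmult mult.commute)
    also have "\<dots> = eps h * (\<Sum>b\<in>Bs. cf b 1 * \<psi> b)"
      by (simp add: basis sum_distrib_left ac_simps)
    also have "\<dots> = eps h * \<psi> 1" using expand[OF \<psi>, of 1] by simp
    finally show ?thesis .
  qed
  then show ?thesis using n(1) by blast
qed

end

section \<open>Evaluating forms on tensors\<close>

definition ev :: "('x \<Rightarrow> 'k alg_closure) \<Rightarrow> ('x \<Rightarrow>\<^sub>0 'k::field) \<Rightarrow> 'k alg_closure" where
  "ev \<Phi> p = (\<Sum>x\<in>Poly_Mapping.keys p. to_ac (Poly_Mapping.lookup p x) * \<Phi> x)"

lemma ev_superset: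
  "finite A \<Longrightarrow> Poly_Mapping.keys p \<subseteq> A \<Longrightarrow> ev \<Phi> p = (\<Sum>x\<in>A. to_ac (Poly_Mapping.lookup p x) * \<Phi> x)"
  unfolding ev_def by (rule sum.mono_neutral_left) (auto simp: in_keys_iff)

lemma ev_add: "ev \<Phi> (p + q) = ev \<Phi> p + ev \<Phi> q"
proof -
  let ?A = "Poly_Mapping.keys p \<union> Poly_Mapping.keys q"
  have "ev \<Phi> (p + q) = (\<Sum>x\<in>?A. to_ac (Poly_Mapping.lookup (p + q) x) * \<Phi> x)"
    by (rule ev_superset) (auto simp: Poly_Mapping.keys_add)
  then show ?thesis
    using ev_superset[of ?A p \<Phi>] ev_superset[of ?A q \<Phi>]
    by (simp add: lookup_add distrib_right sum.distrib)
qed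

lemma ev_fscale: "ev \<Phi> (fscale c p) = to_ac c * ev \<Phi> p"
proof -
  have "Poly_Mapping.keys (fscale c p) \<subseteq> Poly_Mapping.keys p"
    by (auto simp: in_keys_iff)
  then have "ev \<Phi> (fscale c p) = (\<Sum>x\<in>Poly_Mapping.keys p. to_ac (Poly_Mapping.lookup (fscale c p) x) * \<Phi> x)"
    by (intro ev_superset) auto
  then show ?thesis by (simp add: ev_def sum_distrib_left mult.assoc)
qed

lemma ev_diff: "ev \<Phi> (p - q) = ev \<Phi> p - ev \<Phi> q"
  using ev_add[of \<Phi> "p - q" q] by simp

lemma ev_single [simp]: "ev \<Phi> (Poly_Mapping.single x c) = to_ac c * \<Phi> x"
  by (simp add: ev_def)

lemma ev_0 [simp]: "ev \<Phi> 0 = 0"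
  by (simp add: ev_def)

lemma ev_sum: "ev \<Phi> (\<Sum>i\<in>I. p i) = (\<Sum>i\<in>I. ev \<Phi> (p i))"
  by (induction I rule: infinite_finite_induct) (auto simp: ev_add)

lemma ev_fext: "ev \<Phi> (fext f p) = ev (\<lambda>x. ev \<Phi> (f x)) p"
  by (simp add: fext_def ev_sum ev_fscale) (simp add: ev_def)

lemma ev_fext2: "ev \<Phi> (fext2 f p q) = ev (\<lambda>x. ev (\<lambda>y. \<Phi> (f x y)) q) p"
  by (simp add: fext2_def ev_fext)

lemma ev_cong: "(\<And>x. x \<in> Poly_Mapping.keys p \<Longrightarrow> \<Phi> x = \<Psi> x) \<Longrightarrow> ev \<Phi> p = ev \<Psi> p"
  by (simp add: ev_def)

lemma ev_plus: "ev (\<lambda>x. \<Phi> x + \<Psi> x) p = ev \<Phi> p + ev \<Psi> p"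
  by (simp add: ev_def distrib_left sum.distrib)

lemma ev_cmult: "ev (\<lambda>x. c * \<Phi> x) p = c * ev \<Phi> p"
  by (simp add: ev_def sum_distrib_left mult.left_commute)

lemma ev_comb: "fincomb (\<lambda>\<phi>. ev (\<lambda>x. \<phi> (f x)) p)"
proof -
  obtain xs where xs: "set xs = Poly_Mapping.keys p" "distinct xs"
    using finite_distinct_list[of "Poly_Mapping.keys p"] by auto
  have "ev (\<lambda>x. \<phi> (f x)) p = (\<Sum>(c, x)\<leftarrow>map (\<lambda>x. (to_ac (Poly_Mapping.lookup p x), f x)) xs. c * \<phi> x)" for \<phi>
    using sum.distinct_set_conv_list[OF xs(2)] by (simp add: ev_def xs(1) o_def)
  then show ?thesis unfolding fincomb_def by blast
qed

lemma keys_fscale: "Poly_Mapping.keys (fscale c p) \<subseteq> Poly_Mapping.keys p"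
  by (auto simp: in_keys_iff)

lemma keys_fext: "Poly_Mapping.keys (fext f p) \<subseteq> (\<Union>x\<in>Poly_Mapping.keys p. Poly_Mapping.keys (f x))"
  unfolding fext_def using keys_sum[of "\<lambda>x. fscale (Poly_Mapping.lookup p x) (f x)" "Poly_Mapping.keys p"] keys_fscale by fastforce

lemma keys_fext2: "Poly_Mapping.keys (fext2 f p q) \<subseteq> (\<Union>x\<in>Poly_Mapping.keys p. \<Union>y\<in>Poly_Mapping.keys q. {f x y})"
  unfolding fext2_def using keys_fext[of "\<lambda>y. Poly_Mapping.single (f _ y) 1"] by (intro order_trans[OF keys_fext] UN_mono) fastforce+

section \<open>Multilinear forms on tensor powers\<close>

context tensor_powers
begin

text \<open>The two conditions mirror the two families in \<open>multilinearity_relators\<close>, so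
  such a form vanishes on all relators.\<close>

definition nlin :: "nat \<Rightarrow> ('b list \<Rightarrow> 'a alg_closure) \<Rightarrow> bool" where
  "nlin n \<Phi> \<longleftrightarrow> (\<forall>xs a b ys. Suc (length xs + length ys) = n \<longrightarrow>
     \<Phi> (xs @ (a + b) # ys) = \<Phi> (xs @ a # ys) + \<Phi> (xs @ b # ys)) \<and>
   (\<forall>xs c a ys. Suc (length xs + length ys) = n \<longrightarrow> \<Phi> (xs @ scale c a # ys) = to_ac c * \<Phi> (xs @ a # ys))"

lemma ev_relators:
  assumes "nlin n \<Phi>" "p \<in> formal.span (multilinearity_relators n)"
  shows "ev \<Phi> p = 0"
  using assms(2)
proof (induction rule: formal.span_induct_alt)
  case (step c x y)
  have "ev \<Phi> x = 0"
    using step(1) assms(1) by (auto simp: multilinearity_relators_def nlin_def ev_diff)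
  then show ?case using step by (simp add: ev_add ev_fscale)
qed simp

lemma ev_rel: "nlin n \<Phi> \<Longrightarrow> (p, q) \<in> tensor_rel n \<Longrightarrow> ev \<Phi> p = ev \<Phi> q"
  using ev_relators[of n \<Phi> "p - q"] by (auto simp: tensor_rel_def ev_diff)

lemma tensor_rel_refl: "p \<in> free_tensors n \<Longrightarrow> (p, p) \<in> tensor_rel n"
  by (simp add: tensor_rel_def formal.span_zero)

text \<open>The value of a multilinear form on a tensor, computed from an arbitrary representative; \<open>sv\<close>
  says that the choice does not matter.\<close>

definition EV :: "('c \<Rightarrow> ('b list \<Rightarrow>\<^sub>0 'a) set) \<Rightarrow> ('b list \<Rightarrow> 'a alg_closure) \<Rightarrow> 'c \<Rightarrow> 'a alg_closure" where
  "EV F \<Phi> h = ev \<Phi> (SOME p. p \<in> F h)"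

definition sv :: "nat \<Rightarrow> ('c \<Rightarrow> ('b list \<Rightarrow>\<^sub>0 'a) set) \<Rightarrow> bool" where
  "sv n F \<longleftrightarrow> (\<forall>h. F h \<noteq> {} \<and> F h \<subseteq> free_tensors n \<and>
     (\<forall>p\<in>F h. \<forall>q\<in>F h. \<forall>\<Phi>. nlin n \<Phi> \<longrightarrow> ev \<Phi> p = ev \<Phi> q))"

lemma EV_eq: "sv n F \<Longrightarrow> nlin n \<Phi> \<Longrightarrow> p \<in> F h \<Longrightarrow> EV F \<Phi> h = ev \<Phi> p"
  unfolding EV_def sv_def by (metis someI_ex)

lemma sv_some: "sv n F \<Longrightarrow> (SOME p. p \<in> F h) \<in> F h"
  unfolding sv_def by (metis some_in_eq)

lemma sv_some_free: "sv n F \<Longrightarrow> (SOME p. p \<in> F h) \<in> free_tensors n"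
  using sv_some[of n F h] unfolding sv_def by blast

lemma EV_cong: "sv n F \<Longrightarrow> (\<And>xs. length xs = n \<Longrightarrow> \<Phi> xs = \<Psi> xs) \<Longrightarrow> EV F \<Phi> h = EV F \<Psi> h"
  unfolding EV_def using sv_some_free[of n F h] by (intro ev_cong) (auto simp: free_tensors_def)

lemma sv_tensor_power:
  assumes "\<And>h. F h \<in> tensor_power n"
  shows "sv n F"
  unfolding sv_def
proof (intro allI conjI ballI impI)
  fix h
  obtain p where p: "p \<in> free_tensors n" "F h = tensor_rel n `` {p}"
    using assms[of h] by (auto simp: tensor_power_def quotient_def)
  show "F h \<noteq> {}" using p tensor_rel_refl by blast
  show "F h \<subseteq> free_tensors n" using p by (auto simp: tensor_rel_def)
  show "ev \<Phi> q = ev \<Phi> r" if "q \<in> F h" "r \<in> F h" "nlin n \<Phi>" for q r \<Phi>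
    using that(1,2) ev_rel[OF that(3), of p q] ev_rel[OF that(3), of p r] p by simp
qed

lemma pure_tensor_power: "pure_tensor xs \<in> tensor_power (length xs)"
  unfolding pure_tensor_def tensor_power_def by (rule quotientI) (simp add: free_tensors_def)

lemma single_pure_tensor: "Poly_Mapping.single xs 1 \<in> pure_tensor xs"
  by (auto simp: pure_tensor_def free_tensors_def intro: tensor_rel_refl)

lemma nlin_append:
  assumes "nlin (i + j) \<Phi>" "q \<in> free_tensors j"
  shows "nlin i (\<lambda>us. ev (\<lambda>vs. \<Phi> (us @ vs)) q)"
  unfolding nlin_def
proof (intro conjI allI impI)
  fix xs ys :: "'b list" and a b c
  assume l: "Suc (length xs + length ys) = i"
  have *: "length vs = j" if "vs \<in> Poly_Mapping.keys q" for vs using assms(2) that by (auto simp: free_tensors_def)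
  show "ev (\<lambda>vs. \<Phi> ((xs @ (a + b) # ys) @ vs)) q = ev (\<lambda>vs. \<Phi> ((xs @ a # ys) @ vs)) q + ev (\<lambda>vs. \<Phi> ((xs @ b # ys) @ vs)) q"
    unfolding ev_plus[symmetric] using assms(1) l * by (intro ev_cong) (auto simp: nlin_def)
  show "ev (\<lambda>vs. \<Phi> ((xs @ scale c a # ys) @ vs)) q = to_ac c * ev (\<lambda>vs. \<Phi> ((xs @ a # ys) @ vs)) q"
    unfolding ev_cmult[symmetric] using assms(1) l * by (intro ev_cong) (auto simp: nlin_def)
qed

lemma nlin_append_left:
  assumes "nlin (i + j) \<Phi>" "length us = i"
  shows "nlin j (\<lambda>vs. \<Phi> (us @ vs))"
proof -
  have "\<Phi> (xs @ (a + b) # ys) = \<Phi> (xs @ a # ys) + \<Phi> (xs @ b # ys)"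
    "\<Phi> (xs @ scale c a # ys) = to_ac c * \<Phi> (xs @ a # ys)"
    if "Suc (length xs + length ys) = i + j" for xs ys a b c
    using assms(1) that by (auto simp: nlin_def)
  from this[of "us @ _"] show ?thesis
    using assms(2) by (simp add: nlin_def)
qed

text \<open>Fixing one tensor factor leaves a multilinear form in the other, so the representatives
  \<open>f\<close> and \<open>g\<close> chosen in \<open>tensor_map2\<close> do not affect the
  value.\<close>

lemma tensor_map2_ev:
  assumes F: "sv i F" and G: "sv j G" and U: "U \<subseteq> free_tensors 2" and \<Phi>: "nlin (i + j) \<Phi>"
    and q: "q \<in> tensor_map2 i j F G U"
  shows "\<exists>p\<in>U. ev \<Phi> q = ev (\<lambda>xs. EV F (\<lambda>us. EV G (\<lambda>vs. \<Phi> (us @ vs)) (xs ! 1)) (xs ! 0)) p"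
proof -
  obtain p f g where p: "p \<in> U" and f: "\<And>h. f h \<in> F h" and g: "\<And>h. g h \<in> G h"
    and rel: "(fext (\<lambda>xs. fext2 (@) (f (xs ! 0)) (g (xs ! 1))) p, q) \<in> tensor_rel (i + j)"
    using q by (auto simp: tensor_map2_def)
  have ff: "f h \<in> free_tensors i" and gg: "g h \<in> free_tensors j" for h
    using f g F G unfolding sv_def by blast+
  have "ev \<Phi> q = ev (\<lambda>xs. ev (\<lambda>us. ev (\<lambda>vs. \<Phi> (us @ vs)) (g (xs ! 1))) (f (xs ! 0))) p"
    using ev_rel[OF \<Phi> rel] by (simp add: ev_fext ev_fext2)
  also have "\<dots> = ev (\<lambda>xs. EV F (\<lambda>us. EV G (\<lambda>vs. \<Phi> (us @ vs)) (xs ! 1)) (xs ! 0)) p"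
  proof (rule ev_cong)
    fix xs
    have "ev (\<lambda>us. ev (\<lambda>vs. \<Phi> (us @ vs)) (g (xs ! 1))) (f (xs ! 0)) = EV F (\<lambda>us. ev (\<lambda>vs. \<Phi> (us @ vs)) (g (xs ! 1))) (xs ! 0)"
      using EV_eq[OF F nlin_append[OF \<Phi> gg] f] by simp
    also have "\<dots> = EV F (\<lambda>us. EV G (\<lambda>vs. \<Phi> (us @ vs)) (xs ! 1)) (xs ! 0)"
      by (rule EV_cong[OF F]) (use EV_eq[OF G nlin_append_left[OF \<Phi>] g] in simp)
    finally show "ev (\<lambda>us. ev (\<lambda>vs. \<Phi> (us @ vs)) (g (xs ! 1))) (f (xs ! 0)) = EV F (\<lambda>us. EV G (\<lambda>vs. \<Phi> (us @ vs)) (xs ! 1)) (xs ! 0)" .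
  qed
  finally show ?thesis using p by blast
qed

text \<open>Guarantees a representative for \<open>EV\<close> to choose; it is built from chosen
  representatives of all values of \<open>F\<close> and \<open>G\<close>.\<close>

lemma tensor_map2_nonempty:
  assumes F: "sv i F" and G: "sv j G" and U: "U \<noteq> {}"
  shows "tensor_map2 i j F G U \<noteq> {}"
proof -
  obtain p where p: "p \<in> U" using U by blast
  let ?f = "\<lambda>h. SOME p. p \<in> F h" and ?g = "\<lambda>h. SOME p. p \<in> G h"
  let ?q = "fext (\<lambda>xs. fext2 (@) (?f (xs ! 0)) (?g (xs ! 1))) p"
  have "Poly_Mapping.keys (fext2 (@) (?f x) (?g y)) \<subseteq> {xs. length xs = i + j}" for x y
  proof
    fix us assume "us \<in> Poly_Mapping.keys (fext2 (@) (?f x) (?g y))"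
    then obtain vs ws where "vs \<in> Poly_Mapping.keys (?f x)" "ws \<in> Poly_Mapping.keys (?g y)" "us = vs @ ws"
      using keys_fext2[of "(@)" "?f x" "?g y"] by auto
    then show "us \<in> {xs. length xs = i + j}"
      using sv_some_free[OF F, of x] sv_some_free[OF G, of y] by (auto simp: free_tensors_def)
  qed
  then have "?q \<in> free_tensors (i + j)"
    unfolding free_tensors_def using keys_fext[of "\<lambda>xs. fext2 (@) (?f (xs ! 0)) (?g (xs ! 1))" p] by blast
  from tensor_rel_refl[OF this] have q: "?q \<in> tensor_rel (i + j) `` {?q}" by simp
  have "?f \<in> {f. \<forall>h. f h \<in> F h}" "?g \<in> {g. \<forall>h. g h \<in> G h}"
    using sv_some[OF F] sv_some[OF G] by auto
  with p q have "?q \<in> tensor_map2 i j F G U"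
    unfolding tensor_map2_def by (intro UN_I)
  then show ?thesis by auto
qed

lemma tensor_map2_free: "tensor_map2 i j F G U \<subseteq> free_tensors (i + j)"
  by (auto simp: tensor_map2_def tensor_rel_def)

end

lemma ev_list2: "length xs = 2 \<Longrightarrow> xs = [xs ! 0, xs ! 1]"
  by (auto simp: numeral_2_eq_2 length_Suc_conv)

section \<open>Sweedler calculus of a bialgebra\<close>

context bialgebra
begin

sublocale K: forms scale to_ac ..

definition DD :: "'h \<Rightarrow> ('h \<Rightarrow> 'h \<Rightarrow> 'k alg_closure) \<Rightarrow> 'k alg_closure" where
  "DD h \<phi> = EV comult (\<lambda>xs. \<phi> (xs ! 0) (xs ! 1)) h"

lemma nlin_2:
  assumes "K.bilin \<phi>"
  shows "nlin 2 (\<lambda>xs. \<phi> (xs ! 0) (xs ! 1))"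
  unfolding nlin_def
proof (intro conjI allI impI)
  fix xs ys :: "'h list" and a b c
  assume "Suc (length xs + length ys) = 2"
  then have "(xs = [] \<and> (\<exists>y. ys = [y])) \<or> ((\<exists>x. xs = [x]) \<and> ys = [])"
    by (cases xs; cases ys) auto
  then show "\<phi> ((xs @ (a + b) # ys) ! 0) ((xs @ (a + b) # ys) ! 1) =
      \<phi> ((xs @ a # ys) ! 0) ((xs @ a # ys) ! 1) + \<phi> ((xs @ b # ys) ! 0) ((xs @ b # ys) ! 1)"
    "\<phi> ((xs @ scale c a # ys) ! 0) ((xs @ scale c a # ys) ! 1) =
      to_ac c * \<phi> ((xs @ a # ys) ! 0) ((xs @ a # ys) ! 1)"
    using assms by (auto simp: K.bilin_def K.lin_def)
qed

lemma nlin_3: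
  assumes "K.trilin F"
  shows "nlin 3 (\<lambda>xs. F (xs ! 0) (xs ! 1) (xs ! 2))"
proof -
  have cases: "(xs = [] \<and> (\<exists>y z. ys = [y, z])) \<or> (\<exists>x z. xs = [x] \<and> ys = [z]) \<or> ((\<exists>x y. xs = [x, y]) \<and> ys = [])"
    if "Suc (length xs + length ys) = 3" for xs ys :: "'h list"
  proof -
    have "length xs = 0 \<and> length ys = 2 \<or> length xs = 1 \<and> length ys = 1 \<or> length xs = 2 \<and> length ys = 0"
      using that by linarith
    then show ?thesis by (auto simp: length_Suc_conv numeral_2_eq_2)
  qed
  have "F (a + b) y z = F a y z + F b y z" "F (scale c a) y z = to_ac c * F a y z"
    "F y (a + b) z = F y a z + F y b z" "F y (scale c a) z = to_ac c * F y a z"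
    "F y z (a + b) = F y z a + F y z b" "F y z (scale c a) = to_ac c * F y z a" for a b c y z
    using assms unfolding K.trilin_def K.bilin_def K.lin_def by auto
  note F_lin = this
  show ?thesis
    unfolding nlin_def
  proof (intro conjI allI impI)
    fix xs ys :: "'h list" and a b c
    assume "Suc (length xs + length ys) = 3"
    from cases[OF this] show
      "F ((xs @ (a + b) # ys) ! 0) ((xs @ (a + b) # ys) ! 1) ((xs @ (a + b) # ys) ! 2) =
         F ((xs @ a # ys) ! 0) ((xs @ a # ys) ! 1) ((xs @ a # ys) ! 2) +
         F ((xs @ b # ys) ! 0) ((xs @ b # ys) ! 1) ((xs @ b # ys) ! 2)"
      "F ((xs @ scale c a # ys) ! 0) ((xs @ scale c a # ys) ! 1) ((xs @ scale c a # ys) ! 2) =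
         to_ac c * F ((xs @ a # ys) ! 0) ((xs @ a # ys) ! 1) ((xs @ a # ys) ! 2)"
      by (auto simp: F_lin)
  qed
qed

lemma sv_comult: "sv 2 comult"
  by (rule sv_tensor_power) (rule comult_tensor)

lemma sv_pure: "sv 1 (\<lambda>h. pure_tensor [h])"
  using pure_tensor_power[of "[_]"] by (intro sv_tensor_power) simp

lemma DD_rep: "K.bilin \<phi> \<Longrightarrow> p \<in> comult h \<Longrightarrow> DD h \<phi> = ev (\<lambda>xs. \<phi> (xs ! 0) (xs ! 1)) p"
  unfolding DD_def by (rule EV_eq[OF sv_comult nlin_2])

lemma comult_rep:
  obtains p where "p \<in> comult h" "p \<in> free_tensors 2"
  using sv_some[OF sv_comult] sv_some_free[OF sv_comult] by blast

lemma EV_pure: "nlin 1 \<Phi> \<Longrightarrow> EV (\<lambda>h. pure_tensor [h]) \<Phi> h = \<Phi> [h]"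
  using EV_eq[OF sv_pure, of \<Phi> "Poly_Mapping.single [h] 1" h] single_pure_tensor by simp

lemma DD_comb: "fincomb (\<lambda>\<phi>. DD h (\<lambda>x y. \<phi> (x, y)))"
  unfolding DD_def EV_def using ev_comb[of "\<lambda>xs. (xs ! 0, xs ! 1)"] by simp

lemma DD_lin:
  assumes "K.bilin \<phi>"
  shows "K.lin (\<lambda>h. DD h \<phi>)"
  unfolding K.lin_def
proof (intro conjI allI)
  fix a b c
  obtain p where p: "p \<in> comult a" "p \<in> free_tensors 2" by (rule comult_rep)
  obtain q where q: "q \<in> comult b" "q \<in> free_tensors 2" by (rule comult_rep)
  have "p + q \<in> free_tensors 2"
    using p(2) q(2) Poly_Mapping.keys_add[of p q] by (auto simp: free_tensors_def)
  then have "p + q \<in> comult (a + b)"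
    using p(1) q(1) tensor_rel_refl unfolding comult_add tensor_add_def by blast
  then show "DD (a + b) \<phi> = DD a \<phi> + DD b \<phi>"
    using p q assms by (simp add: DD_rep ev_add)
  have "fscale c p \<in> free_tensors 2"
    using p(2) keys_fscale[of c p] by (auto simp: free_tensors_def)
  then have "fscale c p \<in> comult (scale c a)"
    using p(1) tensor_rel_refl unfolding comult_scale tensor_scale_def by blast
  then show "DD (scale c a) \<phi> = to_ac c * DD a \<phi>"
    using p assms by (simp add: DD_rep ev_fscale)
qed

text \<open>The invariant that passes through iterated comultiplication: values are well defined and
  depend linearly on the argument.\<close>

definition svl :: "nat \<Rightarrow> ('h \<Rightarrow> ('h list \<Rightarrow>\<^sub>0 'k) set) \<Rightarrow> bool" where
  "svl n F \<longleftrightarrow> sv n F \<and> (\<forall>\<Phi>. nlin n \<Phi> \<longrightarrow> K.lin (EV F \<Phi>))"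

lemma svl_pure: "svl 1 (\<lambda>h. pure_tensor [h])"
proof -
  have "K.lin (EV (\<lambda>h. pure_tensor [h]) \<Phi>)" if "nlin 1 \<Phi>" for \<Phi>
  proof -
    have "EV (\<lambda>h. pure_tensor [h]) \<Phi> = (\<lambda>h. \<Phi> [h])" using EV_pure[OF that] by auto
    moreover have A: "\<Phi> (xs @ (a + b) # ys) = \<Phi> (xs @ a # ys) + \<Phi> (xs @ b # ys)"
      and B: "\<Phi> (xs @ scale c a # ys) = to_ac c * \<Phi> (xs @ a # ys)"
      if "Suc (length xs + length ys) = 1" for xs ys a b c
      using \<open>nlin 1 \<Phi>\<close> that unfolding nlin_def by blast+
    ultimately show ?thesis using A[of "[]" "[]"] B[of "[]" "[]"] by (simp add: K.lin_def)
  qed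
  then show ?thesis by (simp add: svl_def sv_pure del: One_nat_def)
qed

lemma svl_comult: "svl 2 comult"
proof -
  have "K.lin (EV comult \<Phi>)" if "nlin 2 \<Phi>" for \<Phi>
  proof -
    have "EV comult \<Phi> = (\<lambda>h. DD h (\<lambda>x y. \<Phi> [x, y]))"
      unfolding DD_def by (intro ext EV_cong[OF sv_comult] arg_cong[of _ _ \<Phi>] ev_list2)
    moreover have A: "\<Phi> (xs @ (a + b) # ys) = \<Phi> (xs @ a # ys) + \<Phi> (xs @ b # ys)"
      and B: "\<Phi> (xs @ scale c a # ys) = to_ac c * \<Phi> (xs @ a # ys)"
      if "Suc (length xs + length ys) = 2" for xs ys a b c
      using \<open>nlin 2 \<Phi>\<close> that unfolding nlin_def by blast+
    have "K.bilin (\<lambda>x y. \<Phi> [x, y])"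
      using A[of "[]" "[_]"] A[of "[_]" "[]"] B[of "[]" "[_]"] B[of "[_]" "[]"]
      by (simp add: K.bilin_def K.lin_def)
    ultimately show ?thesis by (simp add: DD_lin)
  qed
  then show ?thesis by (simp add: svl_def sv_comult)
qed

lemma EV_plus: "EV F (\<lambda>x. \<Phi> x + \<Psi> x) h = EV F \<Phi> h + EV F \<Psi> h"
  and EV_cmult: "EV F (\<lambda>x. c * \<Phi> x) h = c * EV F \<Phi> h"
  by (simp_all add: EV_def ev_plus ev_cmult)

lemma bilin_EV:
  assumes F: "svl i F" and G: "svl j G" and \<Phi>: "nlin (i + j) \<Phi>"
  shows "K.bilin (\<lambda>x y. EV F (\<lambda>us. EV G (\<lambda>vs. \<Phi> (us @ vs)) y) x)"
proof -
  have sF: "sv i F" and sG: "sv j G" using F G by (auto simp: svl_def)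
  have "nlin i (\<lambda>us. EV G (\<lambda>vs. \<Phi> (us @ vs)) y)" for y
    unfolding EV_def by (rule nlin_append[OF \<Phi> sv_some_free[OF sG]])
  then have 1: "K.lin (\<lambda>x. EV F (\<lambda>us. EV G (\<lambda>vs. \<Phi> (us @ vs)) y) x)" for y
    using F by (simp add: svl_def)
  have G_lin: "K.lin (EV G (\<lambda>vs. \<Phi> (us @ vs)))" if "length us = i" for us
    using G nlin_append_left[OF \<Phi> that] by (simp add: svl_def)
  have "K.lin (\<lambda>y. EV F (\<lambda>us. EV G (\<lambda>vs. \<Phi> (us @ vs)) y) x)" for x
    unfolding K.lin_def EV_plus[where F = F, symmetric] EV_cmult[where F = F, symmetric]
    using G_lin by (intro conjI allI EV_cong[OF sF]) (auto simp: K.lin_def)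
  with 1 show ?thesis by (simp add: K.bilin_def)
qed

lemma ev_tensor_map2:
  assumes F: "svl i F" and G: "svl j G" and \<Phi>: "nlin (i + j) \<Phi>"
    and q: "q \<in> tensor_map2 i j F G (comult h)"
  shows "ev \<Phi> q = DD h (\<lambda>x y. EV F (\<lambda>us. EV G (\<lambda>vs. \<Phi> (us @ vs)) y) x)"
proof -
  have sF: "sv i F" and sG: "sv j G" using F G by (auto simp: svl_def)
  have "comult h \<subseteq> free_tensors 2" using sv_comult by (simp add: sv_def)
  from tensor_map2_ev[OF sF sG this \<Phi> q] obtain p where p: "p \<in> comult h"
    "ev \<Phi> q = ev (\<lambda>xs. EV F (\<lambda>us. EV G (\<lambda>vs. \<Phi> (us @ vs)) (xs ! 1)) (xs ! 0)) p" by blast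
  then show ?thesis using DD_rep[OF bilin_EV[OF F G \<Phi>] p(1)] by simp
qed

lemma
  assumes F: "svl i F" and G: "svl j G"
  shows svl_tensor_map2: "svl (i + j) (\<lambda>h. tensor_map2 i j F G (comult h))"
    and EV_tensor_map2: "nlin (i + j) \<Phi> \<Longrightarrow> EV (\<lambda>h. tensor_map2 i j F G (comult h)) \<Phi> h =
      DD h (\<lambda>x y. EV F (\<lambda>us. EV G (\<lambda>vs. \<Phi> (us @ vs)) y) x)"
proof -
  have sF: "sv i F" and sG: "sv j G" using F G by (auto simp: svl_def)
  have "comult h \<noteq> {}" for h using sv_comult by (simp add: sv_def)
  then have sv: "sv (i + j) (\<lambda>h. tensor_map2 i j F G (comult h))"
    unfolding sv_def using tensor_map2_nonempty[OF sF sG] tensor_map2_free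
    by (intro allI conjI ballI impI) (simp_all add: ev_tensor_map2[OF F G])
  have EV: "EV (\<lambda>h. tensor_map2 i j F G (comult h)) \<Phi> h =
      DD h (\<lambda>x y. EV F (\<lambda>us. EV G (\<lambda>vs. \<Phi> (us @ vs)) y) x)" if "nlin (i + j) \<Phi>" for \<Phi> h
    using ev_tensor_map2[OF F G that sv_some[OF sv]] by (simp add: EV_def)
  then show "nlin (i + j) \<Phi> \<Longrightarrow> EV (\<lambda>h. tensor_map2 i j F G (comult h)) \<Phi> h =
      DD h (\<lambda>x y. EV F (\<lambda>us. EV G (\<lambda>vs. \<Phi> (us @ vs)) y) x)" .
  have "K.lin (EV (\<lambda>h. tensor_map2 i j F G (comult h)) \<Phi>)" if "nlin (i + j) \<Phi>" for \<Phi>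
  proof -
    have "EV (\<lambda>h. tensor_map2 i j F G (comult h)) \<Phi> = (\<lambda>h. DD h (\<lambda>x y. EV F (\<lambda>us. EV G (\<lambda>vs. \<Phi> (us @ vs)) y) x))"
      using EV[OF that] by blast
    then show ?thesis using DD_lin[OF bilin_EV[OF F G that]] by simp
  qed
  with sv show "svl (i + j) (\<lambda>h. tensor_map2 i j F G (comult h))" by (simp add: svl_def)
qed

lemma DD_cong: "(\<And>x y. \<phi> x y = \<psi> x y) \<Longrightarrow> DD h \<phi> = DD h \<psi>"
  by presburger

text \<open>By \<open>coassoc\<close> one representative \<open>q\<close> belongs to both iterated
  coproducts, and evaluating the form on \<open>q\<close> in two ways gives the two sides.\<close>

lemma DD_coassoc:
  assumes "K.trilin F"
  shows "DD h (\<lambda>x z. DD x (\<lambda>u v. F u v z)) = DD h (\<lambda>x y. DD y (\<lambda>v z. F x v z))"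
proof -
  let ?\<Phi> = "\<lambda>xs. F (xs ! 0) (xs ! 1) (xs ! 2)"
  have n: "nlin 3 ?\<Phi>" by (rule nlin_3[OF assms])
  have n21: "nlin (2 + 1) ?\<Phi>" and n12: "nlin (1 + 2) ?\<Phi>"
    using n by (simp_all only: one_plus_numeral add_One numeral_plus_one BitM.simps inc.simps semiring_norm)
  obtain q where q: "q \<in> tensor_map2 2 1 comult (\<lambda>h. pure_tensor [h]) (comult h)"
    using svl_tensor_map2[OF svl_comult svl_pure] unfolding svl_def sv_def by blast
  have "ev ?\<Phi> q = DD h (\<lambda>x z. DD x (\<lambda>u v. F u v z))"
    unfolding ev_tensor_map2[OF svl_comult svl_pure n21 q]
  proof (rule DD_cong)
    fix x y
    have "EV (\<lambda>h. pure_tensor [h]) (\<lambda>vs. ?\<Phi> (us @ vs)) y = F (us ! 0) (us ! 1) y" if "length us = 2" for us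
      by (subst EV_pure[OF nlin_append_left[OF n21 that]]) (use that in \<open>simp add: nth_append\<close>)
    then show "EV comult (\<lambda>us. EV (\<lambda>h. pure_tensor [h]) (\<lambda>vs. ?\<Phi> (us @ vs)) y) x = DD x (\<lambda>u v. F u v y)"
      unfolding DD_def by (intro EV_cong[OF sv_comult])
  qed
  moreover have "ev ?\<Phi> q = DD h (\<lambda>x y. DD y (\<lambda>v z. F x v z))"
    unfolding ev_tensor_map2[OF svl_pure svl_comult n12 q[unfolded coassoc]]
  proof (rule DD_cong)
    fix x y
    have "nlin 1 (\<lambda>us. EV comult (\<lambda>vs. ?\<Phi> (us @ vs)) y)"
      unfolding EV_def by (rule nlin_append[OF n12 sv_some_free[OF sv_comult]])
    then show "EV (\<lambda>h. pure_tensor [h]) (\<lambda>us. EV comult (\<lambda>vs. ?\<Phi> (us @ vs)) y) x = DD y (\<lambda>v z. F x v z)"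
      by (simp add: EV_pure DD_def numeral_2_eq_2)
  qed
  ultimately show ?thesis by simp
qed

lemma DD_mult:
  assumes "K.bilin \<phi>"
  shows "DD (a * b) \<phi> = DD a (\<lambda>x y. DD b (\<lambda>u v. \<phi> (x * u) (y * v)))"
proof -
  obtain p where p: "p \<in> comult a" "p \<in> free_tensors 2" by (rule comult_rep)
  obtain q where q: "q \<in> comult b" "q \<in> free_tensors 2" by (rule comult_rep)
  have len: "length xs = 2" if "xs \<in> Poly_Mapping.keys p \<union> Poly_Mapping.keys q" for xs
    using that p(2) q(2) by (auto simp: free_tensors_def)
  have "fext2 (map2 (*)) p q \<in> free_tensors 2"
    using keys_fext2[of "map2 (*)" p q] len by (fastforce simp: free_tensors_def)
  then have "fext2 (map2 (*)) p q \<in> comult (a * b)"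
    using p(1) q(1) tensor_rel_refl unfolding comult_mult by blast
  then have "DD (a * b) \<phi> = ev (\<lambda>xs. ev (\<lambda>ys. \<phi> (map2 (*) xs ys ! 0) (map2 (*) xs ys ! 1)) q) p"
    using assms by (simp add: DD_rep ev_fext2)
  also have "\<dots> = ev (\<lambda>xs. ev (\<lambda>ys. \<phi> (xs ! 0 * ys ! 0) (xs ! 1 * ys ! 1)) q) p"
    using len by (intro ev_cong) simp
  also have "\<dots> = ev (\<lambda>xs. DD b (\<lambda>u v. \<phi> (xs ! 0 * u) (xs ! 1 * v))) p"
  proof -
    have "K.bilin (\<lambda>u v. \<phi> (x * u) (y * v))" for x y
      using assms by (simp add: K.bilin_def K.lin_def distrib_left scale_mult_right)
    then show ?thesis using DD_rep[OF _ q(1)] by simp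
  qed
  also have "\<dots> = DD a (\<lambda>x y. DD b (\<lambda>u v. \<phi> (x * u) (y * v)))"
  proof (rule DD_rep[OF _ p(1), symmetric])
    have "DD b (\<lambda>x y. f x y + g x y) = DD b f + DD b g" "DD b (\<lambda>x y. c * f x y) = c * DD b f" for f g c
      by (simp_all add: DD_def EV_plus EV_cmult)
    then show "K.bilin (\<lambda>x y. DD b (\<lambda>u v. \<phi> (x * u) (y * v)))"
      using assms by (simp add: K.bilin_def K.lin_def distrib_right scale_mult_left)
  qed
  finally show ?thesis .
qed

lemma DD_one: "K.bilin \<phi> \<Longrightarrow> DD 1 \<phi> = \<phi> 1 1"
  using DD_rep[of \<phi> "Poly_Mapping.single [1, 1] 1" 1] single_pure_tensor by (simp add: comult_one)

lemma counit_lin: "K.lin (\<lambda>h. to_ac (counit h))"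
proof -
  interpret C: Vector_Spaces.linear scale "(*)" counit by (rule counit_linear)
  show ?thesis by (simp add: K.lin_def C.add C.scale)
qed

end

section \<open>The finite-dimensional case\<close>

locale fd_bialgebra = bialgebra scale comult counit + FD: finite_dimensional_vector_space scale Basis
  for scale :: "'k::field \<Rightarrow> 'h::ring_1 \<Rightarrow> 'h" and comult counit Basis
begin

definition cf :: "'h \<Rightarrow> 'h \<Rightarrow> 'k alg_closure" where
  "cf b h = to_ac (representation Basis h b)"

lemma cf_lin: "K.lin (cf b)"
  using FD.independent_Basis FD.span_Basis
  by (simp add: K.lin_def cf_def representation_add representation_scale)

lemma lin_0: assumes "K.lin \<psi>" shows "\<psi> 0 = 0"
proof -
  have "\<psi> (scale 0 0) = to_ac 0 * \<psi> 0" using assms unfolding K.lin_def by blast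
  then show ?thesis by simp
qed

lemma cf_expand:
  assumes "K.lin \<psi>"
  shows "\<psi> h = (\<Sum>b\<in>Basis. cf b h * \<psi> b)"
proof -
  have sum: "\<psi> (\<Sum>b\<in>A. f b) = (\<Sum>b\<in>A. \<psi> (f b))" for A f
    by (induction A rule: infinite_finite_induct) (use assms lin_0[OF assms] in \<open>auto simp: K.lin_def\<close>)
  have "h = (\<Sum>b\<in>Basis. scale (representation Basis h b) b)"
    using sum_representation_eq[OF FD.independent_Basis _ FD.finite_Basis order_refl, of h] FD.span_Basis by simp
  then have "\<psi> h = \<psi> (\<Sum>b\<in>Basis. scale (representation Basis h b) b)" by simp
  also have "\<dots> = (\<Sum>b\<in>Basis. cf b h * \<psi> b)"
    using assms by (simp add: sum K.lin_def cf_def)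
  finally show ?thesis .
qed

lemma lin_separating:
  assumes "h \<noteq> 0" shows "\<exists>\<psi>. K.lin \<psi> \<and> \<psi> h \<noteq> 0"
proof (rule ccontr)
  assume "\<not> ?thesis"
  then have "cf b h = 0" for b using cf_lin by blast
  then have "representation Basis h b = 0" for b by (simp add: cf_def)
  then have "h = 0"
    using sum_representation_eq[OF FD.independent_Basis _ FD.finite_Basis order_refl, of h] FD.span_Basis by simp
  with assms show False by contradiction
qed

lemma lin_eqI: "(\<And>\<psi>. K.lin \<psi> \<Longrightarrow> \<psi> a = \<psi> b) \<Longrightarrow> a = b"
proof (rule ccontr)
  assume *: "\<And>\<psi>. K.lin \<psi> \<Longrightarrow> \<psi> a = \<psi> b" and "a \<noteq> b"
  then obtain \<psi> where \<psi>: "K.lin \<psi>" "\<psi> (a - b) \<noteq> 0" using lin_separating[of "a - b"] by auto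
  have "\<psi> (a - b + b) = \<psi> (a - b) + \<psi> b" using \<psi>(1) unfolding K.lin_def by blast
  then show False using *[OF \<psi>(1)] \<psi>(2) by simp
qed

text \<open>Forms separate points, and each takes one value on all representatives; hence the image
  inside \<open>the_elem\<close> is a singleton.\<close>

lemma tensor_lift_form:
  assumes F: "sv n F" and f: "\<And>\<psi>. K.lin \<psi> \<Longrightarrow> nlin n (\<lambda>xs. \<psi> (f xs))" and \<psi>: "K.lin \<psi>"
  shows "\<psi> (tensor_lift f (F h)) = EV F (\<lambda>xs. \<psi> (f xs)) h"
proof -
  define val where "val p = (\<Sum>xs\<in>Poly_Mapping.keys p. scale (Poly_Mapping.lookup p xs) (f xs))" for p
  have val: "\<psi> (val p) = ev (\<lambda>xs. \<psi> (f xs)) p" if "K.lin \<psi>" for \<psi> p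
  proof -
    have "\<psi> (\<Sum>xs\<in>A. scale (c xs) (f xs)) = (\<Sum>xs\<in>A. to_ac (c xs) * \<psi> (f xs))" for A c
      by (induction A rule: infinite_finite_induct) (use that lin_0[OF that] in \<open>auto simp: K.lin_def\<close>)
    then show ?thesis by (simp add: val_def ev_def)
  qed
  define p where "p = (SOME p. p \<in> F h)"
  have p: "p \<in> F h" unfolding p_def by (rule sv_some[OF F])
  have "val q = val p" if "q \<in> F h" for q
  proof (rule lin_eqI)
    fix \<psi> assume \<psi>: "K.lin \<psi>"
    show "\<psi> (val q) = \<psi> (val p)"
      unfolding val[OF \<psi>] using F p that f[OF \<psi>] unfolding sv_def by blast
  qed
  then have "val ` F h = (\<lambda>_. val p) ` F h" by (rule image_cong[OF refl])
  also have "\<dots> = {val p}" using p by auto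
  finally have "the_elem (val ` F h) = val p" by simp
  then have "tensor_lift f (F h) = val p"
    unfolding tensor_lift_def val_def[abs_def] .
  then show ?thesis using val[OF \<psi>] by (simp add: EV_def p_def)
qed

lemma DD_tensor_lift:
  assumes f: "\<And>\<psi>. K.lin \<psi> \<Longrightarrow> K.bilin (\<lambda>x y. \<psi> (f x y))" and \<psi>: "K.lin \<psi>"
  shows "DD h (\<lambda>x y. \<psi> (f x y)) = \<psi> (tensor_lift (\<lambda>xs. f (xs ! 0) (xs ! 1)) (comult h))"
  using tensor_lift_form[OF sv_comult _ \<psi>, where f = "\<lambda>xs. f (xs ! 0) (xs ! 1)"] nlin_2[OF f]
  by (simp add: DD_def)

text \<open>\<open>DD_tensor_lift\<close> turns the antipode and counit axioms into Sweedler form;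
  the other coalgebra axioms have been verified for \<open>DD\<close>.\<close>

lemma sweedler_antipode:
  assumes S: "Vector_Spaces.linear scale scale S"
    "\<And>h. tensor_lift (\<lambda>xs. S (xs ! 0) * xs ! 1) (comult h) = scale (counit h) 1"
    "\<And>h. tensor_lift (\<lambda>xs. xs ! 0 * S (xs ! 1)) (comult h) = scale (counit h) 1"
  shows "finite_sweedler scale to_ac DD (\<lambda>h. to_ac (counit h)) S Basis cf"
proof -
  interpret S: Vector_Spaces.linear scale scale S by (rule S(1))
  interpret C: Vector_Spaces.linear scale "(*)" counit by (rule counit_linear)
  show ?thesis
  proof
    fix \<psi> :: "'h \<Rightarrow> 'k alg_closure" and h assume \<psi>: "K.lin \<psi>"
    note simps = K.bilin_def K.lin_def distrib_left distrib_right scale_mult_left scale_mult_right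
      S.add S.scale C.add C.scale scale_left_distrib scale_right_distrib
    have unit: "\<psi> (scale c a) = to_ac c * \<psi> a" for c a
      using \<psi> by (simp add: K.lin_def)
    have "DD h (\<lambda>x y. \<psi> (S x * y)) = \<psi> (scale (counit h) 1)"
      unfolding S(2)[symmetric] by (rule DD_tensor_lift[OF _ \<psi>]) (simp add: simps)
    then show "DD h (\<lambda>x y. \<psi> (S x * y)) = to_ac (counit h) * \<psi> 1" by (simp add: unit)
    have "DD h (\<lambda>x y. \<psi> (x * S y)) = \<psi> (scale (counit h) 1)"
      unfolding S(3)[symmetric] by (rule DD_tensor_lift[OF _ \<psi>]) (simp add: simps)
    then show "DD h (\<lambda>x y. \<psi> (x * S y)) = to_ac (counit h) * \<psi> 1" by (simp add: unit)
    have "DD h (\<lambda>x y. \<psi> (scale (counit x) y)) =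
        \<psi> (tensor_lift (\<lambda>xs. scale (counit (xs ! 0)) (xs ! 1)) (comult h))"
      by (rule DD_tensor_lift[OF _ \<psi>]) (simp add: simps mult.commute)
    then have "DD h (\<lambda>x y. \<psi> (scale (counit x) y)) = \<psi> h" by (simp only: counit_left)
    then show "DD h (\<lambda>x y. to_ac (counit x) * \<psi> y) = \<psi> h" by (simp add: unit)
    have "DD h (\<lambda>x y. \<psi> (scale (counit y) x)) =
        \<psi> (tensor_lift (\<lambda>xs. scale (counit (xs ! 1)) (xs ! 0)) (comult h))"
      by (rule DD_tensor_lift[OF _ \<psi>]) (simp add: simps mult.commute)
    then have "DD h (\<lambda>x y. \<psi> (scale (counit y) x)) = \<psi> h" by (simp only: counit_right)
    then show "DD h (\<lambda>x y. to_ac (counit y) * \<psi> x) = \<psi> h" by (simp add: unit)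
    show "\<psi> h = (\<Sum>b\<in>Basis. cf b h * \<psi> b)" by (rule cf_expand[OF \<psi>])
  qed (assumption | rule scale_mult_left scale_mult_right DD_comb DD_lin DD_coassoc DD_mult DD_one counit_lin
      S.add S.scale lin_separating cf_lin FD.finite_Basis | simp add: counit_mult counit_one)+
qed

lemma svl_comult_n: "svl (Suc n) (comult_n (Suc n))"
proof (induction n)
  case 0
  then show ?case using svl_pure by simp
next
  case (Suc n)
  from svl_tensor_map2[OF Suc svl_pure] show ?case by simp
qed

lemma nlin_prod_list:
  assumes "K.lin \<psi>"
  shows "nlin n (\<lambda>xs. \<psi> (prod_list xs))"
proof -
  have "\<psi> (scale c a) = to_ac c * \<psi> a" "\<psi> (a + b) = \<psi> a + \<psi> b" for a b c
    using assms by (simp_all add: K.lin_def)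
  then show ?thesis
    by (simp add: nlin_def distrib_left distrib_right scale_mult_left scale_mult_right)
qed

end

section \<open>Finiteness of the exponent\<close>

theorem (in bialgebra) exp0_finite:
  assumes S: "Vector_Spaces.linear scale scale S"
    "\<And>h. tensor_lift (\<lambda>xs. S (xs ! 0) * xs ! 1) (comult h) = scale (counit h) 1"
    "\<And>h. tensor_lift (\<lambda>xs. xs ! 0 * S (xs ! 1)) (comult h) = scale (counit h) 1"
    and fd: "finite_dimensional_vector_space scale Basis"
    and char: "CHAR('k) > 0"
  shows "exp0 < \<infinity>"
proof -
  interpret FD: finite_dimensional_vector_space scale Basis by (rule fd)
  interpret F: fd_bialgebra scale comult counit Basis ..
  interpret H: finite_sweedler scale to_ac DD "\<lambda>h. to_ac (counit h)" S Basis F.cf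
    by (rule F.sweedler_antipode[OF S])
  interpret S: Vector_Spaces.linear scale scale S by (rule S(1))
  have "inj S"
  proof (rule injI)
    fix a b assume "S a = S b"
    then have "S (a - b) = 0" by (simp add: S.diff)
    then show "a = b" using H.S_injective[of "a - b"] by simp
  qed
  \<comment> \<open>Finite dimension turns injectivity into bijectivity, so the inverse function can
    serve as \<open>R\<close>.\<close>
  then have "surj S" by (rule FD.linear_inj_imp_surj[OF S(1)])
  interpret C: closed_forms scale to_ac DD "\<lambda>h. to_ac (counit h)" S Basis F.cf "inv_into UNIV S"
    by unfold_locales (simp_all add: surj_f_inv_f[OF \<open>surj S\<close>] inv_f_f[OF \<open>inj S\<close>])
  have "\<exists>n>0. \<forall>\<psi> h. K.lin \<psi> \<longrightarrow> C.hpow n \<psi> h = to_ac (counit h) * \<psi> 1"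
  proof (rule C.hopf_power_trivial[OF char])
    have "to_ac (of_nat CHAR('k) :: 'k) = 0" by simp
    then show "of_nat CHAR('k) = (0 :: 'k alg_closure)" by (simp only: to_ac_of_nat)
  qed
  then obtain n where n: "n > 0" "\<And>\<psi> h. K.lin \<psi> \<Longrightarrow> C.hpow n \<psi> h = to_ac (counit h) * \<psi> 1" by blast
  \<comment> \<open>For positive exponents the Hopf power is the composite of
    \<open>comult_n\<close> and \<open>mult_n\<close>, tested on \<open>\<psi>\<close>; both
    recursions split the same tensor factor.\<close>
  have hpow: "C.hpow (Suc n) \<psi> h = EV (comult_n (Suc n)) (\<lambda>xs. \<psi> (prod_list xs)) h" if "K.lin \<psi>" for n \<psi> h
    using that
  proof (induction n arbitrary: \<psi> h)
    case 0
    have "C.hpow (Suc 0) \<psi> h = \<psi> h" using H.D_eps_left[OF 0] by simp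
    also have "\<dots> = EV (\<lambda>h. pure_tensor [h]) (\<lambda>xs. \<psi> (prod_list xs)) h"
      by (subst EV_pure) (simp_all add: F.nlin_prod_list[OF 0])
    finally show ?case by simp
  next
    case (Suc n)
    have lin_y: "K.lin (\<lambda>z. \<psi> (z * y))" for y
      using Suc.prems by (simp add: K.lin_def distrib_right scale_mult_left)
    have "EV (comult_n (Suc (Suc n))) (\<lambda>xs. \<psi> (prod_list xs)) h =
      DD h (\<lambda>x y. EV (comult_n (Suc n)) (\<lambda>us. EV (\<lambda>h. pure_tensor [h]) (\<lambda>vs. \<psi> (prod_list (us @ vs))) y) x)"
      using EV_tensor_map2[OF F.svl_comult_n svl_pure F.nlin_prod_list[OF Suc.prems]] by simp
    also have "\<dots> = DD h (\<lambda>x y. EV (comult_n (Suc n)) (\<lambda>us. \<psi> (prod_list us * y)) x)"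
    proof -
      have "nlin 1 (\<lambda>vs. \<psi> (prod_list us * prod_list vs))" for us
        by (rule F.nlin_prod_list) (use Suc.prems in \<open>simp add: K.lin_def distrib_left scale_mult_right\<close>)
      then show ?thesis by (simp add: EV_pure)
    qed
    also have "\<dots> = C.hpow (Suc (Suc n)) \<psi> h"
      using Suc.IH[OF lin_y] by simp
    finally show ?case by simp
  qed
  obtain m where m: "n = Suc m" using n(1) by (cases n) auto
  have sv: "sv n (comult_n n)"
    using F.svl_comult_n[of m] by (simp add: svl_def m)
  have "mult_n (comult_n n h) = scale (counit h) 1" for h
  proof (rule F.lin_eqI)
    fix \<psi> :: "'h \<Rightarrow> 'k alg_closure" assume \<psi>: "K.lin \<psi>"
    have "\<psi> (mult_n (comult_n n h)) = EV (comult_n n) (\<lambda>xs. \<psi> (prod_list xs)) h"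
      unfolding mult_n_def
      by (rule F.tensor_lift_form[OF sv F.nlin_prod_list \<psi>])
    also have "\<dots> = to_ac (counit h) * \<psi> 1"
      using n(2)[OF \<psi>] hpow[OF \<psi>] m by simp
    finally show "\<psi> (mult_n (comult_n n h)) = \<psi> (scale (counit h) 1)"
      using \<psi> by (simp add: K.lin_def)
  qed
  then have "exp0 \<le> enat n"
    unfolding exp0_def using n(1) by (intro Inf_lower) auto
  then show ?thesis by (rule order.strict_trans1) simp
qed

theorem proposition4p1:
  fixes scale :: "'k::field \<Rightarrow> 'h::ring_1 \<Rightarrow> 'h"
    and comult :: "'h \<Rightarrow> ('h list \<Rightarrow>\<^sub>0 'k) set"
    and counit :: "'h \<Rightarrow> 'k"
  assumes "hopf_algebra scale comult counit"
    and "\<exists>Basis. finite_dimensional_vector_space scale Basis"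
    and "CHAR('k) > 0"
  shows "bialgebra.exp0 scale comult counit < \<infinity>"
proof -
  interpret hopf_algebra scale comult counit by (rule assms(1))
  obtain S where "Vector_Spaces.linear scale scale S"
    "\<And>h. tensor_lift (\<lambda>xs. S (xs ! 0) * xs ! 1) (comult h) = scale (counit h) 1"
    "\<And>h. tensor_lift (\<lambda>xs. xs ! 0 * S (xs ! 1)) (comult h) = scale (counit h) 1"
    using antipode_exists by blast
  then show ?thesis using assms(2,3) exp0_finite by blast
qed

end
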